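(* Let $m,n\ge 1$ be integers and let $\pi$ be a partition of $\{1,\dots,m+n\}$ such that every component of $\pi$ has at least $n+1$ elements. Let $\psi:\mathbb{N}\to(0,\infty)$ be a function such that $x\mapsto x^{m-1}\psi(x)^n$ is non-increasing on $\mathbb{N}$. If $\sum_{j\ge 1} j^{m-1}\psi(j)^n=\infty$, then for almost every $\Theta\in \mathrm{Mat}_{n,m}(\mathbb{R})$ there exist infinitely many points $(\mathbf{q},\mathbf{p})^t\in P(\pi)$, with $\mathbf{q}\in\mathbb{Z}^m\setminus\{0\}$ and $\mathbf{p}\in\mathbb{Z}^n$, such that $$|\Theta\mathbf{q}+\mathbf{p}|\le\psi(|\mathbf{q}|).$$ Conversely, if $\sum_{j\ge 1} j^{m-1}\psi(j)^n<\infty$, then for almost every $\Theta\in \mathrm{Mat}_{n,m}(\mathbb{R})$ there exist only finitely many $(\mathbf{q},\mathbf{p})^t\in\mathbb{Z}^{m+n}$, with $\mathbf{q}\in\mathbb{Z}^m\setminus\{0\}$, $\mathbf{p}\in\mathbb{Z}^n$, satisfying $|\Theta\mathbf{q}+\mathbf{p}|\le\psi(|\mathbf{q}|)$.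
   Context: $\mathbb{N}=\{1,2,\dots\}$. $\mathrm{Mat}_{n,m}(\mathbb{R})$ is the space of real $n\times m$ matrices; vectors are columns, and $(\mathbf{q},\mathbf{p})^t\in\mathbb{R}^{m+n}$ denotes the column vector obtained by stacking $\mathbf{q}\in\mathbb{R}^m$ above $\mathbf{p}\in\mathbb{R}^n$. $|\cdot|$ is the supremum norm. "Almost every" refers to Lebesgue measure. For a partition $\pi$ of $\{1,\dots,d\}$ whose components $\pi_1,\dots,\pi_k$ each have at least two elements, $P(\pi)$ is the set of $\mathbf{v}=(v_1,\dots,v_d)^t\in\mathbb{Z}^d$ such that for every component $\pi_j$ one has $\gcd(v_i : i\in\pi_j)=1$. *)

theory Defs
  imports "HOL-Analysis.Analysis" "HOL-Library.Disjoint_Sets"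
begin

text \<open>
  The dimensions \<open>m\<close> and \<open>n\<close> are the cardinalities of the finite (hence nonempty) index types
  \<open>'m\<close> and \<open>'n\<close>, so a real \<open>n \<times> m\<close> matrix is an element of \<^typ>\<open>real ^ 'm ^ 'n\<close>, and the sum
  type \<^typ>\<open>'m + 'n\<close> plays the role of \<open>{1, \<dots>, m + n}\<close>: \<open>Inl\<close> indexes the upper \<open>m\<close>
  coordinates of a stacked vector and \<open>Inr\<close> the lower \<open>n\<close> ones.
\<close>

definition stack :: "'a ^ 'm \<Rightarrow> 'a ^ 'n \<Rightarrow> 'a ^ ('m + 'n)" where
  "stack q p = (\<chi> i. case i of Inl j \<Rightarrow> q $ j | Inr k \<Rightarrow> p $ k)"

definition primitive_points :: "'d set set \<Rightarrow> (int ^ 'd) set" where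
  "primitive_points \<pi> = {v. \<forall>B\<in>\<pi>. Gcd ((\<lambda>i. v $ i) ` B) = 1}"

definition real_vec :: "int ^ 'd \<Rightarrow> real ^ 'd" where
  "real_vec v = (\<chi> i. real_of_int (v $ i))"

text \<open>
  The supremum norm of an integer vector as a natural number, so that it can be an argument of
  \<open>\<psi>\<close>. It agrees with the library's \<^const>\<open>infnorm\<close>, see \<open>infnorm_real_vec\<close>.
\<close>

definition int_supnorm :: "int ^ 'd \<Rightarrow> nat" where
  "int_supnorm v = Max (range (\<lambda>i. nat \<bar>v $ i\<bar>))"

lemma infnorm_real_vec: "infnorm (real_vec v) = real (int_supnorm v)"
proof -
  have "infnorm (real_vec v) = Sup {\<bar>real_vec v $ i\<bar> |i. i \<in> UNIV}"
    by (rule infnorm_cart)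
  also have "{\<bar>real_vec v $ i\<bar> |i. i \<in> UNIV} = real ` range (\<lambda>i. nat \<bar>v $ i\<bar>)"
    by (force simp: real_vec_def image_image)
  also have "Sup \<dots> = Max \<dots>"
    by (rule cSup_eq_Max) auto
  also have "\<dots> = real (Max (range (\<lambda>i. nat \<bar>v $ i\<bar>)))"
    by (rule mono_Max_commute [symmetric]) (auto intro: monoI)
  finally show ?thesis
    by (simp add: int_supnorm_def)
qed

end

theory Submission
  imports Defs
begin

text \<open>
  Divergence is a second-moment argument that avoids both ergodicity and zero-one laws. For linearly
  independent integer vectors \<open>q, q'\<close> the sets \<open>{\<Theta>. \<Theta> q \<in> \<int>\<^sup>n + [-\<epsilon>, \<epsilon>]\<^sup>n}\<close> are exactly independent on
  every unit cube: translating \<open>\<Theta>\<close> along a suitable rank-one matrix \<open>u w\<^sup>t\<close> with \<open>w \<bullet> q' = 0 \<noteq> w \<bullet> q\<close> and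
  averaging over \<open>u\<close> decouples the two conditions.

  Intersect the components of \<open>\<pi>\<close> with the \<open>q\<close>-coordinates. If all these blocks have at least two
  elements, use the \<open>q\<close> that are primitive on each block: they have positive density and are pairwise
  independent, which gives full measure at once. Otherwise the size condition forces exactly one
  component to consist of a single coordinate \<open>i\<^sub>0\<close> of \<open>q\<close> together with all coordinates of \<open>p\<close>. On a cube of
  side \<open>2\<^sup>-\<^sup>j\<close> take \<open>q\<close> with \<open>q\<^sub>i\<^sub>0 = 2\<^sup>j\<^sup>+\<^sup>1 r\<close>, where \<open>r\<close> is odd with few divisors: whole periods in the
  column \<open>i\<^sub>0\<close> fit into the cube, so a fixed proportion of it is met with \<open>p\<close> prime to \<open>q\<^sub>i\<^sub>0\<close>. The second
  moment is bounded by the independence above if \<open>m \<ge> 2\<close>, and by counting pairs of distinct reduced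
  fractions if \<open>m = 1\<close>. The resulting lower bound for the measure of the limsup set inside small cubes is
  a fixed fraction of the measure of the cube, hence the complement is null. Convergence is Borel--Cantelli.
\<close>

section \<open>Periodic functions on cubes\<close>

text \<open>A block with two or more coordinates of q can be made primitive through q alone. A block
  with a single one cannot, so there p must be coprime to it. For n = 1 the proportion of such p is
  Euler's phi(q)/q, which has no positive lower bound; this is why the number r is required to have
  few divisors. Part of the measure is still lost to the other p, so the moment method then yields
  only a fixed fraction, and this fraction must be found in all small cubes before it can give full
  measure.

  Exact independence, however, needs the side of the cube times the entries of q to be integers, so
  it is available on unit cubes only. For m >= 2 the passage to a subcube uses the variance over the
  whole unit cube. For m = 1 all q are proportional and no pair is independent; there primitivity
  itself keeps the fractions apart.

  The candidates q depend on j, and their density tends to 0 as j grows. This is harmless: the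
  fraction obtained depends on the divergence of the sum over them, not on its rate.\<close>

definition cube :: "'a::euclidean_space \<Rightarrow> real \<Rightarrow> 'a set" where
  "cube a \<delta> = {x. \<forall>b\<in>Basis. a \<bullet> b \<le> x \<bullet> b \<and> x \<bullet> b < a \<bullet> b + \<delta>}"

lemma cube_borel [measurable]: "cube a \<delta> \<in> sets borel"
  unfolding cube_def by measurable

lemma cube_subset_cbox: "cube a \<delta> \<subseteq> cbox a (a + \<delta> *\<^sub>R One)"
  by (force simp: cube_def mem_box inner_simps)

lemma box_subset_cube: "box a (a + \<delta> *\<^sub>R One) \<subseteq> cube a \<delta>"
  by (auto simp: cube_def mem_box inner_simps less_imp_le)

lemma emeasure_cbox_translate:
  fixes a :: "'a::euclidean_space"
  assumes "\<delta> \<ge> 0"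
  shows "emeasure lborel (cbox a (a + \<delta> *\<^sub>R One)) = ennreal (\<delta> ^ DIM('a))"
  using assms by (subst emeasure_lborel_cbox) (auto simp: inner_simps)

lemma emeasure_cube:
  fixes a :: "'a::euclidean_space"
  assumes "\<delta> \<ge> 0"
  shows "emeasure lborel (cube a \<delta>) = ennreal (\<delta> ^ DIM('a))"
proof -
  have box: "emeasure lborel (box a (a + \<delta> *\<^sub>R One)) = ennreal (\<delta> ^ DIM('a))"
    using assms by (subst emeasure_lborel_box) (auto simp: inner_simps)
  show ?thesis
    using emeasure_mono[where M=lborel, OF cube_subset_cbox[of a \<delta>]]
      emeasure_mono[where M=lborel, OF box_subset_cube[of a \<delta>]]
    by (intro antisym) (simp_all add: assms emeasure_cbox_translate box)
qed

lemma measure_cube: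
  fixes a :: "'a::euclidean_space"
  shows "\<delta> \<ge> 0 \<Longrightarrow> measure lborel (cube a \<delta>) = \<delta> ^ DIM('a)"
  by (simp add: measure_def emeasure_cube)

text \<open>Cubes are half-open so that the translates by multiples of \<delta> along an axis tile
  exactly: the count is 1 at every point, and no null set of boundaries has to be carried
  along.\<close>

lemma cube_translates_partition:
  fixes a :: "'a::euclidean_space"
  assumes \<delta>: "\<delta> > 0" and b: "b \<in> Basis"
    and y: "\<And>b'. b' \<in> Basis \<Longrightarrow> b' \<noteq> b \<Longrightarrow> a \<bullet> b' \<le> y \<bullet> b' \<and> y \<bullet> b' < a \<bullet> b' + \<delta>"
  shows "(\<integral>\<^sup>+k. indicator (cube a \<delta>) (y + (\<delta> * of_int k) *\<^sub>R b) \<partial>count_space UNIV) = (1::ennreal)"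
proof -
  define k0 where "k0 = - \<lfloor>(y \<bullet> b - a \<bullet> b) / \<delta>\<rfloor>"
  have "y + (\<delta> * of_int k) *\<^sub>R b \<in> cube a \<delta> \<longleftrightarrow> k = k0" for k
  proof -
    have "y + (\<delta> * of_int k) *\<^sub>R b \<in> cube a \<delta> \<longleftrightarrow>
        a \<bullet> b \<le> y \<bullet> b + \<delta> * of_int k \<and> y \<bullet> b + \<delta> * of_int k < a \<bullet> b + \<delta>"
      using b y by (auto simp: cube_def inner_simps inner_Basis)
    also have "\<dots> \<longleftrightarrow> \<lfloor>(y \<bullet> b - a \<bullet> b) / \<delta>\<rfloor> = - k"
      using \<delta> by (simp add: floor_eq_iff field_simps)
    finally show ?thesis by (auto simp: k0_def)
  qed
  hence "(\<lambda>k. indicator (cube a \<delta>) (y + (\<delta> * of_int k) *\<^sub>R b) :: ennreal) = indicator {k0}"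
    by (auto simp: indicator_def)
  thus ?thesis by simp
qed

lemma nn_integral_lborel_translate:
  fixes t :: "'a::euclidean_space"
  assumes [measurable]: "f \<in> borel_measurable borel"
  shows "(\<integral>\<^sup>+x. f (x + t) \<partial>lborel) = (\<integral>\<^sup>+x. f x \<partial>lborel)"
proof -
  have "(\<integral>\<^sup>+x. f x \<partial>lborel) = (\<integral>\<^sup>+x. f x \<partial>distr lborel borel ((+) t))"
    by (simp add: lborel_distr_plus)
  also have "\<dots> = (\<integral>\<^sup>+x. f (x + t) \<partial>lborel)"
    by (subst nn_integral_distr) (auto simp: add.commute)
  finally show ?thesis by simp
qed

text \<open>The cube and its shift \<open>D'\<close> are fundamental domains for the same group of
  translations by multiples of \<delta> along \<open>b\<close>. Cutting \<open>D'\<close> into its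
  pieces in the translates of \<open>D\<close> and moving each piece back by periodicity reassembles
  the integral over \<open>D\<close>.\<close>

lemma nn_integral_cube_translate_Basis:
  fixes h :: "'a::euclidean_space \<Rightarrow> ennreal"
  assumes h[measurable]: "h \<in> borel_measurable borel" and b: "b \<in> Basis" and \<delta>: "\<delta> > 0"
    and per: "\<And>x. h (x + \<delta> *\<^sub>R b) = h x"
  shows "(\<integral>\<^sup>+x. h (x + c *\<^sub>R b) * indicator (cube a \<delta>) x \<partial>lborel) =
         (\<integral>\<^sup>+x. h x * indicator (cube a \<delta>) x \<partial>lborel)"
proof -
  have per_nat: "h (x + (\<delta> * of_nat n) *\<^sub>R b) = h x" for x n
  proof (induction n)
    case (Suc n)
    have "x + (\<delta> * of_nat (Suc n)) *\<^sub>R b = (x + (\<delta> * of_nat n) *\<^sub>R b) + \<delta> *\<^sub>R b"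
      by (simp add: algebra_simps)
    with Suc per[of "x + (\<delta> * of_nat n) *\<^sub>R b"] show ?case by metis
  qed simp
  have per_int: "h (x + (\<delta> * of_int k) *\<^sub>R b) = h x" for x k
  proof (cases k)
    case (nonneg n)
    thus ?thesis using per_nat[of x n] by simp
  next
    case (neg n)
    have "h (x + (\<delta> * of_int k) *\<^sub>R b) = h (x + (\<delta> * of_int k) *\<^sub>R b + (\<delta> * of_nat (Suc n)) *\<^sub>R b)"
      by (rule per_nat[symmetric])
    also have "x + (\<delta> * of_int k) *\<^sub>R b + (\<delta> * of_nat (Suc n)) *\<^sub>R b = x"
      using neg by (simp del: of_nat_Suc)
    finally show ?thesis .
  qed
  define D where "D = cube a \<delta>"
  have [measurable]: "D \<in> sets borel" by (simp add: D_def)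
  define D' where "D' = {y. y - c *\<^sub>R b \<in> D}"
  have [measurable]: "D' \<in> sets borel" unfolding D'_def by measurable
  let ?e = "\<lambda>k::int. (\<delta> * of_int k) *\<^sub>R b"
  have coord: "(y + r *\<^sub>R b) \<bullet> b' = y \<bullet> b'" if "b' \<in> Basis" "b' \<noteq> b" for y b' r
    using that b by (simp add: inner_simps inner_Basis)
  have one: "(\<integral>\<^sup>+k. indicator D (y + ?e k) \<partial>count_space UNIV) = (1::ennreal)" if "y \<in> D'" for y
    unfolding D_def
  proof (rule cube_translates_partition[OF \<delta> b])
    fix b' :: 'a assume b': "b' \<in> Basis" "b' \<noteq> b"
    have "y - c *\<^sub>R b \<in> cube a \<delta>" using that by (simp add: D'_def D_def)
    thus "a \<bullet> b' \<le> y \<bullet> b' \<and> y \<bullet> b' < a \<bullet> b' + \<delta>"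
      using b' coord[OF b', of y "-c"] by (auto simp: cube_def)
  qed
  have one': "(\<integral>\<^sup>+k. indicator D' (y - ?e k) \<partial>count_space UNIV) = (1::ennreal)" if "y \<in> D" for y
  proof -
    have "(\<integral>\<^sup>+k. indicator D' (y - ?e k) \<partial>count_space UNIV) =
          (\<integral>\<^sup>+k. indicator D' (y - ?e (-k)) \<partial>count_space UNIV)"
      by (rule nn_integral_bij_count_space[symmetric, of uminus]) (auto intro!: bij_uminus)
    also have "\<dots> = (\<integral>\<^sup>+k. indicator (cube a \<delta>) ((y - c *\<^sub>R b) + ?e k) \<partial>count_space UNIV)"
      by (intro nn_integral_cong) (auto simp: D'_def D_def indicator_def algebra_simps)
    also have "\<dots> = 1"
    proof (rule cube_translates_partition[OF \<delta> b])
      fix b' :: 'a assume b': "b' \<in> Basis" "b' \<noteq> b"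
      thus "a \<bullet> b' \<le> (y - c *\<^sub>R b) \<bullet> b' \<and> (y - c *\<^sub>R b) \<bullet> b' < a \<bullet> b' + \<delta>"
        using that coord[OF b', of y "-c"] by (auto simp: D_def cube_def)
    qed
    finally show ?thesis .
  qed
  have "(\<integral>\<^sup>+x. h (x + c *\<^sub>R b) * indicator D x \<partial>lborel) =
        (\<integral>\<^sup>+x. (\<lambda>y. h y * indicator D' y) (x + c *\<^sub>R b) \<partial>lborel)"
    by (intro nn_integral_cong) (auto simp: D'_def indicator_def)
  also have "\<dots> = (\<integral>\<^sup>+y. h y * indicator D' y \<partial>lborel)"
    by (rule nn_integral_lborel_translate) measurable
  also have "\<dots> = (\<integral>\<^sup>+y. (\<integral>\<^sup>+k. h y * indicator D' y * indicator D (y + ?e k) \<partial>count_space UNIV) \<partial>lborel)"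
    by (intro nn_integral_cong, subst nn_integral_cmult) (auto simp: one split: split_indicator)
  also have "\<dots> = (\<integral>\<^sup>+k. (\<integral>\<^sup>+y. h y * indicator D' y * indicator D (y + ?e k) \<partial>lborel) \<partial>count_space UNIV)"
    by (rule nn_integral_count_space_nn_integral) auto
  also have "\<dots> = (\<integral>\<^sup>+k. (\<integral>\<^sup>+y. h y * indicator D y * indicator D' (y - ?e k) \<partial>lborel) \<partial>count_space UNIV)"
  proof (rule nn_integral_cong)
    fix k :: int
    have "(\<integral>\<^sup>+y. h y * indicator D y * indicator D' (y - ?e k) \<partial>lborel) =
      (\<integral>\<^sup>+y. (\<lambda>y. h y * indicator D y * indicator D' (y - ?e k)) (y + ?e k) \<partial>lborel)"
      by (rule nn_integral_lborel_translate[symmetric]) measurable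
    also have "\<dots> = (\<integral>\<^sup>+y. h y * indicator D' y * indicator D (y + ?e k) \<partial>lborel)"
      by (intro nn_integral_cong) (auto simp: per_int indicator_def)
    finally show "(\<integral>\<^sup>+y. h y * indicator D' y * indicator D (y + ?e k) \<partial>lborel) =
       (\<integral>\<^sup>+y. h y * indicator D y * indicator D' (y - ?e k) \<partial>lborel)" by simp
  qed
  also have "\<dots> = (\<integral>\<^sup>+y. (\<integral>\<^sup>+k. h y * indicator D y * indicator D' (y - ?e k) \<partial>count_space UNIV) \<partial>lborel)"
    by (rule nn_integral_count_space_nn_integral[symmetric]) auto
  also have "\<dots> = (\<integral>\<^sup>+y. h y * indicator D y \<partial>lborel)"
    by (intro nn_integral_cong, subst nn_integral_cmult) (auto simp: one' split: split_indicator)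
  finally show ?thesis by (simp add: D_def)
qed

text \<open>A period is asked for only along the coordinates in which \<open>t\<close> moves. Later
  \<open>t\<close> is a matrix supported in one or two columns, and on a small cube only one column
  has a suitable period.\<close>

lemma nn_integral_cube_translate:
  fixes h :: "'a::euclidean_space \<Rightarrow> ennreal"
  assumes h: "h \<in> borel_measurable borel" and \<delta>: "\<delta> > 0"
    and per: "\<And>b x. b \<in> Basis \<Longrightarrow> t \<bullet> b \<noteq> 0 \<Longrightarrow> h (x + \<delta> *\<^sub>R b) = h x"
  shows "(\<integral>\<^sup>+x. h (x + t) * indicator (cube a \<delta>) x \<partial>lborel) =
         (\<integral>\<^sup>+x. h x * indicator (cube a \<delta>) x \<partial>lborel)"
proof -
  have "(\<integral>\<^sup>+x. h (x + (\<Sum>b\<in>S. (t \<bullet> b) *\<^sub>R b)) * indicator (cube a \<delta>) x \<partial>lborel) =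
         (\<integral>\<^sup>+x. h x * indicator (cube a \<delta>) x \<partial>lborel)" if "finite S" "S \<subseteq> Basis" for S
    using that
  proof (induction S rule: finite_induct)
    case (insert b S)
    let ?s = "\<Sum>b\<in>S. (t \<bullet> b) *\<^sub>R b"
    show ?case
    proof (cases "t \<bullet> b = 0")
      case False
      have [measurable]: "h \<in> borel_measurable borel" by fact
      have "(\<integral>\<^sup>+x. h (x + (\<Sum>b\<in>insert b S. (t \<bullet> b) *\<^sub>R b)) * indicator (cube a \<delta>) x \<partial>lborel) =
        (\<integral>\<^sup>+x. (\<lambda>x. h (x + ?s)) (x + (t \<bullet> b) *\<^sub>R b) * indicator (cube a \<delta>) x \<partial>lborel)"
        using insert.hyps by (intro nn_integral_cong) (simp add: algebra_simps)
      also have "\<dots> = (\<integral>\<^sup>+x. h (x + ?s) * indicator (cube a \<delta>) x \<partial>lborel)"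
      proof (rule nn_integral_cube_translate_Basis[OF _ _ \<delta>])
        show "h (x + \<delta> *\<^sub>R b + ?s) = h (x + ?s)" for x
          using per[OF _ False, of "x + ?s"] insert.prems by (simp add: algebra_simps)
      qed (use insert.prems in auto)
      finally show ?thesis using insert by auto
    qed (use insert in auto)
  qed auto
  from this[of Basis] show ?thesis by (simp add: euclidean_representation)
qed

lemma nn_integral_lborel_affine:
  fixes f :: "'a::euclidean_space \<Rightarrow> ennreal"
  assumes [measurable]: "f \<in> borel_measurable borel" and D: "D > 0"
  shows "(\<integral>\<^sup>+y. f y \<partial>lborel) = ennreal (D ^ DIM('a)) * (\<integral>\<^sup>+x. f (D *\<^sub>R x) \<partial>lborel)"
  using D by (subst lborel_affine[of D 0]) (auto simp: nn_integral_density nn_integral_distr nn_integral_cmult)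

section \<open>Rank-one translations of matrices and decoupling\<close>

definition outer_product :: "real ^ 'n \<Rightarrow> real ^ 'm \<Rightarrow> real ^ 'm ^ 'n" where
  "outer_product u w = (\<chi> r i. u $ r * w $ i)"

lemma outer_product_mult_vec: "outer_product u w *v q = (w \<bullet> q) *\<^sub>R u"
  by (simp add: outer_product_def matrix_vector_mult_def vec_eq_iff inner_vec_def
      sum_distrib_left mult_ac)

lemma borel_measurable_matrix_vector_mult [measurable]:
  "(\<lambda>\<Theta>::real^'m^'n. \<Theta> *v q) \<in> borel_measurable borel"
proof -
  have "linear (\<lambda>\<Theta>::real^'m^'n. \<Theta> *v q)"
    by (auto simp: linear_iff matrix_vector_mult_add_rdistrib scaleR_matrix_vector_assoc)
  thus ?thesis
    by (intro borel_measurable_continuous_onI linear_continuous_on) (simp add: linear_conv_bounded_linear)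
qed

lemma borel_measurable_outer_product [measurable]:
  "(\<lambda>u. outer_product u w) \<in> borel_measurable borel"
proof -
  have "linear (\<lambda>u. outer_product u w)"
    by (auto simp: linear_iff outer_product_def vec_eq_iff algebra_simps)
  thus ?thesis
    by (intro borel_measurable_continuous_onI linear_continuous_on) (simp add: linear_conv_bounded_linear)
qed

text \<open>Translating by \<open>outer_product u w\<close> fixes \<open>g\<close> and moves \<open>\<Theta> *v q\<close> by \<open>D u\<close>; averaging over \<open>u\<close>
  in a cube of side \<open>\<rho> / D\<close> replaces \<open>f\<close> by its mean over one period.\<close>

lemma nn_integral_cube_decouple:
  fixes f :: "real ^ 'n \<Rightarrow> ennreal" and g :: "real ^ 'm ^ 'n \<Rightarrow> ennreal" and q w :: "real ^ 'm"
  assumes f[measurable]: "f \<in> borel_measurable borel" and g[measurable]: "g \<in> borel_measurable borel"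
    and \<delta>: "\<delta> > 0" and \<rho>: "\<rho> > 0" and D: "w \<bullet> q > 0"
    and f_per: "\<And>r y. f (y + \<rho> *\<^sub>R axis r 1) = f y"
    and f_per': "\<And>r i y. w $ i \<noteq> 0 \<Longrightarrow> f (y + (\<delta> * q $ i) *\<^sub>R axis r 1) = f y"
    and g_per: "\<And>r i \<Theta>. w $ i \<noteq> 0 \<Longrightarrow> g (\<Theta> + \<delta> *\<^sub>R axis r (axis i 1)) = g \<Theta>"
    and g_inv: "\<And>u \<Theta>. g (\<Theta> + outer_product u w) = g \<Theta>"
  shows "ennreal (\<rho> ^ CARD('n)) * (\<integral>\<^sup>+\<Theta>. f (\<Theta> *v q) * g \<Theta> * indicator (cube a \<delta>) \<Theta> \<partial>lborel) =
     (\<integral>\<^sup>+y. f y * indicator (cube c \<rho>) y \<partial>lborel) * (\<integral>\<^sup>+\<Theta>. g \<Theta> * indicator (cube a \<delta>) \<Theta> \<partial>lborel)"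
proof -
  define D where "D = w \<bullet> q"
  have D: "D > 0" using D by (simp add: D_def)
  define h where "h = (\<lambda>\<Theta>. f (\<Theta> *v q) * g \<Theta>)"
  have [measurable]: "h \<in> borel_measurable borel" unfolding h_def by measurable
  define I where "I = (\<integral>\<^sup>+\<Theta>. h \<Theta> * indicator (cube a \<delta>) \<Theta> \<partial>lborel)"
  define m where "m = (\<integral>\<^sup>+y. f y * indicator (cube 0 \<rho>) y \<partial>lborel)"
  have Basis_n: "\<exists>r. b = axis r 1" if "b \<in> Basis" for b :: "real^'n"
    using that by (auto simp: Basis_vec_def)
  have m_shift: "(\<integral>\<^sup>+y. f (y + s) * indicator (cube 0 \<rho>) y \<partial>lborel) = m" for s
    unfolding m_def using Basis_n f_per by (intro nn_integral_cube_translate f \<rho>) metis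
  have "(\<integral>\<^sup>+y. f y * indicator (cube c \<rho>) y \<partial>lborel) =
      (\<integral>\<^sup>+y. f (y + c) * indicator (cube c \<rho>) (y + c) \<partial>lborel)"
    by (rule nn_integral_lborel_translate[symmetric]) measurable
  also have "\<dots> = (\<integral>\<^sup>+y. f (y + c) * indicator (cube 0 \<rho>) y \<partial>lborel)"
    by (intro nn_integral_cong) (auto simp: indicator_def cube_def inner_simps)
  also have "\<dots> = m" by (rule m_shift)
  finally have m_c: "(\<integral>\<^sup>+y. f y * indicator (cube c \<rho>) y \<partial>lborel) = m" .
  \<comment> \<open>Substitution y = D u: a cube of side \<open>\<rho> / D\<close> in
    \<open>u\<close> covers one full period, whatever the offset \<open>s\<close>.\<close>
  have inner: "ennreal (D ^ CARD('n)) * (\<integral>\<^sup>+u. f (s + D *\<^sub>R u) * indicator (cube 0 (\<rho> / D)) u \<partial>lborel) = m" for s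
  proof -
    have "m = (\<integral>\<^sup>+y. f (y + s) * indicator (cube 0 \<rho>) y \<partial>lborel)"
      by (rule m_shift[symmetric])
    also have "\<dots> = ennreal (D ^ CARD('n)) *
        (\<integral>\<^sup>+u. f (D *\<^sub>R u + s) * indicator (cube 0 \<rho>) (D *\<^sub>R u) \<partial>lborel)"
      using D by (subst nn_integral_lborel_affine[of _ D]) auto
    also have "(\<lambda>u. indicator (cube 0 \<rho>) (D *\<^sub>R u) :: ennreal) = indicator (cube 0 (\<rho> / D) :: (real^'n) set)"
      using D by (auto simp: fun_eq_iff indicator_def cube_def field_simps zero_le_mult_iff)
    finally show ?thesis by (simp add: add.commute)
  qed
  have shift: "(\<integral>\<^sup>+\<Theta>. f (\<Theta> *v q + D *\<^sub>R u) * g \<Theta> * indicator (cube a \<delta>) \<Theta> \<partial>lborel) = I" for u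
  proof -
    have "(\<integral>\<^sup>+\<Theta>. f (\<Theta> *v q + D *\<^sub>R u) * g \<Theta> * indicator (cube a \<delta>) \<Theta> \<partial>lborel) =
      (\<integral>\<^sup>+\<Theta>. h (\<Theta> + outer_product u w) * indicator (cube a \<delta>) \<Theta> \<partial>lborel)"
      by (simp add: h_def g_inv matrix_vector_mult_add_rdistrib outer_product_mult_vec D_def)
    also have "\<dots> = I" unfolding I_def
    proof (rule nn_integral_cube_translate[OF _ \<delta>])
      \<comment> \<open>Adding \<delta> to the entry (r, i) moves \<open>\<Theta> *v q\<close> by
        \<delta> q_i in coordinate r; \<open>f_per'\<close> and \<open>g_per\<close> cover the
        columns with \<open>w $ i \<noteq> 0\<close>, and only these occur.\<close>
      fix b \<Theta> assume b: "b \<in> Basis" "outer_product u w \<bullet> b \<noteq> 0"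
      then obtain r i where ri: "b = axis r (axis i 1)"
        by (auto simp: Basis_vec_def)
      have "w $ i \<noteq> 0"
        using b(2) by (auto simp: ri inner_axis outer_product_def)
      moreover have "axis r (axis i 1) *v q = (q $ i) *\<^sub>R axis r 1"
        by (auto simp: vec_eq_iff matrix_vector_mult_def axis_def if_distrib[of "\<lambda>x. x * _"] cong: if_cong)
      ultimately show "h (\<Theta> + \<delta> *\<^sub>R b) = h \<Theta>"
        using f_per'[of i "\<Theta> *v q" r] g_per[of i \<Theta> r]
        by (simp add: h_def ri matrix_vector_mult_add_rdistrib scaleR_matrix_vector_assoc[symmetric])
    qed simp
    finally show ?thesis .
  qed
  \<comment> \<open>By \<open>shift\<close> the integral equals \<open>I\<close> for every
    \<open>u\<close>, so integrating over a cube of \<open>u\<close> multiplies it by a volume.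
    After Fubini, the integral over \<open>u\<close> is the one in \<open>inner\<close> and is
    constant in \<Theta>.\<close>
  have "ennreal (\<rho> ^ CARD('n)) * I = ennreal (D ^ CARD('n)) * (ennreal ((\<rho> / D) ^ CARD('n)) * I)"
    using D \<rho> by (simp add: mult.assoc[symmetric] ennreal_mult[symmetric] power_mult_distrib[symmetric])
  also have "ennreal ((\<rho> / D) ^ CARD('n)) * I = (\<integral>\<^sup>+u. I * indicator (cube (0::real^'n) (\<rho> / D)) u \<partial>lborel)"
    using D \<rho> by (simp add: nn_integral_cmult emeasure_cube mult.commute)
  also have "\<dots> = (\<integral>\<^sup>+u. (\<integral>\<^sup>+\<Theta>. f (\<Theta> *v q + D *\<^sub>R u) * g \<Theta> * indicator (cube a \<delta>) \<Theta> *
      indicator (cube (0::real^'n) (\<rho> / D)) u \<partial>lborel) \<partial>lborel)"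
    by (intro nn_integral_cong, subst nn_integral_multc) (auto simp: shift)
  also have "\<dots> = (\<integral>\<^sup>+\<Theta>. (\<integral>\<^sup>+u. f (\<Theta> *v q + D *\<^sub>R u) * g \<Theta> * indicator (cube a \<delta>) \<Theta> *
      indicator (cube (0::real^'n) (\<rho> / D)) u \<partial>lborel) \<partial>lborel)"
    by (rule lborel_pair.Fubini') measurable
  also have "\<dots> = (\<integral>\<^sup>+\<Theta>. (\<integral>\<^sup>+u. f (\<Theta> *v q + D *\<^sub>R u) * indicator (cube (0::real^'n) (\<rho> / D)) u \<partial>lborel) *
      (g \<Theta> * indicator (cube a \<delta>) \<Theta>) \<partial>lborel)"
    by (intro nn_integral_cong, subst nn_integral_multc[symmetric]) (auto simp: mult_ac)
  also have "ennreal (D ^ CARD('n)) * \<dots> = (\<integral>\<^sup>+\<Theta>. ennreal (D ^ CARD('n)) * ((\<integral>\<^sup>+u. f (\<Theta> *v q + D *\<^sub>R u) * indicator (cube (0::real^'n) (\<rho> / D)) u \<partial>lborel) *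
      (g \<Theta> * indicator (cube a \<delta>) \<Theta>)) \<partial>lborel)"
    by (rule nn_integral_cmult[symmetric]) measurable
  also have "\<dots> = (\<integral>\<^sup>+\<Theta>. m * (g \<Theta> * indicator (cube a \<delta>) \<Theta>) \<partial>lborel)"
    by (simp add: mult.assoc[symmetric] inner)
  also have "\<dots> = m * (\<integral>\<^sup>+\<Theta>. g \<Theta> * indicator (cube a \<delta>) \<Theta> \<partial>lborel)"
    by (rule nn_integral_cmult) measurable
  finally show ?thesis by (simp add: m_c I_def h_def)
qed

text \<open>The points within sup-distance \<epsilon> of the lattice \<rho> Z^n; \<rho> = 1 is the
  approximation problem itself.\<close>

definition near :: "real \<Rightarrow> real \<Rightarrow> (real ^ 'n) set" where
  "near \<rho> \<epsilon> = {y. \<exists>p::int^'n. \<forall>r. \<bar>y $ r + \<rho> * of_int (p $ r)\<bar> \<le> \<epsilon>}"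

lemma near_borel [measurable]: "near \<rho> \<epsilon> \<in> sets borel"
proof -
  have "near \<rho> \<epsilon> = (\<Union>p::int^'n. {y. \<forall>r. \<bar>y $ r + \<rho> * of_int (p $ r)\<bar> \<le> \<epsilon>})"
    by (auto simp: near_def)
  also have "\<dots> \<in> sets borel"
    by (intro sets.countable_UN'' borel_closed closed_Collect_all closed_Collect_le continuous_intros)
      (auto intro: countableI_type)
  finally show ?thesis .
qed

lemma near_translate: "y + (\<rho> * of_int z) *\<^sub>R axis r 1 \<in> near \<rho> \<epsilon> \<longleftrightarrow> y \<in> near \<rho> \<epsilon>"
proof -
  have *: "y + (\<rho> * of_int z) *\<^sub>R axis r 1 \<in> near \<rho> \<epsilon>" if "y \<in> near \<rho> \<epsilon>" for y z
  proof -
    from that obtain p :: "int ^ 'a" where p: "\<forall>r. \<bar>y $ r + \<rho> * of_int (p $ r)\<bar> \<le> \<epsilon>"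
      by (auto simp: near_def)
    have "(y + (\<rho> * of_int z) *\<^sub>R axis r 1) $ r' + \<rho> * of_int ((p - axis r z) $ r') = y $ r' + \<rho> * of_int (p $ r')" for r'
      by (simp add: axis_def algebra_simps)
    with p show ?thesis unfolding near_def mem_Collect_eq by metis
  qed
  from *[of y z] *[of "y + (\<rho> * of_int z) *\<^sub>R axis r 1" "-z"] show ?thesis
    by auto
qed

text \<open>The period cell is centred at the origin: since \<epsilon> < \<rho> / 2, the
  neighbourhoods of nonzero lattice points stay outside it, and a single cube of side 2 \<epsilon>
  remains.\<close>

lemma nn_integral_near_cube:
  fixes \<epsilon> \<rho> :: real
  assumes "0 \<le> \<epsilon>" "\<epsilon> < \<rho> / 2"
  shows "(\<integral>\<^sup>+y. indicator (near \<rho> \<epsilon>) y * indicator (cube ((- \<rho> / 2) *\<^sub>R One) \<rho>) (y :: real ^ 'n) \<partial>lborel) =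
    ennreal ((2 * \<epsilon>) ^ CARD('n))" (is "?I = _")
proof -
  let ?C = "cube ((- \<rho> / 2) *\<^sub>R One) \<rho> :: (real^'n) set"
  have OneI: "(One :: real^'n) \<bullet> axis r 1 = 1" for r
    by (rule inner_sum_Basis) (simp add: axis_in_Basis_iff)
  have Bas: "(\<forall>b\<in>Basis. P b) \<longleftrightarrow> (\<forall>r. P (axis r 1))" for P :: "real^'n \<Rightarrow> bool"
    by (auto simp: Basis_vec_def)
  have comp: "(c *\<^sub>R One) \<bullet> (axis r 1 :: real^'n) = c" "y \<bullet> axis r 1 = y $ r" for r c and y :: "real^'n"
    by (simp only: inner_scaleR_left OneI) (simp_all add: inner_axis)
  have mem: "y \<in> ?C \<longleftrightarrow> (\<forall>r. - \<rho> / 2 \<le> y $ r \<and> y $ r < \<rho> / 2)" for y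
    by (simp add: cube_def Bas comp del: scaleR_minus_left)
  have memc: "y \<in> cbox ((-\<epsilon>) *\<^sub>R One) (\<epsilon> *\<^sub>R One) \<longleftrightarrow> (\<forall>r. -\<epsilon> \<le> y $ r \<and> y $ r \<le> \<epsilon>)" for y :: "real^'n"
    by (simp add: mem_box Bas comp del: scaleR_minus_left)
  have "near \<rho> \<epsilon> \<inter> ?C = cbox ((-\<epsilon>) *\<^sub>R One) (\<epsilon> *\<^sub>R One)"
  proof (intro equalityI subsetI)
    fix y assume y: "y \<in> near \<rho> \<epsilon> \<inter> ?C"
    then obtain p :: "int^'n" where p: "\<And>r. \<bar>y $ r + \<rho> * of_int (p $ r)\<bar> \<le> \<epsilon>"
      by (auto simp: near_def)
    have "\<bar>y $ r\<bar> \<le> \<epsilon>" for r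
    proof -
      have "-\<rho>/2 \<le> y $ r" "y $ r < \<rho> / 2" using y mem by auto
      hence "\<bar>\<rho> * of_int (p $ r)\<bar> < \<rho> * 1"
        using p[of r] assms(2) by linarith
      hence "\<bar>of_int (p $ r) :: real\<bar> < 1"
        using assms by (simp add: abs_mult)
      hence "p $ r = 0" by linarith
      thus ?thesis using p[of r] by simp
    qed
    thus "y \<in> cbox ((-\<epsilon>) *\<^sub>R One) (\<epsilon> *\<^sub>R One)"
      unfolding memc by (auto simp: abs_le_iff minus_le_iff)
  next
    fix y assume "y \<in> cbox ((-\<epsilon>) *\<^sub>R One) (\<epsilon> *\<^sub>R One :: real^'n)"
    hence y: "- \<epsilon> \<le> y $ r \<and> y $ r \<le> \<epsilon>" for r
      unfolding memc by blast
    have "y \<in> near \<rho> \<epsilon>"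
      unfolding near_def using y by (auto intro!: exI[of _ 0] simp: abs_le_iff minus_le_iff)
    moreover have "y \<in> ?C" unfolding mem using y assms(2) by (smt (verit) field_sum_of_halves)
    ultimately show "y \<in> near \<rho> \<epsilon> \<inter> ?C" by blast
  qed
  hence "?I = emeasure lborel (cbox ((-\<epsilon>) *\<^sub>R One) (\<epsilon> *\<^sub>R One :: real^'n))"
    by (subst indicator_inter_arith[symmetric]) simp
  also have "\<dots> = ennreal ((2 * \<epsilon>) ^ CARD('n))"
  proof -
    have "(\<epsilon> *\<^sub>R One - (-\<epsilon>) *\<^sub>R One) \<bullet> b = 2 * \<epsilon>" if "b \<in> Basis" for b :: "real^'n"
      by (simp only: inner_diff_left inner_scaleR_left inner_sum_Basis[OF that])
    moreover have "(-\<epsilon>) *\<^sub>R One \<bullet> b \<le> \<epsilon> *\<^sub>R One \<bullet> b" if "b \<in> Basis" for b :: "real^'n"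
      using assms by (simp only: inner_scaleR_left inner_sum_Basis[OF that])
    ultimately show ?thesis
      by (subst emeasure_lborel_cbox) (simp_all del: scaleR_minus_left)
  qed
  finally show ?thesis .
qed

lemma real_vec_nth [simp]: "real_vec v $ i = of_int (v $ i)"
  by (simp add: real_vec_def)

lemma infnorm_le_iff_component: "infnorm (x :: real ^ 'n) \<le> e \<longleftrightarrow> (\<forall>i. \<bar>x $ i\<bar> \<le> e)"
proof
  assume "infnorm x \<le> e"
  thus "\<forall>i. \<bar>x $ i\<bar> \<le> e"
    using component_le_infnorm_cart[of x] by (meson order_trans)
next
  assume *: "\<forall>i. \<bar>x $ i\<bar> \<le> e"
  have "infnorm x = Sup {\<bar>x $ i\<bar> |i. i \<in> UNIV}" by (rule infnorm_cart)
  also have "\<dots> \<le> e" by (rule cSup_least) (use * in auto)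
  finally show "infnorm x \<le> e" .
qed

definition near_set :: "int ^ 'm \<Rightarrow> real \<Rightarrow> real \<Rightarrow> (real ^ 'm ^ 'n) set" where
  "near_set q \<rho> \<epsilon> = {\<Theta>. \<Theta> *v real_vec q \<in> near \<rho> \<epsilon>}"

lemma near_set_borel [measurable]: "near_set q \<rho> \<epsilon> \<in> sets borel"
  unfolding near_set_def by measurable

lemma indicator_near_set: "indicator (near_set q \<rho> \<epsilon>) \<Theta> = indicator (near \<rho> \<epsilon>) (\<Theta> *v real_vec q)"
  by (simp add: indicator_def near_set_def)

text \<open>Decoupling with \<open>g\<close> constant and \<open>w\<close> supported in column
  \<open>i\<close>. The last hypothesis says that whole periods fit: crossing the cube in an entry
  of that column changes \<open>\<Theta> *v real_vec q\<close> by a multiple of \<rho>. This gives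
  exact values on cubes smaller than the unit cube.\<close>

lemma emeasure_near_set_cube:
  fixes q :: "int ^ 'm" and a :: "real ^ 'm ^ 'n"
  assumes "\<delta> > 0" "\<rho> > 0" "0 \<le> \<epsilon>" "\<epsilon> < \<rho> / 2" "q $ i \<noteq> 0" "\<delta> * of_int (q $ i) = \<rho> * of_int z"
  shows "ennreal (\<rho> ^ CARD('n)) * emeasure lborel (near_set q \<rho> \<epsilon> \<inter> cube a \<delta>) =
     ennreal ((2 * \<epsilon>) ^ CARD('n)) * ennreal (\<delta> ^ (CARD('n) * CARD('m)))"
proof -
  define w :: "real ^ 'm" where "w = axis i (of_int (sgn (q $ i)))"
  have w_nz: "w $ j \<noteq> 0 \<longleftrightarrow> j = i" for j
    using assms(5) by (auto simp: w_def axis_def sgn_if)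
  have "w \<bullet> real_vec q = \<bar>of_int (q $ i)\<bar>"
    by (simp add: w_def inner_axis' flip: of_int_mult of_int_abs) (simp add: mult.commute abs_sgn)
  hence w: "w \<bullet> real_vec q > 0" using assms(5) by simp
  have *: "ennreal (\<rho> ^ CARD('n)) * (\<integral>\<^sup>+\<Theta>. indicator (near \<rho> \<epsilon>) (\<Theta> *v real_vec q) * 1 * indicator (cube a \<delta>) \<Theta> \<partial>lborel) =
     (\<integral>\<^sup>+y. indicator (near \<rho> \<epsilon>) (y::real^'n) * indicator (cube ((- \<rho> / 2) *\<^sub>R One) \<rho>) y \<partial>lborel) *
     (\<integral>\<^sup>+\<Theta>. 1 * indicator (cube a \<delta>) \<Theta> \<partial>lborel)"
  proof (rule nn_integral_cube_decouple[where w = w and f = "indicator (near \<rho> \<epsilon>)" and g = "\<lambda>_. 1"])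
    show "(indicator (near \<rho> \<epsilon>) (y + \<rho> *\<^sub>R axis r 1) :: ennreal) = indicator (near \<rho> \<epsilon>) y" for y r
      using near_translate[of y \<rho> 1 r \<epsilon>] by (simp add: indicator_def)
    show "(indicator (near \<rho> \<epsilon>) (y + (\<delta> * real_vec q $ j) *\<^sub>R axis r 1) :: ennreal) = indicator (near \<rho> \<epsilon>) y"
      if "w $ j \<noteq> 0" for y r j
      using near_translate[of y \<rho> z r \<epsilon>] assms(6) that w_nz by (simp add: indicator_def)
  qed (use assms w in auto)
  have "ennreal (\<rho> ^ CARD('n)) * (\<integral>\<^sup>+\<Theta>. indicator (near_set q \<rho> \<epsilon>) \<Theta> * indicator (cube a \<delta>) \<Theta> \<partial>lborel) =
     ennreal ((2 * \<epsilon>) ^ CARD('n)) * ennreal (\<delta> ^ (CARD('n) * CARD('m)))"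
    using *[unfolded nn_integral_near_cube[OF assms(3,4)]] assms(1) by (simp add: indicator_near_set emeasure_cube)
  thus ?thesis
    by (subst (asm) indicator_inter_arith[symmetric]) simp
qed

lemma measure_near_set_cube:
  fixes q :: "int ^ 'm" and a :: "real ^ 'm ^ 'n"
  assumes "\<delta> > 0" "\<rho> > 0" "0 \<le> \<epsilon>" "\<epsilon> < \<rho> / 2" "q $ i \<noteq> 0" "\<delta> * of_int (q $ i) = \<rho> * of_int z"
  shows "measure lborel (near_set q \<rho> \<epsilon> \<inter> cube a \<delta>) =
     (2 * \<epsilon> / \<rho>) ^ CARD('n) * measure lborel (cube a \<delta>)"
proof -
  have "enn2real (ennreal (\<rho> ^ CARD('n)) * emeasure lborel (near_set q \<rho> \<epsilon> \<inter> cube a \<delta>)) =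
    \<rho> ^ CARD('n) * measure lborel (near_set q \<rho> \<epsilon> \<inter> cube a \<delta>)"
    using assms by (simp add: measure_def enn2real_mult)
  moreover have "enn2real (ennreal ((2 * \<epsilon>) ^ CARD('n)) * ennreal (\<delta> ^ (CARD('n) * CARD('m)))) =
     (2 * \<epsilon>) ^ CARD('n) * \<delta> ^ (CARD('n) * CARD('m))"
    using assms by (simp add: enn2real_mult)
  ultimately have "\<rho> ^ CARD('n) * measure lborel (near_set q \<rho> \<epsilon> \<inter> cube a \<delta>) =
     (2 * \<epsilon>) ^ CARD('n) * \<delta> ^ (CARD('n) * CARD('m))"
    using emeasure_near_set_cube[OF assms, of a] by simp
  thus ?thesis using assms by (simp add: measure_cube power_divide field_simps)
qed

text \<open>Decoupling with the second condition as \<open>g\<close>. The vector \<open>w\<close> is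
  orthogonal to \<open>q'\<close>, and its product with \<open>q\<close> is a 2 x 2 minor of the two
  vectors, made positive by the sign \<open>s\<close>. Side 1 makes every column periodic, because q
  and q' are integral.\<close>

lemma measure_near_set_inter:
  fixes q q' :: "int ^ 'm" and a :: "real ^ 'm ^ 'n"
  assumes "0 \<le> \<epsilon>" "\<epsilon> < 1 / 2" "0 \<le> \<epsilon>'" "\<epsilon>' < 1 / 2" "q' $ i \<noteq> 0" "q $ i * q' $ j \<noteq> q $ j * q' $ i"
  shows "measure lborel (near_set q 1 \<epsilon> \<inter> near_set q' 1 \<epsilon>' \<inter> cube a 1) =
     (2 * \<epsilon>) ^ CARD('n) * (2 * \<epsilon>') ^ CARD('n)"
proof -
  define s :: int where "s = sgn (q $ j * q' $ i - q $ i * q' $ j)"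
  have s: "s \<noteq> 0" using assms(6) by (auto simp: s_def sgn_if)
  define w :: "real ^ 'm" where "w = axis j (of_int (s * q' $ i)) - axis i (of_int (s * q' $ j))"
  have "w \<bullet> real_vec q = of_int (s * (q $ j * q' $ i - q $ i * q' $ j))"
    by (simp add: w_def inner_axis' inner_diff_left algebra_simps)
  also have "s * (q $ j * q' $ i - q $ i * q' $ j) = \<bar>q $ j * q' $ i - q $ i * q' $ j\<bar>"
    by (simp add: s_def abs_sgn mult.commute)
  finally have w: "w \<bullet> real_vec q > 0" using assms(6)
    by (metis of_int_0_less_iff right_minus_eq zero_less_abs_iff)
  have w': "w \<bullet> real_vec q' = 0"
    by (simp add: w_def inner_axis' inner_diff_left algebra_simps)
  have ind: "(indicator (near 1 \<epsilon>) (y + of_int z *\<^sub>R axis r 1) :: ennreal) = indicator (near 1 \<epsilon>) y" 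
    for y :: "real^'n" and r z \<epsilon>
    using near_translate[of y 1 z r \<epsilon>] by (simp add: indicator_def)
  have "(\<integral>\<^sup>+\<Theta>. indicator (near 1 \<epsilon>) (\<Theta> *v real_vec q) * indicator (near 1 \<epsilon>') (\<Theta> *v real_vec q') * indicator (cube a 1) \<Theta> \<partial>lborel) =
     ennreal (1 ^ CARD('n)) * (\<integral>\<^sup>+\<Theta>. indicator (near 1 \<epsilon>) (\<Theta> *v real_vec q) * indicator (near 1 \<epsilon>') (\<Theta> *v real_vec q') * indicator (cube a 1) \<Theta> \<partial>lborel)"
    by simp
  also have "\<dots> =
     (\<integral>\<^sup>+y. indicator (near 1 \<epsilon>) (y::real^'n) * indicator (cube ((- 1 / 2) *\<^sub>R One) 1) y \<partial>lborel) *
     (\<integral>\<^sup>+\<Theta>. indicator (near 1 \<epsilon>') (\<Theta> *v real_vec q') * indicator (cube a 1) \<Theta> \<partial>lborel)"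
  proof (rule nn_integral_cube_decouple[where w = w and f = "indicator (near 1 \<epsilon>)"
        and g = "\<lambda>\<Theta>. indicator (near 1 \<epsilon>') (\<Theta> *v real_vec q')"])
    fix r :: 'n and k and \<Theta> :: "real ^ 'm ^ 'n"
    have "axis r (axis k 1) *v real_vec q' = of_int (q' $ k) *\<^sub>R axis r 1"
      by (auto simp: vec_eq_iff matrix_vector_mult_def axis_def if_distrib[of "\<lambda>x. x * _"] cong: if_cong)
    thus "(indicator (near 1 \<epsilon>') ((\<Theta> + 1 *\<^sub>R axis r (axis k 1)) *v real_vec q') :: ennreal) =
         indicator (near 1 \<epsilon>') (\<Theta> *v real_vec q')"
      by (simp add: matrix_vector_mult_add_rdistrib ind)
  qed (use w ind[of _ _ 1] in \<open>auto simp: ind matrix_vector_mult_add_rdistrib outer_product_mult_vec w'\<close>)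
  also have "(\<integral>\<^sup>+y. indicator (near 1 \<epsilon>) (y::real^'n) * indicator (cube ((- 1 / 2) *\<^sub>R One) 1) (y::real^'n) \<partial>lborel) = 
     ennreal ((2 * \<epsilon>) ^ CARD('n))"
    by (rule nn_integral_near_cube) (use assms in auto)
  finally have "emeasure lborel (near_set q 1 \<epsilon> \<inter> near_set q' 1 \<epsilon>' \<inter> cube a 1) =
      ennreal ((2 * \<epsilon>) ^ CARD('n)) * emeasure lborel (near_set q' 1 \<epsilon>' \<inter> cube a 1)"
    by (simp add: indicator_near_set[symmetric] flip: indicator_inter_arith)
  hence "measure lborel (near_set q 1 \<epsilon> \<inter> near_set q' 1 \<epsilon>' \<inter> cube a 1) =
     (2 * \<epsilon>) ^ CARD('n) * measure lborel (near_set q' 1 \<epsilon>' \<inter> cube a 1)"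
    using assms by (simp add: measure_def enn2real_mult)
  thus ?thesis
    using measure_near_set_cube[of 1 1 \<epsilon>' q' i "q' $ i" a] assms by (simp add: measure_cube)
qed

section \<open>Limsup sets of positive measure in all cubes\<close>

text \<open>For every \<open>\<lambda>\<close>, the square of \<open>\<lambda> (\<Sum>q\<in>X. indicator (A q)) - indicator T\<close> has non-negative integral,
  where \<open>T\<close> is the part of \<open>B\<close> covered by the sets far out; \<open>\<lambda> = c / (C * sum s X)\<close> is optimal.\<close>

lemma measure_limsup_ge:
  fixes A :: "'q \<Rightarrow> 'a set" and \<nu> :: "'q \<Rightarrow> nat"
  assumes B: "B \<in> sets M" "emeasure M B < \<infinity>" and Q: "countable Q"
    and A: "\<And>q. q \<in> Q \<Longrightarrow> A q \<in> sets M"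
    and s: "\<And>q. q \<in> Q \<Longrightarrow> 0 \<le> s q" and pos: "0 < c" "0 < C" "0 \<le> C'"
    and lower: "\<And>q. q \<in> Q \<Longrightarrow> c * s q * measure M B \<le> measure M (A q \<inter> B)"
    and upper: "\<And>X. finite X \<Longrightarrow> X \<subseteq> Q \<Longrightarrow>
        (\<Sum>q\<in>X. \<Sum>q'\<in>X. measure M (A q \<inter> A q' \<inter> B)) \<le> C * measure M B * (sum s X)\<^sup>2 + C' * sum s X"
    and diverge: "\<And>k R. \<exists>X. finite X \<and> X \<subseteq> {q\<in>Q. \<nu> q > k} \<and> R \<le> sum s X"
  shows "c\<^sup>2 / C * measure M B \<le> measure M {x\<in>B. \<forall>k. \<exists>q\<in>Q. \<nu> q > k \<and> x \<in> A q}"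
proof -
  define b where "b = measure M B"
  define T where "T = (\<lambda>k. B \<inter> (\<Union>q\<in>{q\<in>Q. \<nu> q > k}. A q))"
  have Tsets: "T k \<in> sets M" for k
    unfolding T_def using A B Q by (intro sets.Int sets.countable_UN') (auto intro: countable_subset)
  have fin: "emeasure M Y < \<infinity>" if "Y \<subseteq> B" "Y \<in> sets M" for Y
    using emeasure_mono[OF that(1) B(1)] B(2) by (simp add: less_le_trans order.strict_trans1)
  have int: "integrable M (\<lambda>x. indicator Y x :: real)" if "Y \<subseteq> B" "Y \<in> sets M" for Y
    using fin[OF that] that by (simp add: integrable_indicator_iff)
  have int_eq: "(LINT x|M. indicator Y x :: real) = measure M Y" if "Y \<subseteq> B" "Y \<in> sets M" for Y
    using that sets.sets_into_space[OF that(2)] by (simp add: Int_absorb2)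
  have key: "2 * l * c * sum s X * b - l\<^sup>2 * (C * b * (sum s X)\<^sup>2 + C' * sum s X) \<le> measure M (T k)"
    if X: "finite X" "X \<subseteq> {q\<in>Q. \<nu> q > k}" and l: "l > 0" for X k l
  proof -
    have XQ: "X \<subseteq> Q" using X by auto
    let ?\<phi> = "\<lambda>x. l\<^sup>2 * (\<Sum>q\<in>X. \<Sum>q'\<in>X. indicator (A q \<inter> A q' \<inter> B) x) - 2 * l * (\<Sum>q\<in>X. indicator (A q \<inter> B) x)
        + indicator (T k) x :: real"
    have "0 \<le> ?\<phi> x" for x
    proof -
      define G where "G = (\<Sum>q\<in>X. indicator (A q \<inter> B) x :: real)"
      have "(\<Sum>q\<in>X. \<Sum>q'\<in>X. indicator (A q \<inter> A q' \<inter> B) x) = G * G"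
        unfolding G_def sum_product by (intro sum.cong) (auto simp: indicator_def)
      \<comment> \<open>All members of \<open>X\<close> have \<open>\<nu> q > k\<close>, so
        \<open>G\<close> vanishes off \<open>T k\<close>.\<close>
      moreover have "G * indicator (T k) x = G"
        unfolding G_def sum_distrib_right
        by (intro sum.cong) (use X in \<open>auto simp: indicator_def T_def\<close>)
      moreover have "indicator (T k) x * indicator (T k) x = (indicator (T k) x :: real)"
        by (simp add: indicator_def)
      moreover have "(l * G - indicator (T k) x)\<^sup>2 =
          l\<^sup>2 * (G * G) - 2 * l * (G * indicator (T k) x) + indicator (T k) x * indicator (T k) x"
        by (simp add: power2_eq_square algebra_simps)
      ultimately have "?\<phi> x = (l * G - indicator (T k) x)\<^sup>2"
        unfolding G_def[symmetric] by (simp only:)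
      thus ?thesis by simp
    qed
    hence "0 \<le> (LINT x|M. ?\<phi> x)" by (intro Bochner_Integration.integral_nonneg) simp
    also have "(LINT x|M. ?\<phi> x) = l\<^sup>2 * (\<Sum>q\<in>X. \<Sum>q'\<in>X. measure M (A q \<inter> A q' \<inter> B))
       - 2 * l * (\<Sum>q\<in>X. measure M (A q \<inter> B)) + measure M (T k)"
    proof -
      have 1: "A q \<inter> B \<subseteq> B" "A q \<inter> B \<in> sets M" "A q \<inter> A q' \<inter> B \<subseteq> B" "A q \<inter> A q' \<inter> B \<in> sets M"
        if "q \<in> X" "q' \<in> X" for q q'
        using that XQ A B by auto
      have 2: "T k \<subseteq> B" by (auto simp: T_def)
      have i1: "integrable M (\<lambda>x. \<Sum>q\<in>X. \<Sum>q'\<in>X. indicator (A q \<inter> A q' \<inter> B) x :: real)"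
        "integrable M (\<lambda>x. \<Sum>q\<in>X. indicator (A q \<inter> B) x :: real)"
        "integrable M (\<lambda>x. indicator (T k) x :: real)"
        by (auto intro!: Bochner_Integration.integrable_sum int 1 2 Tsets)
      have i2: "(LINT x|M. (\<Sum>q\<in>X. \<Sum>q'\<in>X. indicator (A q \<inter> A q' \<inter> B) x :: real)) =
          (\<Sum>q\<in>X. \<Sum>q'\<in>X. measure M (A q \<inter> A q' \<inter> B))"
        by (subst Bochner_Integration.integral_sum, (auto intro!: Bochner_Integration.integrable_sum int 1)[1],
          intro sum.cong refl, subst Bochner_Integration.integral_sum, (auto intro!: int 1)[1],
          intro sum.cong refl int_eq 1)
      have i3: "(LINT x|M. (\<Sum>q\<in>X. indicator (A q \<inter> B) x :: real)) = (\<Sum>q\<in>X. measure M (A q \<inter> B))"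
        by (subst Bochner_Integration.integral_sum, (auto intro!: int 1)[1], intro sum.cong refl int_eq 1)
      have "(LINT x|M. l\<^sup>2 * F x - 2 * l * G x + H x) = l\<^sup>2 * integral\<^sup>L M F - 2 * l * integral\<^sup>L M G + integral\<^sup>L M H"
        if "integrable M F" "integrable M G" "integrable M H" for F G H :: "'a \<Rightarrow> real"
        using that by simp
      from this[OF i1] show ?thesis
        using i2 i3 int_eq[OF 2 Tsets] by simp
    qed
    finally have "2 * l * (\<Sum>q\<in>X. measure M (A q \<inter> B)) - l\<^sup>2 * (\<Sum>q\<in>X. \<Sum>q'\<in>X. measure M (A q \<inter> A q' \<inter> B))
        \<le> measure M (T k)" by simp
    moreover have "l\<^sup>2 * (\<Sum>q\<in>X. \<Sum>q'\<in>X. measure M (A q \<inter> A q' \<inter> B)) \<le> l\<^sup>2 * (C * b * (sum s X)\<^sup>2 + C' * sum s X)"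
      unfolding b_def by (intro mult_left_mono upper X XQ) simp
    moreover have "2 * l * (c * sum s X * b) \<le> 2 * l * (\<Sum>q\<in>X. measure M (A q \<inter> B))"
    proof (intro mult_left_mono)
      have "c * sum s X * b = (\<Sum>q\<in>X. c * s q * b)"
        by (simp add: sum_distrib_left sum_distrib_right)
      also have "\<dots> \<le> (\<Sum>q\<in>X. measure M (A q \<inter> B))"
        unfolding b_def using XQ by (intro sum_mono lower) auto
      finally show "c * sum s X * b \<le> (\<Sum>q\<in>X. measure M (A q \<inter> B))" .
    qed (use l in simp)
    ultimately show ?thesis by (simp add: mult.assoc)
  qed
  have T_ge: "c\<^sup>2 / C * b \<le> measure M (T k)" for k
  proof (rule field_le_epsilon)
    fix e :: real assume e: "e > 0"
    \<comment> \<open>With the optimal \<open>l\<close> the linear term of \<open>upper\<close>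
      costs \<open>c\<^sup>2 * C' / (C\<^sup>2 * S)\<close>, where \<open>S = sum s X\<close>.
      Divergence lets S be so large that this is at most \<open>e\<close>; the maximum with 1 keeps
      S positive.\<close>
    define R where "R = max 1 (c\<^sup>2 * C' / (C\<^sup>2 * e))"
    obtain X where X: "finite X" "X \<subseteq> {q\<in>Q. \<nu> q > k}" "R \<le> sum s X"
      using diverge[of k R] by (elim exE conjE)
    define S where "S = sum s X"
    have S: "S > 0" "c\<^sup>2 * C' / (C\<^sup>2 * e) \<le> S" using X(3) by (auto simp: S_def R_def)
    define l where "l = c / (C * S)"
    have l: "l > 0" using pos S by (simp add: l_def)
    have "2 * l * c * S * b - l\<^sup>2 * (C * b * S\<^sup>2 + C' * S) = c\<^sup>2 / C * b - c\<^sup>2 * C' / (C\<^sup>2 * S)"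
    proof -
      have lS: "l * S = c / C" using S by (simp add: l_def)
      have "2 * l * c * S * b = 2 * (l * S) * c * b" by simp
      moreover have "l\<^sup>2 * (C * b * S\<^sup>2 + C' * S) = (l * S)\<^sup>2 * C * b + (l * S)\<^sup>2 * C' / S"
        using S by (simp add: power2_eq_square algebra_simps)
      moreover have "(c / C)\<^sup>2 * C * b = c\<^sup>2 / C * b" "2 * (c / C) * c * b = 2 * (c\<^sup>2 / C * b)"
        using pos by (simp_all add: power2_eq_square)
      moreover have "(c / C)\<^sup>2 * C' / S = c\<^sup>2 * C' / (C\<^sup>2 * S)"
        by (simp add: power_divide)
      ultimately show ?thesis unfolding lS by simp
    qed
    moreover have "c\<^sup>2 * C' / (C\<^sup>2 * S) \<le> e"
    proof -
      have "c\<^sup>2 * C' \<le> S * (C\<^sup>2 * e)"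
        using S(2) pos e by (simp add: pos_divide_le_eq)
      thus ?thesis using S(1) pos by (simp add: pos_divide_le_eq mult_ac)
    qed
    ultimately show "c\<^sup>2 / C * b \<le> measure M (T k) + e"
      using key[OF X(1,2) l] unfolding S_def by linarith
  qed
  have "{x\<in>B. \<forall>k. \<exists>q\<in>Q. \<nu> q > k \<and> x \<in> A q} = (\<Inter>k. T k)"
    by (auto simp: T_def)
  moreover have "(\<lambda>k. measure M (T k)) \<longlonglongrightarrow> measure M (\<Inter>k. T k)"
  proof (rule Lim_measure_decseq)
    show "decseq T" unfolding T_def decseq_def by force
    show "emeasure M (T k) \<noteq> \<infinity>" for k using fin[of "T k"] Tsets by (auto simp: T_def)
  qed (use Tsets in auto)
  ultimately show ?thesis
    using T_ge by (simp add: b_def) (rule LIMSEQ_le_const, auto)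
qed

section \<open>Full measure from a fixed proportion of all dyadic cubes\<close>

lemma emeasure_Union_le_nn_integral:
  assumes "countable D" "\<And>K. K \<in> D \<Longrightarrow> K \<in> sets M"
  shows "emeasure M (\<Union>D) \<le> (\<integral>\<^sup>+K. emeasure M K \<partial>count_space D)"
proof -
  have [measurable]: "\<Union>D \<in> sets M" using assms by auto
  have "emeasure M (\<Union>D) = (\<integral>\<^sup>+x. indicator (\<Union>D) x \<partial>M)" by simp
  also have "\<dots> \<le> (\<integral>\<^sup>+x. (\<integral>\<^sup>+K. indicator K x \<partial>count_space D) \<partial>M)"
  proof (rule nn_integral_mono)
    fix x
    show "indicator (\<Union>D) x \<le> (\<integral>\<^sup>+K. indicator K x \<partial>count_space D)"
    proof (cases "x \<in> \<Union>D")
      case True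
      then obtain K where K: "K \<in> D" "x \<in> K" by auto
      have "(1::ennreal) = (\<integral>\<^sup>+K'. indicator {K} K' \<partial>count_space D)"
        using K by simp
      also have "\<dots> \<le> (\<integral>\<^sup>+K'. indicator K' x \<partial>count_space D)"
        using K by (intro nn_integral_mono) (auto simp: indicator_def)
      finally show ?thesis using True by simp
    qed simp
  qed
  also have "\<dots> = (\<integral>\<^sup>+K. (\<integral>\<^sup>+x. indicator K x \<partial>M) \<partial>count_space D)"
    using assms by (intro nn_integral_count_space_nn_integral) auto
  also have "\<dots> = (\<integral>\<^sup>+K. emeasure M K \<partial>count_space D)"
    using assms by (intro nn_integral_cong) auto
  finally show ?thesis .
qed

lemma emeasure_cbox_Diff_box: "emeasure lborel (cbox u v - box u v) = 0"
  by (subst emeasure_Diff) (auto simp: emeasure_lborel_cbox_eq emeasure_lborel_box_eq box_subset_cbox box_eq_empty)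

lemma AE_lborel_if_AE_unit_cubes:
  fixes P :: "'a::euclidean_space \<Rightarrow> bool"
  assumes "\<And>a. AE x in lborel. x \<in> cube a 1 \<longrightarrow> P x"
  shows "AE x in lborel. P x"
proof -
  define L :: "'a set" where "L = (\<lambda>f. \<Sum>b\<in>Basis. of_int (f b) *\<^sub>R b) ` (Basis \<rightarrow>\<^sub>E (UNIV :: int set))"
  have "countable L"
    unfolding L_def by (intro countable_image countable_PiE) auto
  hence "AE x in lborel. \<forall>a\<in>L. x \<in> cube a 1 \<longrightarrow> P x"
    using assms by (subst AE_ball_countable) auto
  moreover have "\<exists>a\<in>L. x \<in> cube a 1" for x :: 'a
  proof -
    define f where "f = restrict (\<lambda>b. \<lfloor>x \<bullet> b\<rfloor>) (Basis :: 'a set)"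
    have "(\<Sum>b\<in>Basis. of_int (f b) *\<^sub>R b) \<bullet> b = of_int \<lfloor>x \<bullet> b\<rfloor>" if "b \<in> Basis" for b
      using that by (simp add: f_def)
    moreover have "(\<Sum>b\<in>Basis. of_int (f b) *\<^sub>R b) \<in> L"
      unfolding L_def f_def by (intro imageI) auto
    ultimately show ?thesis
      by (intro bexI[of _ "\<Sum>b\<in>Basis. of_int (f b) *\<^sub>R b"])
        (simp_all add: cube_def less_imp_le real_of_int_floor_add_one_gt)
  qed
  ultimately show ?thesis by (auto elim!: eventually_mono)
qed

text \<open>A substitute for the density theorem. The complement \<open>Z\<close> of
  \<open>W\<close> in a unit cube is covered by non-overlapping dyadic cubes inside an open
  \<open>G\<close> that is larger than \<open>Z\<close> by less than \<open>e\<close>. In each cube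
  \<open>W\<close> takes at least the proportion \<kappa>, and these parts are disjoint and lie in
  \<open>G - Z\<close>, so \<kappa> times the measure of \<open>Z\<close> is at most
  \<open>e\<close>.\<close>

lemma AE_lborel_if_cubes:
  fixes W :: "'a::euclidean_space set"
  assumes W[measurable]: "W \<in> sets borel" and \<kappa>: "\<kappa> > 0"
    and cubes: "\<And>a j. \<kappa> * measure lborel (cube a (1 / 2 ^ j)) \<le> measure lborel (W \<inter> cube a (1 / 2 ^ j))"
  shows "AE x in lborel. x \<in> W"
proof -
  have null: "emeasure lborel (cbox a (a + One) - W) = 0" for a :: 'a
  proof -
    define Z where "Z = cbox a (a + One) - W"
    have Z[measurable]: "Z \<in> sets borel" by (simp add: Z_def)
    have "ennreal \<kappa> * emeasure lborel Z \<le> 0 + ennreal e" if e: "e > 0" for e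
    proof -
      obtain G where G: "open G" "Z \<subseteq> G" "emeasure lborel (G - Z) < ennreal e"
        using outer_regular_lborel[OF Z e] by metis
      \<comment> \<open>The gauge forces every piece of the covering into \<open>G\<close>. The
        starting box has side 1, so the sides of the pieces are powers of 1/2, the only ones about
        which \<open>cubes\<close> speaks.\<close>
      obtain \<D> where \<D>: "countable \<D>"
        "\<And>K. K \<in> \<D> \<Longrightarrow> interior K \<noteq> {} \<and> (\<exists>c d. K = cbox c d)"
        "pairwise (\<lambda>A B. interior A \<inter> interior B = {}) \<D>"
        "\<And>K. K \<in> \<D> \<Longrightarrow> \<exists>x \<in> Z \<inter> K. K \<subseteq> (if x \<in> G then G else UNIV)"
        "\<And>u v. cbox u v \<in> \<D> \<Longrightarrow> \<exists>n. \<forall>i \<in> Basis. v \<bullet> i - u \<bullet> i = ((a + One) \<bullet> i - a \<bullet> i) / 2^n"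
        "Z \<subseteq> \<Union>\<D>"
        by (rule covering_lemma[of Z a "a + One" "\<lambda>x. if x \<in> G then G else UNIV"])
          (auto simp: Z_def gauge_def G box_ne_empty inner_simps)
      have Dsets: "K \<in> sets borel" if "K \<in> \<D>" for K
        using \<D>(2)[OF that] by auto
      have KG: "K \<subseteq> G" if "K \<in> \<D>" for K
        using \<D>(4)[OF that] G(2) by (auto split: if_splits)
      have KW: "ennreal \<kappa> * emeasure lborel K \<le> emeasure lborel (interior K \<inter> W)" if K: "K \<in> \<D>" for K
      proof -
        obtain u v where uv: "K = cbox u v" using \<D>(2)[OF K] by auto
        obtain n where n: "\<And>i. i \<in> Basis \<Longrightarrow> v \<bullet> i - u \<bullet> i = 1 / 2^n"
          using \<D>(5)[of u v] K uv by (auto simp: inner_simps)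
        have v: "v = u + (1 / 2 ^ n) *\<^sub>R One"
        proof (rule euclidean_eqI)
          fix b :: 'a assume b: "b \<in> Basis"
          show "v \<bullet> b = (u + (1 / 2 ^ n) *\<^sub>R One) \<bullet> b"
            using n[OF b] by (simp only: inner_add_left inner_scaleR_left inner_sum_Basis[OF b])
        qed
        have "emeasure lborel K = emeasure lborel (cube u (1 / 2 ^ n))"
          unfolding uv v by (simp add: emeasure_cube emeasure_cbox_translate)
        hence "ennreal \<kappa> * emeasure lborel K = ennreal (\<kappa> * measure lborel (cube u (1 / 2 ^ n)))"
          using \<kappa> by (simp add: emeasure_cube measure_cube ennreal_mult)
        also have "\<dots> \<le> ennreal (measure lborel (W \<inter> cube u (1 / 2 ^ n)))"
          by (intro ennreal_leI cubes)
        also have "\<dots> = emeasure lborel (W \<inter> cube u (1 / 2 ^ n))"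
        proof (rule emeasure_eq_ennreal_measure[symmetric])
          have "emeasure lborel (W \<inter> cube u (1 / 2 ^ n)) \<le> emeasure lborel (cube u (1 / 2 ^ n))"
            by (rule emeasure_mono) auto
          also have "\<dots> < top" by (simp add: emeasure_cube)
          finally show "emeasure lborel (W \<inter> cube u (1 / 2 ^ n)) \<noteq> top" by simp
        qed
        \<comment> \<open>The pieces may share faces, so the null boundary is discarded before their
          intersections with \<open>W\<close> are added up.\<close>
        also have "\<dots> \<le> emeasure lborel ((box u v \<inter> W) \<union> (cbox u v - box u v))"
          using cube_subset_cbox[of u "1 / 2 ^ n"] unfolding v by (intro emeasure_mono) auto
        also have "\<dots> \<le> emeasure lborel (box u v \<inter> W) + emeasure lborel (cbox u v - box u v)"
          by (rule emeasure_subadditive) auto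
        also have "\<dots> = emeasure lborel (interior K \<inter> W)"
          by (simp add: emeasure_cbox_Diff_box uv)
        finally show ?thesis .
      qed
      have "ennreal \<kappa> * emeasure lborel Z \<le> ennreal \<kappa> * emeasure lborel (\<Union>\<D>)"
        using \<D>(1,6) Dsets by (intro mult_left_mono emeasure_mono sets.countable_Union) auto
      also have "\<dots> \<le> ennreal \<kappa> * (\<integral>\<^sup>+K. emeasure lborel K \<partial>count_space \<D>)"
        using \<D>(1) Dsets by (intro mult_left_mono emeasure_Union_le_nn_integral) auto
      also have "\<dots> = (\<integral>\<^sup>+K. ennreal \<kappa> * emeasure lborel K \<partial>count_space \<D>)"
        by (simp add: nn_integral_cmult)
      also have "\<dots> \<le> (\<integral>\<^sup>+K. emeasure lborel (interior K \<inter> W) \<partial>count_space \<D>)"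
        by (intro nn_integral_mono) (auto simp: KW)
      also have "\<dots> = emeasure lborel (\<Union>K\<in>\<D>. interior K \<inter> W)"
        using \<D>(1,3) by (intro emeasure_UN_countable[symmetric])
          (auto simp: disjoint_family_on_def pairwise_def)
      also have "\<dots> \<le> emeasure lborel (G - Z)"
      proof (rule emeasure_mono)
        show "(\<Union>K\<in>\<D>. interior K \<inter> W) \<subseteq> G - Z"
          using KG interior_subset by (fastforce simp: Z_def)
      qed (use G(1) in auto)
      finally show ?thesis using G(3) by simp
    qed
    hence "ennreal \<kappa> * emeasure lborel Z \<le> 0"
      by (rule ennreal_le_epsilon)
    thus ?thesis using \<kappa> by (simp add: Z_def)
  qed
  have "AE x in lborel. x \<in> cube a 1 \<longrightarrow> x \<in> W" for a :: 'a
  proof (rule AE_I[where N = "cbox a (a + One) - W"])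
    show "{x \<in> space lborel. \<not> (x \<in> cube a 1 \<longrightarrow> x \<in> W)} \<subseteq> cbox a (a + One) - W"
      using cube_subset_cbox[of a 1] by auto
  qed (use null in auto)
  thus ?thesis by (rule AE_lborel_if_AE_unit_cubes)
qed

section \<open>Counting vectors\<close>

text \<open>Functions chosen separately on the blocks glue to one function on the whole type.
  \<open>local\<close> says that \<open>P C\<close> reads values on \<open>C\<close> only, so it
  survives the change from a function that is undefined outside \<open>C\<close> to the glued
  one.\<close>

lemma card_PiE_blocks_le:
  fixes \<P> :: "'m::finite set set" and S :: "'b set"
  assumes \<P>: "partition_on UNIV \<P>" and S: "finite S"
    and local: "\<And>C f g. C \<in> \<P> \<Longrightarrow> (\<And>i. i \<in> C \<Longrightarrow> f i = g i) \<Longrightarrow> P C f \<Longrightarrow> P C g"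
  shows "(\<Prod>C\<in>\<P>. card {f \<in> C \<rightarrow>\<^sub>E S. P C f}) \<le> card {f. range f \<subseteq> S \<and> (\<forall>C\<in>\<P>. P C f)}"
proof -
  define blk where "blk = (\<lambda>i. THE C. C \<in> \<P> \<and> i \<in> C)"
  have ex1: "\<exists>!C. C \<in> \<P> \<and> i \<in> C" for i
  proof -
    have "i \<in> \<Union>\<P>" unfolding partition_onD1[OF \<P>, symmetric] by simp
    then obtain C where "C \<in> \<P>" "i \<in> C" by blast
    moreover have "C' = C" if "C' \<in> \<P>" "i \<in> C'" for C'
      using disjointD[OF partition_onD2[OF \<P>], of C' C] that calculation by blast
    ultimately show ?thesis by blast
  qed
  have blk: "blk i \<in> \<P>" "i \<in> blk i" for i
    using theI'[OF ex1[of i]] by (auto simp: blk_def)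
  have blk_eq: "blk i = C" if "C \<in> \<P>" "i \<in> C" for i C
    using ex1[of i] blk[of i] that by blast
  have fin: "finite \<P>" by simp
  define \<Phi> where "\<Phi> = (\<lambda>F i. F (blk i) i :: 'b)"
  have "(\<Prod>C\<in>\<P>. card {f \<in> C \<rightarrow>\<^sub>E S. P C f}) = card (\<Pi>\<^sub>E C\<in>\<P>. {f \<in> C \<rightarrow>\<^sub>E S. P C f})"
    by (rule card_PiE[OF fin, symmetric])
  also have "\<dots> \<le> card {f. range f \<subseteq> S \<and> (\<forall>C\<in>\<P>. P C f)}"
  proof (rule card_inj_on_le[of \<Phi>])
    show "inj_on \<Phi> (\<Pi>\<^sub>E C\<in>\<P>. {f \<in> C \<rightarrow>\<^sub>E S. P C f})"
    proof (rule inj_onI)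
      fix F G assume F: "F \<in> (\<Pi>\<^sub>E C\<in>\<P>. {f \<in> C \<rightarrow>\<^sub>E S. P C f})"
        and G: "G \<in> (\<Pi>\<^sub>E C\<in>\<P>. {f \<in> C \<rightarrow>\<^sub>E S. P C f})" and eq: "\<Phi> F = \<Phi> G"
      show "F = G"
      proof (rule PiE_ext[OF F G])
        fix C assume C: "C \<in> \<P>"
        hence FC: "F C \<in> C \<rightarrow>\<^sub>E S" "G C \<in> C \<rightarrow>\<^sub>E S" using F G by (auto simp: PiE_iff)
        show "F C = G C"
        proof (rule PiE_ext[OF FC])
          fix i assume "i \<in> C"
          thus "F C i = G C i"
            using fun_cong[OF eq, of i] blk_eq[OF C] by (simp add: \<Phi>_def)
        qed
      qed
    qed
    show "\<Phi> ` (\<Pi>\<^sub>E C\<in>\<P>. {f \<in> C \<rightarrow>\<^sub>E S. P C f}) \<subseteq> {f. range f \<subseteq> S \<and> (\<forall>C\<in>\<P>. P C f)}"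
    proof clarsimp
      fix F assume F: "F \<in> (\<Pi>\<^sub>E C\<in>\<P>. {f \<in> C \<rightarrow>\<^sub>E S. P C f})"
      have FC: "F C \<in> C \<rightarrow>\<^sub>E S" "P C (F C)" if "C \<in> \<P>" for C using F that by (auto simp: PiE_iff)
      have "P C (\<Phi> F)" if C: "C \<in> \<P>" for C
        by (rule local[OF C _ FC(2)[OF C]]) (simp add: \<Phi>_def blk_eq[OF C])
      moreover have "\<Phi> F i \<in> S" for i
        using FC(1)[OF blk(1)[of i]] blk(2)[of i] by (auto simp: \<Phi>_def PiE_iff)
      ultimately show "range (\<Phi> F) \<subseteq> S \<and> (\<forall>C\<in>\<P>. P C (\<Phi> F))" by auto
    qed
    have "finite (UNIV \<rightarrow>\<^sub>E S :: ('m \<Rightarrow> 'b) set)" using S by (intro finite_PiE) auto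
    thus "finite {f::'m \<Rightarrow> 'b. range f \<subseteq> S \<and> (\<forall>C\<in>\<P>. P C f)}"
      by (rule finite_subset[rotated]) auto
  qed
  finally show ?thesis .
qed

text \<open>This is the proportion removed by the sieve in \<open>card_coprime_ge\<close>, so it has
  to stay below 1. Telescoping from l = 2 on would give 1; keeping the first term as 1/4 and
  telescoping the others gives 1/4 + 1/2.\<close>

lemma sum_inverse_squares_le: "(\<Sum>l=2..N. 1 / (real l)\<^sup>2) \<le> 3 / 4"
proof -
  have *: "(\<Sum>l=2..N. 1 / (real l)\<^sup>2) \<le> 3 / 4 - 1 / real N" if "N \<ge> 2" for N
    using that
  proof (induction N rule: dec_induct)
    case (step N)
    have "1 / (real (Suc N))\<^sup>2 \<le> 1 / (real N * real (Suc N))"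
      using step.hyps by (intro divide_left_mono) (auto simp: power2_eq_square intro!: mult_right_mono)
    also have "\<dots> = 1 / real N - 1 / real (Suc N)"
      using step.hyps by (simp add: field_simps)
    finally show ?case using step by (simp add: sum.nat_ivl_Suc')
  qed (simp add: power2_eq_square)
  show ?thesis
  proof (cases "N \<ge> 2")
    case True
    have "0 \<le> 1 / real N" by simp
    with *[OF True] show ?thesis by linarith
  qed simp
qed

lemma card_dvd_le: "card {x\<in>{1..N}. l dvd x} \<le> N div l" for N l :: nat
proof (cases "l = 0")
  case False
  have "{x\<in>{1..N}. l dvd x} \<subseteq> (\<lambda>k. l * k) ` {1..N div l}"
  proof
    fix x assume "x \<in> {x\<in>{1..N}. l dvd x}"
    then obtain k where k: "x = l * k" "1 \<le> x" "x \<le> N" by auto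
    hence "k \<le> N div l" using False by (simp add: less_eq_div_iff_mult_less_eq mult.commute)
    thus "x \<in> (\<lambda>k. l * k) ` {1..N div l}" using k by (intro image_eqI[of _ _ k]) (auto intro: Suc_leI gr0I)
  qed
  hence "card {x\<in>{1..N}. l dvd x} \<le> card ((\<lambda>k. l * k) ` {1..N div l})"
    by (intro card_mono) auto
  also have "\<dots> \<le> N div l" by (rule order.trans[OF card_image_le]) auto
  finally show ?thesis .
qed auto

text \<open>A tuple that is not coprime has all entries divisible by some l >= 2, and at most
  \<open>(N / l) ^ k\<close> tuples have that. As \<open>k \<ge> 2\<close>, these add up to at most
  3/4 of all tuples. With a single coordinate only the value 1 would qualify, which is why such a
  block needs another treatment.\<close>

lemma card_coprime_ge:
  fixes C :: "'a set"
  assumes C: "finite C" "card C \<ge> 2"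
  shows "1 / 4 * real N ^ card C \<le> real (card {f \<in> C \<rightarrow>\<^sub>E {1..N}. Gcd (f ` C) = 1})"
proof -
  define k where "k = card C"
  let ?A = "C \<rightarrow>\<^sub>E {1..N}"
  have finA: "finite ?A" using C by (intro finite_PiE) auto
  obtain i where i: "i \<in> C" using C by fastforce
  have "?A - {f \<in> ?A. Gcd (f ` C) = 1} \<subseteq> (\<Union>l\<in>{2..N}. C \<rightarrow>\<^sub>E {x\<in>{1..N}. l dvd x})"
  proof
    fix f assume f: "f \<in> ?A - {f \<in> ?A. Gcd (f ` C) = 1}"
    define l where "l = Gcd (f ` C)"
    have fi: "1 \<le> f i" "f i \<le> N" using f i by (auto simp: PiE_iff)
    have "l dvd f i" using i by (auto simp: l_def)
    moreover from this have "l \<noteq> 0" using fi by auto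
    moreover have "l \<noteq> 1" using f by (auto simp: l_def)
    ultimately have "l \<in> {2..N}" using fi dvd_imp_le[of l "f i"] by auto
    moreover have "f \<in> C \<rightarrow>\<^sub>E {x\<in>{1..N}. l dvd x}" using f by (auto simp: PiE_iff l_def)
    ultimately show "f \<in> (\<Union>l\<in>{2..N}. C \<rightarrow>\<^sub>E {x\<in>{1..N}. l dvd x})" by blast
  qed
  hence "card (?A - {f \<in> ?A. Gcd (f ` C) = 1}) \<le> card (\<Union>l\<in>{2..N}. C \<rightarrow>\<^sub>E {x\<in>{1..N}. l dvd x})"
    using C by (intro card_mono finite_UN_I finite_PiE) auto
  also have "\<dots> \<le> (\<Sum>l=2..N. card (C \<rightarrow>\<^sub>E {x\<in>{1..N}. l dvd x}))"
    by (rule card_UN_le) auto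
  also have "\<dots> = (\<Sum>l=2..N. card {x\<in>{1..N}. l dvd x} ^ k)"
    using C by (simp add: card_PiE k_def)
  finally have "real (card (?A - {f \<in> ?A. Gcd (f ` C) = 1})) \<le> (\<Sum>l=2..N. real (card {x\<in>{1..N}. l dvd x}) ^ k)"
    by (metis (mono_tags, lifting) of_nat_le_iff of_nat_power of_nat_sum sum.cong)
  also have "\<dots> \<le> (\<Sum>l=2..N. real N ^ k * (1 / (real l)\<^sup>2))"
  proof (rule sum_mono)
    fix l assume l: "l \<in> {2..N}"
    have "real (card {x\<in>{1..N}. l dvd x}) \<le> real N / real l"
      using card_dvd_le[of N l] of_nat_div_le_of_nat[where ?'a = real, of N l] by linarith
    hence "real (card {x\<in>{1..N}. l dvd x}) ^ k \<le> (real N / real l) ^ k"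
      by (intro power_mono) auto
    also have "\<dots> = real N ^ k * (1 / real l ^ k)" by (simp add: power_divide)
    also have "\<dots> \<le> real N ^ k * (1 / (real l)\<^sup>2)"
      using l C by (intro mult_left_mono divide_left_mono power_increasing) (auto simp: k_def)
    finally show "real (card {x\<in>{1..N}. l dvd x}) ^ k \<le> real N ^ k * (1 / (real l)\<^sup>2)" .
  qed
  also have "\<dots> \<le> real N ^ k * (3 / 4)"
    unfolding sum_distrib_left[symmetric] by (intro mult_left_mono sum_inverse_squares_le) auto
  finally have "real (card (?A - {f \<in> ?A. Gcd (f ` C) = 1})) \<le> real N ^ k * (3 / 4)" .
  moreover have "card ?A = card (?A - {f \<in> ?A. Gcd (f ` C) = 1}) + card {f \<in> ?A. Gcd (f ` C) = 1}"
    using finA by (subst card_Un_disjoint[symmetric]) (auto intro!: arg_cong[where f = card])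
  hence "real (card ?A) = real (card (?A - {f \<in> ?A. Gcd (f ` C) = 1})) + real (card {f \<in> ?A. Gcd (f ` C) = 1})"
    by (simp only: of_nat_add)
  moreover have "real (card ?A) = real N ^ k" using C by (simp add: card_PiE k_def)
  ultimately show ?thesis unfolding k_def[symmetric] by linarith
qed

text \<open>17/72 = 1/9 + 1/8: the term d = 3 is kept, and the others telescope through (2k + 1)^2
  >= 4k(k + 1).\<close>

lemma sum_inverse_odd_squares_le: "(\<Sum>d\<in>{d\<in>{3..N}. odd d}. 1 / (real d)\<^sup>2) \<le> 17 / 72"
proof -
  have *: "(\<Sum>k=1..K. 1 / (real (2 * k + 1))\<^sup>2) \<le> 17 / 72 - 1 / (4 * (real K + 1))" if "K \<ge> 1" for K
    using that
  proof (induction K rule: dec_induct)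
    case (step K)
    have "1 / (real (2 * Suc K + 1))\<^sup>2 \<le> 1 / (4 * (real K + 1) * (real K + 2))"
      by (intro divide_left_mono mult_pos_pos)
        (auto simp: power2_eq_square algebra_simps intro!: add_pos_nonneg)
    also have "\<dots> = 1 / (4 * (real K + 1)) - 1 / (4 * (real (Suc K) + 1))"
    proof -
      have "1 / (4 * x * (x + 1)) = 1 / (4 * x) - 1 / (4 * (x + 1))" if "x > 0" for x :: real
      proof -
        have e: "1 / (4 * x) = (x + 1) / (4 * x * (x + 1))" "1 / (4 * (x + 1)) = x / (4 * x * (x + 1))"
          using that by simp_all
        show ?thesis unfolding e diff_divide_distrib[symmetric] by simp
      qed
      from this[of "real K + 1"] show ?thesis by (simp add: add.assoc add.commute)
    qed
    finally show ?case using step by (simp add: sum.nat_ivl_Suc')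
  qed (simp add: power2_eq_square)
  have "{d\<in>{3..N}. odd d} \<subseteq> (\<lambda>k. 2 * k + 1) ` {1..Suc N}"
  proof
    fix d assume d: "d \<in> {d\<in>{3..N}. odd d}"
    then obtain k where "d = 2 * k + 1" by (auto elim: oddE)
    with d show "d \<in> (\<lambda>k. 2 * k + 1) ` {1..Suc N}" by auto
  qed
  hence "(\<Sum>d\<in>{d\<in>{3..N}. odd d}. 1 / (real d)\<^sup>2) \<le> (\<Sum>d\<in>(\<lambda>k. 2 * k + 1) ` {1..Suc N}. 1 / (real d)\<^sup>2)"
    by (intro sum_mono2) auto
  also have "\<dots> = (\<Sum>k=1..Suc N. 1 / (real (2 * k + 1))\<^sup>2)"
    by (subst sum.reindex) (auto simp: inj_on_def)
  also have "\<dots> \<le> 17 / 72 - 1 / (4 * (real (Suc N) + 1))" by (rule *) simp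
  also have "\<dots> \<le> 17 / 72" by simp
  finally show ?thesis .
qed

text \<open>The bound \<open>12 / 25\<close> is below \<open>1 / 2\<close>, so that together with the even numerators the numerators sharing
  a factor with \<open>2 ^ Suc j * r\<close> do not exhaust everything, but exceeds \<open>17 / 36\<close>, so that by Markov's
  inequality fewer than all odd \<open>r\<close> violate it.\<close>

definition few_divisors :: "nat \<Rightarrow> bool" where
  "few_divisors r \<longleftrightarrow> odd r \<and> (\<Sum>d | 3 \<le> d \<and> d dvd r. 1 / real d) \<le> 12 / 25"

text \<open>Markov's inequality for the divisor sum over odd r. Its total is at most 17/72 of N,
  with the multiples of d crudely counted among all integers up to N; so at most 17/72 * 25/12 =
  425/864 of N is bad. At least 432/864 is odd, and the difference 7/864 exceeds 1/200.\<close>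

lemma card_few_divisors_ge: "real N / 200 \<le> real (card {r\<in>{1..N}. few_divisors r})"
proof -
  define Od where "Od = {r\<in>{1..N}. odd r}"
  define Bad where "Bad = {r\<in>Od. \<not> few_divisors r}"
  let ?\<sigma> = "\<lambda>r. \<Sum>d | 3 \<le> d \<and> d dvd r. 1 / real d"
  have fin: "finite Od" "finite Bad" by (auto simp: Od_def Bad_def)
  have \<sigma>: "?\<sigma> r = (\<Sum>d\<in>{d\<in>{3..N}. odd d}. if d dvd r then 1 / real d else 0)" if "r \<in> Od" for r
  proof -
    have eq: "{d. 3 \<le> d \<and> d dvd r} = {d \<in> {d\<in>{3..N}. odd d}. d dvd r}"
      using that by (auto simp: Od_def dest: dvd_imp_le)
    show ?thesis unfolding eq by (rule sum.inter_filter) simp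
  qed
  have "12 / 25 * real (card Bad) = (\<Sum>r\<in>Bad. 12 / 25)" by simp
  also have "\<dots> \<le> (\<Sum>r\<in>Bad. ?\<sigma> r)"
    by (intro sum_mono) (auto simp: Bad_def few_divisors_def Od_def)
  also have "\<dots> \<le> (\<Sum>r\<in>Od. ?\<sigma> r)"
    using fin by (intro sum_mono2) (auto simp: Bad_def intro!: sum_nonneg)
  also have "\<dots> = (\<Sum>r\<in>Od. \<Sum>d\<in>{d\<in>{3..N}. odd d}. if d dvd r then 1 / real d else 0)"
    by (intro sum.cong refl \<sigma>)
  also have "\<dots> = (\<Sum>d\<in>{d\<in>{3..N}. odd d}. \<Sum>r\<in>Od. if d dvd r then 1 / real d else 0)"
    by (rule sum.swap)
  also have "\<dots> \<le> (\<Sum>d\<in>{d\<in>{3..N}. odd d}. real N * (1 / (real d)\<^sup>2))"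
  proof (rule sum_mono)
    fix d assume d: "d \<in> {d\<in>{3..N}. odd d}"
    have "(\<Sum>r\<in>Od. if d dvd r then 1 / real d else 0) = real (card {r\<in>Od. d dvd r}) * (1 / real d)"
      using fin by (simp add: sum.inter_filter[symmetric])
    also have "card {r\<in>Od. d dvd r} \<le> card {x\<in>{1..N}. d dvd x}"
      by (intro card_mono) (auto simp: Od_def)
    hence "real (card {r\<in>Od. d dvd r}) * (1 / real d) \<le> (real N / real d) * (1 / real d)"
      using card_dvd_le[of N d] of_nat_div_le_of_nat[where ?'a = real, of N d] by (intro mult_right_mono) auto
    also have "\<dots> = real N * (1 / (real d)\<^sup>2)" by (simp add: power2_eq_square)
    finally show "(\<Sum>r\<in>Od. if d dvd r then 1 / real d else 0) \<le> real N * (1 / (real d)\<^sup>2)" by simp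
  qed
  also have "\<dots> \<le> real N * (17 / 72)"
    unfolding sum_distrib_left[symmetric] by (intro mult_left_mono sum_inverse_odd_squares_le) auto
  finally have bad: "real (card Bad) \<le> real N * (425 / 864)" by simp
  have "(\<lambda>k. 2 * k + 1) ` {..<(N + 1) div 2} \<subseteq> Od"
    by (auto simp: Od_def)
  hence "card ((\<lambda>k::nat. 2 * k + 1) ` {..<(N + 1) div 2}) \<le> card Od"
    using fin by (intro card_mono) auto
  hence "(N + 1) div 2 \<le> card Od" by (subst (asm) card_image) (auto simp: inj_on_def)
  hence "real N / 2 \<le> real (card Od)" by linarith
  moreover have "card Od = card Bad + card {r\<in>{1..N}. few_divisors r}"
    using fin by (subst card_Un_disjoint[symmetric])
      (auto simp: Bad_def Od_def few_divisors_def intro!: arg_cong[where f = card])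
  ultimately show ?thesis using bad by simp
qed

text \<open>Rounding \<open>N / 2 ^ j\<close> down loses at most a factor 2 once
  \<open>N \<ge> 2 ^ j\<close>, hence 400 in place of 200.\<close>

lemma card_few_divisors_multiples_ge:
  assumes "N \<ge> 2 ^ j"
  shows "real N / (400 * 2 ^ j) \<le> real (card {x\<in>{1..N}. \<exists>r. x = 2 ^ j * r \<and> few_divisors r})"
proof -
  let ?n = "N div 2 ^ j"
  have "(\<lambda>r. 2 ^ j * r) ` {r\<in>{1..?n}. few_divisors r} \<subseteq> {x\<in>{1..N}. \<exists>r. x = 2 ^ j * r \<and> few_divisors r}"
    by (auto simp: less_eq_div_iff_mult_less_eq mult.commute)
  hence "card ((\<lambda>r. 2 ^ j * r) ` {r\<in>{1..?n}. few_divisors r}) \<le> card {x\<in>{1..N}. \<exists>r. x = 2 ^ j * r \<and> few_divisors r}"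
    by (intro card_mono) auto
  hence 1: "card {r\<in>{1..?n}. few_divisors r} \<le> card {x\<in>{1..N}. \<exists>r. x = 2 ^ j * r \<and> few_divisors r}"
    by (subst (asm) card_image) (auto simp: inj_on_def)
  have "?n \<ge> 1" using assms by (simp add: Suc_le_eq div_greater_zero_iff)
  have "N < (?n + 1) * 2 ^ j"
    using dividend_less_div_times[of "2 ^ j" N] by (simp add: algebra_simps)
  also have "\<dots> \<le> (2 * ?n) * 2 ^ j" using \<open>?n \<ge> 1\<close> by (intro mult_right_mono) auto
  finally have "real N < real (2 * ?n * 2 ^ j)" by (simp only: of_nat_less_iff)
  hence "real N \<le> 2 * real ?n * 2 ^ j" by simp
  hence "real N / (400 * 2 ^ j) \<le> real ?n / 200" by (simp add: field_simps)
  also have "\<dots> \<le> real (card {r\<in>{1..?n}. few_divisors r})" by (rule card_few_divisors_ge)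
  finally show ?thesis using 1 by linarith
qed

text \<open>The points with \<open>N < \<nu> q \<le> K N\<close> number at least \<open>N ^ m\<close>, so they contribute at least
  \<open>N ^ m * \<phi> (K N)\<close>, which is a fixed fraction of the part of the series between \<open>K N\<close> and \<open>K\<^sup>2 N\<close>.\<close>

lemma diverges_over_positive_density:
  fixes \<nu> :: "'q \<Rightarrow> nat" and \<phi> :: "nat \<Rightarrow> real"
  assumes m: "m \<ge> 1" and c: "c > 0" and \<phi>: "\<And>x. x \<ge> 1 \<Longrightarrow> \<phi> x \<ge> 0"
    and fin: "\<And>N. finite {q\<in>Q. \<nu> q \<le> N}"
    and upper: "\<And>N. card {q\<in>Q. \<nu> q \<le> N} \<le> N ^ m"
    and lower: "\<And>N. N \<ge> N\<^sub>0 \<Longrightarrow> c * real N ^ m \<le> real (card {q\<in>Q. \<nu> q \<le> N})"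
    and anti: "antimono_on {1..} (\<lambda>x. real x ^ (m - 1) * \<phi> x)"
    and diverge: "\<not> summable (\<lambda>j. real (Suc j) ^ (m - 1) * \<phi> (Suc j))"
  shows "\<exists>X. finite X \<and> X \<subseteq> {q\<in>Q. \<nu> q > k} \<and> R \<le> (\<Sum>q\<in>X. \<phi> (\<nu> q))"
proof -
  define a where "a = (\<lambda>x::nat. real x ^ (m - 1) * \<phi> x)"
  have a_anti: "a y \<le> a x" if "1 \<le> x" "x \<le> y" for x y
    using anti that unfolding a_def monotone_on_def by simp
  have a_nn: "0 \<le> a x" if "x \<ge> 1" for x using \<phi>[OF that] by (simp add: a_def)
  have \<phi>_anti: "\<phi> y \<le> \<phi> x" if "1 \<le> x" "x \<le> y" for x y
  proof -
    have "real x ^ (m - 1) * \<phi> y \<le> a y"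
      unfolding a_def using that \<phi>[of y] by (intro mult_right_mono power_mono) auto
    also have "\<dots> \<le> a x" by (rule a_anti[OF that])
    finally show ?thesis using that by (simp add: a_def)
  qed
  \<comment> \<open>\<open>K\<close> is so large that at least \<open>2 * x ^ m\<close> points have
    \<open>\<nu> q \<le> K * x\<close>. At most \<open>x ^ m\<close> of them have
    \<open>\<nu> q \<le> x\<close>, so \<open>x ^ m\<close> remain in between.\<close>
  obtain K :: nat where K: "K \<ge> 2" "c * real K \<ge> 2"
  proof -
    obtain K' :: nat where "real K' > 2 / c" using reals_Archimedean2 by blast
    hence "c * real K' \<ge> 2" using c
      by (simp add: pos_divide_less_eq mult.commute)
    also have "c * real K' \<le> c * real (max 2 K')" using c by (intro mult_left_mono) auto
    finally have "c * real (max 2 K') \<ge> 2" .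
    thus ?thesis using that[of "max 2 K'"] by simp
  qed
  have "real K \<le> real K ^ m" using K m by (intro self_le_power) auto
  hence cK: "c * real K ^ m \<ge> 2" using K(2) c by (smt (verit) mult_left_mono)
  \<comment> \<open>The scales start beyond \<open>N\<^sub>0\<close>, where the density bound holds,
    and beyond \<open>k\<close>, so that all collected points lie in the required tail.\<close>
  define N where "N = (\<lambda>i. K ^ i * max 1 (max N\<^sub>0 k))"
  have N: "N i \<ge> 1" "N i \<ge> N\<^sub>0" "N i \<ge> k" for i
  proof -
    have "N i \<ge> 1 * max 1 (max N\<^sub>0 k)" unfolding N_def using K by (intro mult_right_mono) auto
    thus "N i \<ge> 1" "N i \<ge> N\<^sub>0" "N i \<ge> k" by auto
  qed
  have N_Suc: "N (Suc i) = K * N i" for i by (simp add: N_def)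
  have block: "(\<Sum>j\<in>{K * x..<K * (K * x)}. a j) \<le> real K ^ (m + 1) * (\<Sum>q\<in>{q\<in>Q. x < \<nu> q \<and> \<nu> q \<le> K * x}. \<phi> (\<nu> q))"
    if x: "x \<ge> 1" "x \<ge> N\<^sub>0" for x
  proof -
    have Kx: "1 \<le> K * x" "x \<le> K * x" using x K by (simp_all add: Suc_le_eq)
    have "(\<Sum>j\<in>{K * x..<K * (K * x)}. a j) \<le> (\<Sum>j\<in>{K * x..<K * (K * x)}. a (K * x))"
      using Kx by (intro sum_mono a_anti) auto
    also have "\<dots> \<le> real (K * (K * x)) * a (K * x)"
      using a_nn[OF Kx(1)] by (simp add: mult_right_mono)
    also have "\<dots> = real K ^ (m + 1) * (real x ^ m * \<phi> (K * x))"
      using m by (cases m) (auto simp: a_def power_mult_distrib)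
    also have "real x ^ m * \<phi> (K * x) \<le> (\<Sum>q\<in>{q\<in>Q. x < \<nu> q \<and> \<nu> q \<le> K * x}. \<phi> (\<nu> q))"
    proof -
      have "{q\<in>Q. \<nu> q \<le> K * x} = {q\<in>Q. x < \<nu> q \<and> \<nu> q \<le> K * x} \<union> {q\<in>Q. \<nu> q \<le> x}"
        using order.trans[OF _ Kx(2)] by fastforce
      moreover have "finite {q\<in>Q. x < \<nu> q \<and> \<nu> q \<le> K * x}"
        by (rule finite_subset[OF _ fin[of "K * x"]]) auto
      ultimately have "card {q\<in>Q. \<nu> q \<le> K * x} = card {q\<in>Q. x < \<nu> q \<and> \<nu> q \<le> K * x} + card {q\<in>Q. \<nu> q \<le> x}"
        using fin by (simp add: card_Un_disjoint disjoint_iff)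
      hence "real (card {q\<in>Q. \<nu> q \<le> K * x}) = real (card {q\<in>Q. x < \<nu> q \<and> \<nu> q \<le> K * x}) + real (card {q\<in>Q. \<nu> q \<le> x})"
        by simp
      moreover have "real (card {q\<in>Q. \<nu> q \<le> x}) \<le> real x ^ m"
        using upper[of x] by (metis of_nat_le_iff of_nat_power)
      moreover have "2 * real x ^ m \<le> real (card {q\<in>Q. \<nu> q \<le> K * x})"
      proof -
        have "2 * real x ^ m \<le> (c * real K ^ m) * real x ^ m"
          by (intro mult_right_mono cK) auto
        also have "\<dots> = c * real (K * x) ^ m" by (simp add: power_mult_distrib)
        also have "\<dots> \<le> real (card {q\<in>Q. \<nu> q \<le> K * x})"
          using order.trans[OF x(2) Kx(2)] by (intro lower)
        finally show ?thesis .
      qed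
      ultimately have "real x ^ m \<le> real (card {q\<in>Q. x < \<nu> q \<and> \<nu> q \<le> K * x})" by linarith
      hence "real x ^ m * \<phi> (K * x) \<le> real (card {q\<in>Q. x < \<nu> q \<and> \<nu> q \<le> K * x}) * \<phi> (K * x)"
        using \<phi>[OF Kx(1)] by (rule mult_right_mono)
      also have "\<dots> = (\<Sum>q\<in>{q\<in>Q. x < \<nu> q \<and> \<nu> q \<le> K * x}. \<phi> (K * x))" by simp
      also have "\<dots> \<le> (\<Sum>q\<in>{q\<in>Q. x < \<nu> q \<and> \<nu> q \<le> K * x}. \<phi> (\<nu> q))"
        using x by (intro sum_mono \<phi>_anti) auto
      finally show ?thesis .
    qed
    hence "real K ^ (m + 1) * (real x ^ m * \<phi> (K * x)) \<le>
      real K ^ (m + 1) * (\<Sum>q\<in>{q\<in>Q. x < \<nu> q \<and> \<nu> q \<le> K * x}. \<phi> (\<nu> q))"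
      by (intro mult_left_mono) auto
    finally show ?thesis .
  qed
  define X where "X = (\<lambda>i. {q\<in>Q. N 0 < \<nu> q \<and> \<nu> q \<le> N i})"
  have X_fin: "finite (X i)" for i
    unfolding X_def by (rule finite_subset[OF _ fin[of "N i"]]) auto
  have N_mono: "N 0 \<le> N i" for i
    unfolding N_def using K by (intro mult_right_mono) auto
  have main: "(\<Sum>j\<in>{K * N 0..<K * N i}. a j) \<le> real K ^ (m + 1) * (\<Sum>q\<in>X i. \<phi> (\<nu> q))" for i
  proof (induction i)
    case (Suc i)
    have N_le: "N i \<le> K * N i" using K by simp
    have "{K * N 0..<K * N (Suc i)} = {K * N 0..<K * N i} \<union> {K * N i..<K * (K * N i)}"
      using N_mono[of i] N_le unfolding N_Suc by (intro ivl_disj_un_two(3)[symmetric]) auto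
    hence "(\<Sum>j\<in>{K * N 0..<K * N (Suc i)}. a j) =
        (\<Sum>j\<in>{K * N 0..<K * N i}. a j) + (\<Sum>j\<in>{K * N i..<K * (K * N i)}. a j)"
      by (simp add: sum.union_disjoint ivl_disj_int_two(3))
    also have "\<dots> \<le> real K ^ (m + 1) * (\<Sum>q\<in>X i. \<phi> (\<nu> q)) +
        real K ^ (m + 1) * (\<Sum>q\<in>{q\<in>Q. N i < \<nu> q \<and> \<nu> q \<le> K * N i}. \<phi> (\<nu> q))"
      by (intro add_mono Suc.IH block N)
    also have "\<dots> = real K ^ (m + 1) * (\<Sum>q\<in>X (Suc i). \<phi> (\<nu> q))"
    proof -
      have "X (Suc i) = X i \<union> {q\<in>Q. N i < \<nu> q \<and> \<nu> q \<le> K * N i}"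
        using N_mono[of i] order.trans[OF _ N_le] by (auto simp: X_def N_Suc)
      moreover have "X i \<inter> {q\<in>Q. N i < \<nu> q \<and> \<nu> q \<le> K * N i} = {}" by (auto simp: X_def)
      moreover have "finite {q\<in>Q. N i < \<nu> q \<and> \<nu> q \<le> K * N i}"
        by (rule finite_subset[OF _ fin[of "K * N i"]]) auto
      ultimately show ?thesis by (simp add: sum.union_disjoint X_fin distrib_left)
    qed
    finally show ?case .
  next
    case 0
    have "X 0 = {}" by (auto simp: X_def)
    thus ?case by simp
  qed
  \<comment> \<open>Once a partial sum of the series exceeds \<open>B\<close>, its part from
    \<open>K * N 0\<close> on exceeds \<open>K ^ (m + 1) * R\<close>, and \<open>main\<close> turns
    this into a sum above \<open>R\<close> over the points.\<close>
  define B where "B = (\<Sum>j\<in>{1..<K * N 0}. a j) + real K ^ (m + 1) * R"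
  have "\<exists>n. B < (\<Sum>j<n. a (Suc j))"
  proof (rule ccontr)
    assume "\<nexists>n. B < (\<Sum>j<n. a (Suc j))"
    hence "(\<Sum>j<n. a (Suc j)) \<le> B" for n by (simp add: not_less)
    hence "summable (\<lambda>j. a (Suc j))" by (intro summableI_nonneg_bounded a_nn) auto
    thus False using diverge by (simp add: a_def)
  qed
  then obtain n where n: "B < (\<Sum>j<n. a (Suc j))" by blast
  have "n < 2 ^ n" by (rule less_exp)
  also have "\<dots> \<le> K ^ n" using K by (intro power_mono) auto
  also have "\<dots> \<le> N n" by (simp add: N_def)
  also have "\<dots> \<le> K * N n" using K by simp
  finally have n_le: "n < K * N n" .
  have "(\<Sum>j<n. a (Suc j)) = (\<Sum>j\<in>{1..<Suc n}. a j)"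
    by (rule sum.reindex_bij_witness[of _ "\<lambda>j. j - 1" Suc]) auto
  also have "\<dots> \<le> (\<Sum>j\<in>{1..<K * N 0} \<union> {K * N 0..<K * N n}. a j)"
    using n_le N(1)[of 0] K by (intro sum_mono2) (auto intro!: a_nn simp: Suc_le_eq)
  also have "\<dots> = (\<Sum>j\<in>{1..<K * N 0}. a j) + (\<Sum>j\<in>{K * N 0..<K * N n}. a j)"
    by (intro sum.union_disjoint) auto
  also have "\<dots> \<le> (\<Sum>j\<in>{1..<K * N 0}. a j) + real K ^ (m + 1) * (\<Sum>q\<in>X n. \<phi> (\<nu> q))"
    using main[of n] by simp
  finally have "real K ^ (m + 1) * R < real K ^ (m + 1) * (\<Sum>q\<in>X n. \<phi> (\<nu> q))"
    using n by (simp add: B_def)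
  hence "R \<le> (\<Sum>q\<in>X n. \<phi> (\<nu> q))" using K by (simp add: mult_less_cancel_left)
  moreover have "X n \<subseteq> {q\<in>Q. \<nu> q > k}" using N(3)[of 0] by (auto simp: X_def)
  ultimately show ?thesis using X_fin by blast
qed

section \<open>First and second moments\<close>

text \<open>A vector of fractions in lowest terms determines its common denominator:
  \<open>q\<close> divides \<open>q' * q\<close> and every \<open>q' * P i\<close>, hence also
  \<open>q'\<close> times their gcd, which is 1.\<close>

lemma gcd_eq_1_proportional_imp_eq:
  fixes q q' :: int and P P' :: "'a \<Rightarrow> int"
  assumes "Gcd (insert q (P ` I)) = 1" "Gcd (insert q' (P' ` I)) = 1" "q > 0" "q' > 0"
    and "\<And>i. i \<in> I \<Longrightarrow> P i * q' = P' i * q"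
  shows "q = q'"
proof -
  have *: "q dvd q'" if "Gcd (insert q (P ` I)) = 1" "\<And>i. i \<in> I \<Longrightarrow> P i * q' = P' i * q"
    for q q' :: int and P P' :: "'a \<Rightarrow> int"
  proof -
    have "q dvd Gcd ((*) q' ` insert q (P ` I))"
    proof (rule Gcd_greatest)
      fix x assume "x \<in> (*) q' ` insert q (P ` I)"
      thus "q dvd x"
        using that(2) by (auto simp: mult.commute[of q'])
    qed
    also have "Gcd ((*) q' ` insert q (P ` I)) = normalize (q' * Gcd (insert q (P ` I)))"
      by (rule Gcd_mult)
    finally show ?thesis using that(1) by simp
  qed
  show ?thesis
    using *[OF assms(1,5)] *[OF assms(2), of q P] assms(3-5)
    by (intro zdvd_antisym_nonneg) auto
qed

text \<open>The gcd condition is primitivity on the mixed block, which consists of coordinate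
  \<open>i\<close> of q and all coordinates of p.\<close>

definition prim_near_set :: "int ^ 'm \<Rightarrow> 'm \<Rightarrow> real \<Rightarrow> (real ^ 'm ^ 'n) set" where
  "prim_near_set q i \<epsilon> = {\<Theta>. \<exists>p::int^'n. Gcd (insert (q $ i) (range (\<lambda>r. p $ r))) = 1 \<and>
     infnorm (\<Theta> *v real_vec q + real_vec p) \<le> \<epsilon>}"

lemma mem_near_set_1_iff:
  "\<Theta> \<in> near_set q 1 \<epsilon> \<longleftrightarrow> (\<exists>p::int^'n. infnorm (\<Theta> *v real_vec q + real_vec p) \<le> \<epsilon>)"
  for \<Theta> :: "real ^ 'm ^ 'n"
  by (simp add: near_set_def near_def infnorm_le_iff_component)

lemma prim_near_set_subset: "prim_near_set q i \<epsilon> \<subseteq> near_set q 1 \<epsilon>"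
  by (auto simp: prim_near_set_def mem_near_set_1_iff)

lemma prim_near_set_borel [measurable]: "(prim_near_set q i \<epsilon> :: (real ^ 'm ^ 'n) set) \<in> sets borel"
proof -
  have "(prim_near_set q i \<epsilon> :: (real ^ 'm ^ 'n) set) =
      (\<Union>p\<in>{p. Gcd (insert (q $ i) (range (\<lambda>r. p $ r))) = 1}. {\<Theta>. infnorm (\<Theta> *v real_vec q + real_vec p) \<le> \<epsilon>})"
    by (simp only: prim_near_set_def) blast
  also have "\<dots> \<in> sets borel"
    by (intro sets.countable_UN'') (auto simp: infnorm_le_iff_component)
  finally show ?thesis .
qed

lemma fmeasurable_cube: "0 \<le> \<delta> \<Longrightarrow> cube a \<delta> \<in> fmeasurable lborel"
  by (intro fmeasurableI) (auto simp: emeasure_cube)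

text \<open>\<open>near_set q d \<epsilon>\<close> collects the \<open>\<Theta>\<close> approximated with a numerator divisible by \<open>d\<close>.\<close>

lemma near_set_subset_prim_near_set:
  assumes q: "q $ i = 2 ^ Suc j * int r" and r: "odd r"
  shows "near_set q 1 \<epsilon> \<subseteq> prim_near_set q i \<epsilon> \<union>
    (near_set q 2 \<epsilon> \<union> (\<Union>d\<in>{d. 3 \<le> d \<and> d dvd r}. near_set q (real d) \<epsilon>) :: (real ^ 'm ^ 'n) set)"
proof
  fix \<Theta> :: "real ^ 'm ^ 'n" assume "\<Theta> \<in> near_set q 1 \<epsilon>"
  then obtain p :: "int ^ 'n" where p: "infnorm (\<Theta> *v real_vec q + real_vec p) \<le> \<epsilon>"
    by (auto simp: mem_near_set_1_iff)
  define g where "g = Gcd (insert (q $ i) (range (\<lambda>r. p $ r)))"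
  have g_nn: "g \<ge> 0" by (simp add: g_def)
  have gq: "g dvd q $ i" by (simp add: g_def)
  have gp: "g dvd p $ k" for k unfolding g_def by (rule Gcd_dvd) auto
  have near: "\<Theta> \<in> near_set q (real d) \<epsilon>" if "int d dvd g" for d
  proof -
    have "\<forall>k. \<exists>z. p $ k = int d * z" using that gp by (meson dvd_def dvd_trans)
    then obtain z where "\<And>k. p $ k = int d * z k" by metis
    thus ?thesis using p
      by (auto simp: near_set_def near_def infnorm_le_iff_component intro!: exI[of _ "\<chi> k. z k"])
  qed
  show "\<Theta> \<in> prim_near_set q i \<epsilon> \<union> (near_set q 2 \<epsilon> \<union> (\<Union>d\<in>{d. 3 \<le> d \<and> d dvd r}. near_set q (real d) \<epsilon>))"
  proof (cases "g = 1")
    case True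
    thus ?thesis using p by (auto simp: prim_near_set_def g_def)
  next
    case False
    show ?thesis
    proof (cases "even g")
      case True
      thus ?thesis using near[of 2] by simp
    next
      case odd: False
      hence "coprime g (2 ^ Suc j)" by simp
      hence "g dvd int r" using gq q by (simp add: coprime_dvd_mult_right_iff)
      hence "nat g dvd r" using g_nn by (metis int_dvd_int_iff nat_0_le)
      moreover have "nat g \<ge> 3" using g_nn odd False by (cases "g = 0 \<or> g = 2") auto
      moreover have "\<Theta> \<in> near_set q (real (nat g)) \<epsilon>" using near[of "nat g"] g_nn by simp
      ultimately show ?thesis by blast
    qed
  qed
qed

text \<open>The parts with a common factor are removed from \<open>near_set q 1 \<epsilon>\<close>
  by a union bound. The side times q_i is 2 r, a multiple of 1, of 2 and of every divisor of r, so
  all measures are exact; the exponent \<open>Suc j\<close> instead of \<open>j\<close> supplies the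
  multiple of 2. What remains is 1 - 1/2 - 12/25 = 1/50.\<close>

lemma measure_prim_near_set_ge:
  fixes q :: "int ^ 'm" and a :: "real ^ 'm ^ 'n"
  assumes q: "q $ i = 2 ^ Suc j * int r" and r: "few_divisors r" and \<epsilon>: "0 \<le> \<epsilon>" "\<epsilon> \<le> 1 / 4"
  shows "1 / 50 * (2 * \<epsilon>) ^ CARD('n) * measure lborel (cube a (1 / 2 ^ j)) \<le>
    measure lborel (prim_near_set q i \<epsilon> \<inter> cube a (1 / 2 ^ j))"
proof -
  let ?B = "cube a (1 / 2 ^ j)"
  define s where "s = (2 * \<epsilon>) ^ CARD('n)"
  define b where "b = measure lborel ?B"
  define D where "D = {d. 3 \<le> d \<and> d dvd r}"
  have odd: "odd r" and sum: "(\<Sum>d\<in>D. 1 / real d) \<le> 12 / 25"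
    using r by (auto simp: few_divisors_def D_def)
  have "r > 0" using odd by (cases r) auto
  hence finD: "finite D" unfolding D_def by (rule finite_subset[rotated, OF finite_divisors_nat]) auto
  have s: "s \<ge> 0" using \<epsilon> by (simp add: s_def)
  have qi: "q $ i \<noteq> 0" using q \<open>r > 0\<close> by simp
  have \<delta>q: "1 / 2 ^ j * real_of_int (q $ i) = 2 * real r" by (simp add: q)
  have m: "measure lborel (near_set q \<rho> \<epsilon> \<inter> ?B) \<le> s * (1 / \<rho>) * b"
    if "\<rho> \<ge> 1" "2 * real r = \<rho> * of_int z" for \<rho> z
  proof -
    have "measure lborel (near_set q \<rho> \<epsilon> \<inter> ?B) = (2 * \<epsilon> / \<rho>) ^ CARD('n) * b"
      unfolding b_def using that \<epsilon> qi \<delta>q by (intro measure_near_set_cube[of _ _ _ _ i z]) auto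
    also have "\<dots> = s * (1 / \<rho> ^ CARD('n)) * b" by (simp add: s_def power_divide)
    \<comment> \<open>This reduces every n to the worst case n = 1.\<close>
    also have "\<dots> \<le> s * (1 / \<rho>) * b"
      using that s by (intro mult_right_mono mult_left_mono divide_left_mono self_le_power) (auto simp: b_def)
    finally show ?thesis .
  qed
  have fm: "Y \<inter> ?B \<in> fmeasurable lborel" if "Y \<in> sets borel" for Y
    using that by (intro fmeasurableI2[OF fmeasurable_cube[of "1 / 2 ^ j" a]]) auto
  have "s * b = measure lborel (near_set q 1 \<epsilon> \<inter> ?B)"
    using measure_near_set_cube[of "1 / 2 ^ j" 1 \<epsilon> q i "2 * int r" a] \<epsilon> qi \<delta>q by (simp add: s_def b_def)
  also have "\<dots> \<le> measure lborel ((prim_near_set q i \<epsilon> \<inter> ?B) \<union>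
      ((near_set q 2 \<epsilon> \<inter> ?B) \<union> (\<Union>d\<in>D. near_set q (real d) \<epsilon> \<inter> ?B)))"
    using near_set_subset_prim_near_set[OF q odd, of \<epsilon>] finD
    by (intro measure_mono_fmeasurable fmeasurable.Un fm fmeasurable.finite_UN) (auto simp: D_def)
  also have "\<dots> \<le> measure lborel (prim_near_set q i \<epsilon> \<inter> ?B) +
      measure lborel ((near_set q 2 \<epsilon> \<inter> ?B) \<union> (\<Union>d\<in>D. near_set q (real d) \<epsilon> \<inter> ?B))"
    using finD by (intro measure_Un_le) auto
  also have "measure lborel ((near_set q 2 \<epsilon> \<inter> ?B) \<union> (\<Union>d\<in>D. near_set q (real d) \<epsilon> \<inter> ?B)) \<le>
      measure lborel (near_set q 2 \<epsilon> \<inter> ?B) + measure lborel (\<Union>d\<in>D. near_set q (real d) \<epsilon> \<inter> ?B)"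
    using finD by (intro measure_Un_le) auto
  also have "measure lborel (\<Union>d\<in>D. near_set q (real d) \<epsilon> \<inter> ?B) \<le>
      (\<Sum>d\<in>D. measure lborel (near_set q (real d) \<epsilon> \<inter> ?B))"
    using finD by (intro measure_UNION_le) auto
  also have "\<dots> \<le> (\<Sum>d\<in>D. s * (1 / real d) * b)"
  proof (rule sum_mono)
    fix d assume d: "d \<in> D"
    then obtain z where "r = d * z" by (auto simp: D_def)
    thus "measure lborel (near_set q (real d) \<epsilon> \<inter> ?B) \<le> s * (1 / real d) * b"
      using d by (intro m[of "real d" "2 * int z"]) (auto simp: D_def)
  qed
  also have "\<dots> = s * (\<Sum>d\<in>D. 1 / real d) * b" by (simp add: sum_distrib_left sum_distrib_right)
  also have "\<dots> \<le> s * (12 / 25) * b"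
    using s by (intro mult_right_mono mult_left_mono sum) (auto simp: b_def)
  also have "measure lborel (near_set q 2 \<epsilon> \<inter> ?B) \<le> s * (1 / 2) * b"
    by (rule m[of _ "int r"]) auto
  finally have "s * b \<le> measure lborel (prim_near_set q i \<epsilon> \<inter> ?B) + (s * (1 / 2) * b + s * (12 / 25) * b)"
    by simp
  thus ?thesis unfolding s_def[symmetric] b_def[symmetric] by (simp add: algebra_simps)
qed

text \<open>Off the diagonal the sets are independent and contribute \<open>s x * s y\<close>; the
  diagonal adds \<open>sum s X\<close>, which is of lower order as the sums grow.\<close>

lemma sum_measure_inter_cube_le:
  fixes q :: "'q \<Rightarrow> int ^ 'm" and a :: "real ^ 'm ^ 'n" and \<epsilon> :: "'q \<Rightarrow> real"
  defines "s \<equiv> \<lambda>x. (2 * \<epsilon> x) ^ CARD('n)"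
  assumes X: "finite X" and \<epsilon>: "\<And>x. x \<in> X \<Longrightarrow> 0 \<le> \<epsilon> x \<and> \<epsilon> x \<le> 1 / 4"
    and pos: "\<And>x. x \<in> X \<Longrightarrow> q x \<noteq> 0"
    and indep: "\<And>x y. x \<in> X \<Longrightarrow> y \<in> X \<Longrightarrow> x \<noteq> y \<Longrightarrow> \<exists>i j. q x $ i * q y $ j \<noteq> q x $ j * q y $ i"
  shows "(\<Sum>x\<in>X. \<Sum>y\<in>X. measure lborel (near_set (q x) 1 (\<epsilon> x) \<inter> near_set (q y) 1 (\<epsilon> y) \<inter> cube a 1))
     \<le> (sum s X)\<^sup>2 + sum s X"
    and "x \<in> X \<Longrightarrow> measure lborel (near_set (q x) 1 (\<epsilon> x) \<inter> cube a 1) = s x"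
proof -
  have single: "measure lborel (near_set (q x) 1 (\<epsilon> x) \<inter> cube a 1) = s x" if x: "x \<in> X" for x
  proof -
    obtain i where "q x $ i \<noteq> 0" using pos[OF x] by (auto simp: vec_eq_iff)
    thus ?thesis using measure_near_set_cube[of 1 1 "\<epsilon> x" "q x" i "q x $ i" a] \<epsilon>[OF x]
      by (simp add: s_def measure_cube)
  qed
  show "x \<in> X \<Longrightarrow> measure lborel (near_set (q x) 1 (\<epsilon> x) \<inter> cube a 1) = s x" by (rule single)
  have s_nn: "0 \<le> s x" if "x \<in> X" for x using \<epsilon>[OF that] by (simp add: s_def)
  have "measure lborel (near_set (q x) 1 (\<epsilon> x) \<inter> near_set (q y) 1 (\<epsilon> y) \<inter> cube a 1) \<le>
      s x * s y + (if x = y then s x else 0)" if x: "x \<in> X" and y: "y \<in> X" for x y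
  proof (cases "x = y")
    case True
    thus ?thesis using single[OF x] s_nn[OF x] by simp
  next
    case False
    then obtain i j where ij: "q x $ i * q y $ j \<noteq> q x $ j * q y $ i" using indep x y by blast
    hence "q x $ j * q y $ i \<noteq> q x $ i * q y $ j" by simp
    \<comment> \<open>The independence lemma asks for a nonzero entry of \<open>q y\<close> at the
      first index; i and j exchange roles if necessary.\<close>
    moreover have "q y $ i \<noteq> 0 \<or> q y $ j \<noteq> 0" using ij by auto
    ultimately show ?thesis
      using measure_near_set_inter[of "\<epsilon> x" "\<epsilon> y" "q y" i "q x" j a] ij
        measure_near_set_inter[of "\<epsilon> x" "\<epsilon> y" "q y" j "q x" i a] \<epsilon>[OF x] \<epsilon>[OF y] False
      by (auto simp: s_def)
  qed
  hence "(\<Sum>x\<in>X. \<Sum>y\<in>X. measure lborel (near_set (q x) 1 (\<epsilon> x) \<inter> near_set (q y) 1 (\<epsilon> y) \<inter> cube a 1))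
      \<le> (\<Sum>x\<in>X. \<Sum>y\<in>X. s x * s y + (if x = y then s x else 0))"
    by (intro sum_mono) auto
  also have "\<dots> = (sum s X)\<^sup>2 + sum s X"
    using X by (simp add: sum.distrib power2_eq_square sum_product)
  finally show "(\<Sum>x\<in>X. \<Sum>y\<in>X. measure lborel (near_set (q x) 1 (\<epsilon> x) \<inter> near_set (q y) 1 (\<epsilon> y) \<inter> cube a 1))
     \<le> (sum s X)\<^sup>2 + sum s X" .
qed

text \<open>On \<open>B\<close> the pointwise inequality is \<open>0 \<le> (F - 2 S)\<^sup>2\<close>, on the rest of the cube it is \<open>0 \<le> (F - S)\<^sup>2\<close>,
  where \<open>F\<close> counts the sets containing a point and \<open>S\<close> is its mean.\<close>

lemma sum_measure_inter_subset_cube_le: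
  fixes q :: "'q \<Rightarrow> int ^ 'm" and a :: "real ^ 'm ^ 'n" and \<epsilon> :: "'q \<Rightarrow> real"
    and A :: "'q \<Rightarrow> (real ^ 'm ^ 'n) set"
  defines "s \<equiv> \<lambda>x. (2 * \<epsilon> x) ^ CARD('n)"
  assumes X: "finite X" and \<epsilon>: "\<And>x. x \<in> X \<Longrightarrow> 0 \<le> \<epsilon> x \<and> \<epsilon> x \<le> 1 / 4"
    and pos: "\<And>x. x \<in> X \<Longrightarrow> q x \<noteq> 0"
    and indep: "\<And>x y. x \<in> X \<Longrightarrow> y \<in> X \<Longrightarrow> x \<noteq> y \<Longrightarrow> \<exists>i j. q x $ i * q y $ j \<noteq> q x $ j * q y $ i"
    and B: "B \<in> sets borel" "B \<subseteq> cube a 1"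
    and A: "\<And>x. x \<in> X \<Longrightarrow> A x \<subseteq> near_set (q x) 1 (\<epsilon> x)" "\<And>x. x \<in> X \<Longrightarrow> A x \<in> sets borel"
  shows "(\<Sum>x\<in>X. \<Sum>y\<in>X. measure lborel (A x \<inter> A y \<inter> B)) \<le> 2 * measure lborel B * (sum s X)\<^sup>2 + 2 * sum s X"
proof -
  define S where "S = sum s X"
  define F where "F = (\<lambda>x. near_set (q x) 1 (\<epsilon> x) :: (real ^ 'm ^ 'n) set)"
  define U where "U = cube a 1"
  have [measurable]: "B \<in> sets borel" "F x \<in> sets borel" "U \<in> sets borel" for x
    using B by (simp_all add: F_def U_def)
  have U: "U \<in> fmeasurable lborel" unfolding U_def by (rule fmeasurable_cube) simp
  have fm: "Y \<in> fmeasurable lborel" if "Y \<subseteq> U" "Y \<in> sets borel" for Y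
    using fmeasurableI2[OF U that(1)] that(2) by simp
  have BU: "B \<subseteq> U" using B by (simp add: U_def)
  have int: "integrable lborel (\<lambda>x. indicator Y x :: real)" "(LINT x|lborel. indicator Y x :: real) = measure lborel Y"
    if "Y \<subseteq> U" "Y \<in> sets borel" for Y
    using fm[OF that] that by (auto simp: fmeasurable_def)
  define f1 where "f1 = (\<lambda>\<Theta>. \<Sum>x\<in>X. \<Sum>y\<in>X. indicator (F x \<inter> F y \<inter> B) \<Theta> :: real)"
  define f2 where "f2 = (\<lambda>\<Theta>. \<Sum>x\<in>X. \<Sum>y\<in>X. indicator (F x \<inter> F y \<inter> U) \<Theta> :: real)"
  define f3 where "f3 = (\<lambda>\<Theta>. \<Sum>x\<in>X. indicator (F x \<inter> U) \<Theta> :: real)"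
  have f1: "integrable lborel f1" "integral\<^sup>L lborel f1 = (\<Sum>x\<in>X. \<Sum>y\<in>X. measure lborel (F x \<inter> F y \<inter> B))"
  proof -
    have *: "F x \<inter> F y \<inter> B \<subseteq> U" "F x \<inter> F y \<inter> B \<in> sets borel" for x y using BU by auto
    show "integrable lborel f1" unfolding f1_def by (intro Bochner_Integration.integrable_sum int *)
    show "integral\<^sup>L lborel f1 = (\<Sum>x\<in>X. \<Sum>y\<in>X. measure lborel (F x \<inter> F y \<inter> B))"
      unfolding f1_def
      by (subst Bochner_Integration.integral_sum, intro Bochner_Integration.integrable_sum int *,
          intro sum.cong refl, subst Bochner_Integration.integral_sum, intro int *, intro sum.cong refl int *)
  qed
  have f2: "integrable lborel f2" "integral\<^sup>L lborel f2 = (\<Sum>x\<in>X. \<Sum>y\<in>X. measure lborel (F x \<inter> F y \<inter> U))"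
  proof -
    have *: "F x \<inter> F y \<inter> U \<subseteq> U" "F x \<inter> F y \<inter> U \<in> sets borel" for x y by auto
    show "integrable lborel f2" unfolding f2_def by (intro Bochner_Integration.integrable_sum int *)
    show "integral\<^sup>L lborel f2 = (\<Sum>x\<in>X. \<Sum>y\<in>X. measure lborel (F x \<inter> F y \<inter> U))"
      unfolding f2_def
      by (subst Bochner_Integration.integral_sum, intro Bochner_Integration.integrable_sum int *,
          intro sum.cong refl, subst Bochner_Integration.integral_sum, intro int *, intro sum.cong refl int *)
  qed
  have f3: "integrable lborel f3" "integral\<^sup>L lborel f3 = S"
  proof -
    have *: "F x \<inter> U \<subseteq> U" "F x \<inter> U \<in> sets borel" for x by auto
    show "integrable lborel f3" unfolding f3_def by (intro Bochner_Integration.integrable_sum int *)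
    have "integral\<^sup>L lborel f3 = (\<Sum>x\<in>X. measure lborel (F x \<inter> U))"
      unfolding f3_def by (subst Bochner_Integration.integral_sum, intro int *, intro sum.cong refl int *)
    also have "\<dots> = S" unfolding S_def s_def F_def U_def
      by (intro sum.cong refl sum_measure_inter_cube_le(2)[OF X \<epsilon> pos indep])
    finally show "integral\<^sup>L lborel f3 = S" .
  qed
  have "(\<Sum>x\<in>X. \<Sum>y\<in>X. measure lborel (A x \<inter> A y \<inter> B)) \<le> (\<Sum>x\<in>X. \<Sum>y\<in>X. measure lborel (F x \<inter> F y \<inter> B))"
    using A BU by (intro sum_mono measure_mono_fmeasurable fm) (auto simp: F_def)
  also have "\<dots> = integral\<^sup>L lborel f1" by (rule f1(2)[symmetric])
  also have "\<dots> \<le> (LINT \<Theta>|lborel. 2 * f2 \<Theta> - 4 * S * f3 \<Theta> + 2 * S\<^sup>2 * indicator U \<Theta> + 2 * S\<^sup>2 * indicator B \<Theta>)"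
  proof (rule Bochner_Integration.integral_mono)
    show "integrable lborel (\<lambda>\<Theta>. 2 * f2 \<Theta> - 4 * S * f3 \<Theta> + 2 * S\<^sup>2 * indicator U \<Theta> + 2 * S\<^sup>2 * indicator B \<Theta>)"
      using f2(1) f3(1) int(1)[of U] int(1)[of B] BU by simp
    fix \<Theta>
    define G where "G = (\<Sum>x\<in>X. indicator (F x) \<Theta> :: real)"
    have 1: "f1 \<Theta> = G\<^sup>2 * indicator B \<Theta>"
      unfolding f1_def G_def power2_eq_square sum_product sum_distrib_right by (intro sum.cong) (auto simp: indicator_def)
    have 2: "f2 \<Theta> = G\<^sup>2 * indicator U \<Theta>"
      unfolding f2_def G_def power2_eq_square sum_product sum_distrib_right by (intro sum.cong) (auto simp: indicator_def)
    have 3: "f3 \<Theta> = G * indicator U \<Theta>"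
      unfolding f3_def G_def sum_distrib_right by (intro sum.cong) (auto simp: indicator_def)
    have "0 \<le> (G - 2 * S)\<^sup>2" "0 \<le> (G - S)\<^sup>2" by simp_all
    thus "f1 \<Theta> \<le> 2 * f2 \<Theta> - 4 * S * f3 \<Theta> + 2 * S\<^sup>2 * indicator U \<Theta> + 2 * S\<^sup>2 * indicator B \<Theta>"
      unfolding 1 2 3 using BU by (auto simp: indicator_def power2_eq_square algebra_simps)
  qed (rule f1)
  also have "\<dots> = 2 * integral\<^sup>L lborel f2 - 4 * S * S + 2 * S\<^sup>2 + 2 * S\<^sup>2 * measure lborel B"
  proof -
    have "measure lborel U = 1" by (simp add: U_def measure_cube)
    thus ?thesis
      using f2(1) f3 int[of U] int[of B] BU by simp
  qed
  also have "\<dots> \<le> 2 * (S\<^sup>2 + S) - 4 * S * S + 2 * S\<^sup>2 + 2 * S\<^sup>2 * measure lborel B"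
  proof -
    have "integral\<^sup>L lborel f2 \<le> S\<^sup>2 + S" unfolding f2(2) F_def U_def S_def s_def
      by (rule sum_measure_inter_cube_le(1)[OF X \<epsilon> pos indep])
    thus ?thesis by simp
  qed
  also have "\<dots> = 2 * measure lborel B * S\<^sup>2 + 2 * S" by (simp add: power2_eq_square)
  finally show ?thesis by (simp add: S_def)
qed

text \<open>For numerators \<open>p, p'\<close> of points close to a common \<open>\<theta>\<close>, the integer \<open>p t' - p' t\<close> is a multiple
  of \<open>g = gcd t t'\<close> of modulus at most \<open>H = t \<epsilon>' + t' \<epsilon>\<close>; it determines \<open>p\<close> modulo \<open>t / g\<close>, and then \<open>p'\<close>.\<close>

lemma card_numerator_pairs_le:
  fixes t t' :: nat and k \<alpha> \<epsilon> \<epsilon>' :: real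
  assumes t: "t > 0" "t' > 0" and k: "k > 0" and \<epsilon>: "0 \<le> \<epsilon>" "\<epsilon> \<le> 1 / 4" "0 \<le> \<epsilon>'" "\<epsilon>' \<le> 1 / 4"
    and H: "real (gcd t t') \<le> t * \<epsilon>' + t' * \<epsilon>"
  defines "T \<equiv> {(p :: int, p' :: int). \<exists>\<theta>. \<alpha> \<le> \<theta> \<and> \<theta> < \<alpha> + 1 / k \<and>
     \<bar>k * t * \<theta> + p\<bar> \<le> \<epsilon> \<and> \<bar>k * t' * \<theta> + p'\<bar> \<le> \<epsilon>'}"
  shows "finite T" "real (card T) \<le> 6 * (t * \<epsilon>' + t' * \<epsilon>)"
proof -
  define g where "g = gcd t t'"
  define H where "H = t * \<epsilon>' + t' * \<epsilon>"
  define K where "K = \<lfloor>H / g\<rfloor>"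
  define u where "u = t div g"
  \<comment> \<open>A lower bound for \<open>p\<close>. As \<theta> runs through an interval of
    length 1/k, k t \<theta> runs through one of length t, and \<epsilon> <= 1/4 keeps
    \<open>p - pm\<close> within 0..t. With t = g u its quotient by u takes at most g + 1
    values.\<close>
  define pm where "pm = \<lceil>- k * t * \<alpha> - t - \<epsilon>\<rceil>"
  have g: "g > 0" using t by (simp add: g_def)
  have tu: "t = g * u" unfolding u_def g_def by simp
  obtain u' where tu': "t' = g * u'" unfolding g_def by (metis dvd_def gcd_dvd2)
  have u: "u > 0" using t tu by (cases u) auto
  have cop: "coprime u u'"
    using g tu tu' unfolding g_def by (metis gcd_mult_distrib_nat mult_cancel1 nat_mult_1_right coprime_iff_gcd_eq_1 less_not_refl)
  have K: "K \<ge> 1" using H g by (simp add: K_def H_def g_def le_floor_iff)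
  define \<Phi> where "\<Phi> = (\<lambda>(p :: int, p' :: int). (p * int u' - p' * int u, (p - pm) div int u))"
  have inj: "inj_on \<Phi> T"
  proof (rule inj_onI, clarsimp simp: \<Phi>_def)
    fix p p' r r' :: int
    assume eq: "p * int u' - p' * int u = r * int u' - r' * int u" and d: "(p - pm) div int u = (r - pm) div int u"
    have "(p - r) * int u' = (p' - r') * int u" using eq by (simp add: algebra_simps)
    hence "int u dvd (p - r) * int u'" by simp
    hence "int u dvd p - r" using cop by (simp add: coprime_dvd_mult_left_iff)
    hence "int u dvd (p - pm) - (r - pm)" by simp
    hence "(p - pm) mod int u = (r - pm) mod int u" by (simp add: mod_eq_dvd_iff)
    hence "p - pm = r - pm" using d by (metis div_mult_mod_eq)
    hence "p = r" by simp
    thus "p = r \<and> p' = r'" using eq u by simp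
  qed
  have sub: "\<Phi> ` T \<subseteq> {-K..K} \<times> {0..int g}"
  proof (clarsimp simp: \<Phi>_def T_def)
    fix p p' :: int and \<theta> assume \<theta>: "\<alpha> \<le> \<theta>" "\<theta> < \<alpha> + 1 / k"
      and p: "\<bar>k * t * \<theta> + p\<bar> \<le> \<epsilon>" and p': "\<bar>k * t' * \<theta> + p'\<bar> \<le> \<epsilon>'"
    have "real_of_int (int g * (p * int u' - p' * int u)) = t' * (k * t * \<theta> + p) - t * (k * t' * \<theta> + p')"
      by (simp add: tu tu' algebra_simps)
    also have "\<bar>\<dots>\<bar> \<le> t' * \<bar>k * t * \<theta> + p\<bar> + t * \<bar>k * t' * \<theta> + p'\<bar>"
      by (rule order.trans[OF abs_triangle_ineq4]) (simp add: abs_mult)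
    also have "\<dots> \<le> t' * \<epsilon> + t * \<epsilon>'" using p p' by (intro add_mono mult_left_mono) auto
    finally have "g * \<bar>real_of_int (p * int u' - p' * int u)\<bar> \<le> H"
      by (simp add: H_def abs_mult add.commute)
    hence "\<bar>real_of_int (p * int u' - p' * int u)\<bar> \<le> H / g" using g by (simp add: pos_le_divide_eq mult.commute)
    hence "real_of_int \<bar>p * int u' - p' * int u\<bar> \<le> H / g" by (simp only: of_int_abs)
    hence 1: "\<bar>p * int u' - p' * int u\<bar> \<le> K" unfolding K_def by (simp only: le_floor_iff)
    have "k * t * \<alpha> \<le> k * t * \<theta>" using \<theta> k by (intro mult_left_mono) auto
    moreover have "k * t * \<theta> \<le> k * t * (\<alpha> + 1 / k)" using \<theta> k by (intro mult_left_mono) auto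
    moreover have "k * t * (\<alpha> + 1 / k) = k * t * \<alpha> + t" using k by (simp add: algebra_simps)
    ultimately have "- k * t * \<alpha> - t - \<epsilon> \<le> p" "p \<le> - k * t * \<alpha> + \<epsilon>" using p by auto
    hence 2: "pm \<le> p" "real_of_int (p - pm) < t + 1"
      unfolding pm_def using \<epsilon> by (auto simp: ceiling_le_iff) linarith
    hence "p - pm \<le> int t" by linarith
    hence "(p - pm) div int u \<le> int t div int u" using u by (intro zdiv_mono1) auto
    also have "\<dots> = int g" using u by (simp add: tu)
    finally show "- K \<le> p * int u' - p' * int u \<and> p * int u' - p' * int u \<le> K \<and>
        0 \<le> (p - pm) div int u \<and> (p - pm) div int u \<le> int g"
      using 1 2 u by (auto simp: pos_imp_zdiv_nonneg_iff)
  qed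
  show "finite T"
    by (rule inj_on_finite[OF inj sub]) auto
  have "card T \<le> card ({-K..K} \<times> {0..int g})"
    by (rule card_inj_on_le[OF inj sub]) auto
  hence "real (card T) \<le> real_of_int (2 * K + 1) * (real g + 1)"
    using K by (simp add: card_cartesian_product) (simp add: algebra_simps flip: of_nat_le_iff[where ?'a = real])
  \<comment> \<open>Since the gcd is at most \<open>H\<close>, \<open>K\<close> is at least 1; this
    absorbs the summand 1 in \<open>2 * K + 1\<close>, and g + 1 <= 2 g.\<close>
  also have "\<dots> \<le> (3 * (H / g)) * (2 * real g)"
  proof (intro mult_mono)
    have "real_of_int K \<le> H / g" by (simp add: K_def)
    thus "real_of_int (2 * K + 1) \<le> 3 * (H / g)" using K by simp
  qed (use g K H in \<open>auto simp: H_def\<close>)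
  also have "\<dots> = 6 * H" using g by simp
  finally show "real (card T) \<le> 6 * (t * \<epsilon>' + t' * \<epsilon>)" by (simp add: H_def)
qed

text \<open>Each pair of numerators confines \<theta> to an interval of length at most
  \<open>2 * \<Delta> / k\<close>. In the product with the number of pairs,
  \<open>\<Delta> \<le> \<epsilon> / t\<close> serves one summand and
  \<open>\<Delta> \<le> \<epsilon>' / t'\<close> the other, so that t and t' cancel. The result is 6
  times the value for independent events.\<close>

lemma measure_common_numerators_le:
  fixes t t' :: nat and k \<alpha> \<epsilon> \<epsilon>' :: real
  assumes t: "t > 0" "t' > 0" and k: "k > 0" and \<epsilon>: "0 \<le> \<epsilon>" "\<epsilon> \<le> 1 / 4" "0 \<le> \<epsilon>'" "\<epsilon>' \<le> 1 / 4"
    and H: "real (gcd t t') \<le> t * \<epsilon>' + t' * \<epsilon>"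
  shows "emeasure lborel {\<theta>. \<alpha> \<le> \<theta> \<and> \<theta> < \<alpha> + 1 / k \<and> (\<exists>p::int. \<bar>k * t * \<theta> + p\<bar> \<le> \<epsilon>) \<and>
     (\<exists>p'::int. \<bar>k * t' * \<theta> + p'\<bar> \<le> \<epsilon>')} \<le> ennreal (24 * \<epsilon> * \<epsilon>' / k)" (is "emeasure lborel ?S \<le> _")
proof -
  define T where "T = {(p :: int, p' :: int). \<exists>\<theta>. \<alpha> \<le> \<theta> \<and> \<theta> < \<alpha> + 1 / k \<and>
     \<bar>k * t * \<theta> + p\<bar> \<le> \<epsilon> \<and> \<bar>k * t' * \<theta> + p'\<bar> \<le> \<epsilon>'}"
  have T: "finite T" "real (card T) \<le> 6 * (t * \<epsilon>' + t' * \<epsilon>)"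
    unfolding T_def by (rule card_numerator_pairs_le[OF t k \<epsilon> H])+
  define J where "J = (\<lambda>(p :: int, p' :: int). {\<theta>. \<bar>k * t * \<theta> + p\<bar> \<le> \<epsilon> \<and> \<bar>k * t' * \<theta> + p'\<bar> \<le> \<epsilon>'})"
  have Jsets: "J x \<in> sets borel" for x unfolding J_def by (cases x) simp
  define \<Delta> where "\<Delta> = min (\<epsilon> / t) (\<epsilon>' / t')"
  have \<Delta>: "\<Delta> \<ge> 0" using \<epsilon> t by (simp add: \<Delta>_def)
  have interval: "emeasure lborel {\<theta>. \<bar>k * s * \<theta> + p\<bar> \<le> e} = ennreal (2 * (e / s) / k)"
    if "s > 0" "e \<ge> 0" for s e p :: real
  proof -
    have "{\<theta>. \<bar>k * s * \<theta> + p\<bar> \<le> e} = {(- e - p) / (k * s)..(e - p) / (k * s)}"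
      using that k by (auto simp: field_simps abs_le_iff)
    also have "emeasure lborel \<dots> = ennreal ((e - p) / (k * s) - (- e - p) / (k * s))"
      using that k by (intro emeasure_lborel_Icc divide_right_mono) auto
    also have "(e - p) / (k * s) - (- e - p) / (k * s) = 2 * (e / s) / k"
      using that k by (simp add: diff_divide_distrib[symmetric] field_simps)
    finally show ?thesis .
  qed
  have J: "emeasure lborel (J x) \<le> ennreal (2 * \<Delta> / k)" for x
  proof -
    obtain p p' where x: "x = (p, p')" by force
    have "emeasure lborel (J x) \<le> emeasure lborel {\<theta>. \<bar>k * t * \<theta> + p\<bar> \<le> \<epsilon>}"
      "emeasure lborel (J x) \<le> emeasure lborel {\<theta>. \<bar>k * t' * \<theta> + p'\<bar> \<le> \<epsilon>'}"
      by (intro emeasure_mono; auto simp: J_def x)+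
    thus ?thesis using t \<epsilon> by (simp add: interval \<Delta>_def min_def)
  qed
  have "?S \<subseteq> (\<Union>x\<in>T. J x)" by (auto simp: T_def J_def)
  hence "emeasure lborel ?S \<le> emeasure lborel (\<Union>x\<in>T. J x)"
    using T(1) Jsets by (intro emeasure_mono) auto
  also have "\<dots> \<le> (\<Sum>x\<in>T. emeasure lborel (J x))"
    using T(1) Jsets by (intro emeasure_subadditive_finite) auto
  also have "\<dots> \<le> (\<Sum>x\<in>T. ennreal (2 * \<Delta> / k))" by (intro sum_mono J)
  also have "\<dots> = ennreal (real (card T) * (2 * \<Delta> / k))"
    using \<Delta> k by (simp add: ennreal_of_nat_eq_real_of_nat flip: ennreal_mult)
  also have "\<dots> \<le> ennreal (24 * \<epsilon> * \<epsilon>' / k)"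
  proof (rule ennreal_leI)
    have "real (card T) * (2 * \<Delta> / k) \<le> 6 * (t * \<epsilon>' + t' * \<epsilon>) * (2 * \<Delta> / k)"
      using \<Delta> k by (intro mult_right_mono T) auto
    also have "\<dots> = 12 / k * (\<epsilon>' * (t * \<Delta>) + \<epsilon> * (t' * \<Delta>))" by (simp add: algebra_simps)
    also have "\<dots> \<le> 12 / k * (\<epsilon>' * \<epsilon> + \<epsilon> * \<epsilon>')"
    proof (intro mult_left_mono add_mono)
      have "t * \<Delta> \<le> t * (\<epsilon> / t)" "t' * \<Delta> \<le> t' * (\<epsilon>' / t')"
        by (intro mult_left_mono; simp add: \<Delta>_def)+
      thus "t * \<Delta> \<le> \<epsilon>" "t' * \<Delta> \<le> \<epsilon>'" using t by auto
    qed (use \<epsilon> k in auto)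
    finally show "real (card T) * (2 * \<Delta> / k) \<le> 24 * \<epsilon> * \<epsilon>' / k" by simp
  qed
  finally show ?thesis .
qed

lemma emeasure_lborel_Basis_product:
  fixes S :: "'a::euclidean_space \<Rightarrow> real set"
  assumes S: "\<And>b. b \<in> Basis \<Longrightarrow> S b \<in> sets borel"
  shows "emeasure lborel {x. \<forall>b\<in>Basis. x \<bullet> b \<in> S b} = (\<Prod>b\<in>Basis. emeasure lborel (S b))"
proof -
  have [measurable]: "{x::'a. \<forall>b\<in>Basis. x \<bullet> b \<in> S b} \<in> sets borel"
  proof -
    have "{x::'a. \<forall>b\<in>Basis. x \<bullet> b \<in> S b} = (\<Inter>b\<in>Basis. (\<lambda>x. x \<bullet> b) -` S b \<inter> space borel)" by auto
    also have "\<dots> \<in> sets borel"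
      by (intro sets.finite_INT measurable_sets[OF _ S]) auto
    finally show ?thesis .
  qed
  have "emeasure lborel {x::'a. \<forall>b\<in>Basis. x \<bullet> b \<in> S b} = (\<integral>\<^sup>+x. indicator {x::'a. \<forall>b\<in>Basis. x \<bullet> b \<in> S b} x \<partial>lborel)"
    by simp
  also have "\<dots> = (\<integral>\<^sup>+x. (\<Prod>b\<in>Basis. indicator (S b) (x \<bullet> b)) \<partial>(lborel :: 'a measure))"
  proof (intro nn_integral_cong)
    fix x :: 'a
    show "indicator {x::'a. \<forall>b\<in>Basis. x \<bullet> b \<in> S b} x = (\<Prod>b\<in>Basis. indicator (S b) (x \<bullet> b) :: ennreal)"
      by (auto simp: indicator_def prod_zero_iff)
  qed
  also have "\<dots> = (\<Prod>b\<in>Basis. (\<integral>\<^sup>+x. indicator (S b) x \<partial>lborel))"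
    using S by (intro nn_integral_lborel_prod) auto
  also have "\<dots> = (\<Prod>b\<in>Basis. emeasure lborel (S b))"
    using S by (intro prod.cong) auto
  finally show ?thesis .
qed

text \<open>With one column the rows of \<Theta> are separate real numbers, so the one-dimensional
  bound is raised to the power n. If the gcd exceeds
  \<open>t * \<epsilon>' + t' * \<epsilon>\<close>, each integer p t' - p' t is a multiple of the
  gcd of smaller modulus, hence 0; the two reduced fractions then agree and q = q'. Without
  reducedness the sets of q and 2 q would overlap too much.\<close>

lemma measure_prim_near_set_inter_le:
  fixes q q' :: "int ^ 'm" and a :: "real ^ 'm ^ 'n"
  assumes m: "UNIV = {i :: 'm}" and q: "q $ i = int (k * t)" "q' $ i = int (k * t')" "q \<noteq> q'"
    and pos: "t > 0" "t' > 0" "k > 0" and \<epsilon>: "0 \<le> \<epsilon>" "\<epsilon> \<le> 1 / 4" "0 \<le> \<epsilon>'" "\<epsilon>' \<le> 1 / 4"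
  shows "measure lborel (prim_near_set q i \<epsilon> \<inter> prim_near_set q' i \<epsilon>' \<inter> cube a (1 / real k)) \<le>
     6 ^ CARD('n) * (2 * \<epsilon>) ^ CARD('n) * (2 * \<epsilon>') ^ CARD('n) * measure lborel (cube a (1 / real k))"
    (is "measure lborel ?A \<le> _")
proof -
  have comp: "(\<Theta> *v real_vec v) $ r = of_int (v $ i) * \<Theta> $ r $ i" for \<Theta> :: "real ^ 'm ^ 'n" and v r
    by (simp add: matrix_vector_mult_def m mult.commute)
  have m1: "CARD('m) = 1" by (simp add: m)
  show ?thesis
  proof (cases "real (gcd t t') \<le> t * \<epsilon>' + t' * \<epsilon>")
    case True
    define S where "S = (\<lambda>\<alpha>. {\<theta>. \<alpha> \<le> \<theta> \<and> \<theta> < \<alpha> + 1 / real k \<and>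
      (\<exists>p::int. \<bar>real k * real t * \<theta> + of_int p\<bar> \<le> \<epsilon>) \<and>
      (\<exists>p'::int. \<bar>real k * real t' * \<theta> + of_int p'\<bar> \<le> \<epsilon>')})"
    have S_sets: "S \<alpha> \<in> sets borel" for \<alpha> unfolding S_def by measurable
    have S: "emeasure lborel (S \<alpha>) \<le> ennreal (24 * \<epsilon> * \<epsilon>' / k)" for \<alpha>
      unfolding S_def using pos by (intro measure_common_numerators_le \<epsilon> True) auto
    have "?A \<subseteq> {\<Theta>. \<forall>b\<in>Basis. \<Theta> \<bullet> b \<in> S (a \<bullet> b)}"
    proof clarsimp
      fix \<Theta> b assume \<Theta>: "\<Theta> \<in> prim_near_set q i \<epsilon>" "\<Theta> \<in> prim_near_set q' i \<epsilon>'" "\<Theta> \<in> cube a (1 / real k)"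
        and b: "b \<in> (Basis :: (real^'m^'n) set)"
      obtain r j where "b = axis r (axis j 1)" using b by (auto simp: Basis_vec_def)
      moreover have "j = i" using m by auto
      ultimately have b': "\<Theta> \<bullet> b = \<Theta> $ r $ i" by (simp add: inner_axis)
      from \<Theta>(1) obtain p :: "int ^ 'n" where "\<bar>(\<Theta> *v real_vec q) $ r + p $ r\<bar> \<le> \<epsilon>"
        by (auto simp: prim_near_set_def infnorm_le_iff_component)
      moreover from \<Theta>(2) obtain p' :: "int ^ 'n" where "\<bar>(\<Theta> *v real_vec q') $ r + p' $ r\<bar> \<le> \<epsilon>'"
        by (auto simp: prim_near_set_def infnorm_le_iff_component)
      ultimately show "\<Theta> \<bullet> b \<in> S (a \<bullet> b)"
        using \<Theta>(3) b unfolding S_def b'[symmetric] comp by (auto simp: b' q cube_def)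
    qed
    moreover have "{\<Theta>. \<forall>b\<in>Basis. \<Theta> \<bullet> b \<in> S (a \<bullet> b)} \<in> sets borel"
    proof -
      have "{\<Theta>. \<forall>b\<in>Basis. \<Theta> \<bullet> b \<in> S (a \<bullet> b)} = (\<Inter>b\<in>Basis. (\<lambda>x. x \<bullet> b) -` S (a \<bullet> b) \<inter> space borel)" by auto
      also have "\<dots> \<in> sets borel"
        by (intro sets.finite_INT measurable_sets[OF _ S_sets]) auto
      finally show ?thesis .
    qed
    ultimately have "emeasure lborel ?A \<le> emeasure lborel {\<Theta>. \<forall>b\<in>Basis. \<Theta> \<bullet> b \<in> S (a \<bullet> b)}"
      by (intro emeasure_mono) auto
    also have "\<dots> = (\<Prod>b\<in>(Basis :: (real^'m^'n) set). emeasure lborel (S (a \<bullet> b)))"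
      by (rule emeasure_lborel_Basis_product) (rule S_sets)
    also have "\<dots> \<le> (\<Prod>b\<in>(Basis :: (real^'m^'n) set). ennreal (24 * \<epsilon> * \<epsilon>' / k))"
      by (intro prod_mono_ennreal S)
    also have "\<dots> = ennreal ((24 * \<epsilon> * \<epsilon>' / k) ^ CARD('n))"
      using \<epsilon> by (simp add: m1 ennreal_power)
    finally have "measure lborel ?A \<le> (24 * \<epsilon> * \<epsilon>' / k) ^ CARD('n)"
      using \<epsilon> unfolding measure_def by (intro enn2real_leI) auto
    also have "24 * \<epsilon> * \<epsilon>' / k = 6 * (2 * \<epsilon>) * (2 * \<epsilon>') * (1 / k)" by simp
    also have "\<dots> ^ CARD('n) = 6 ^ CARD('n) * (2 * \<epsilon>) ^ CARD('n) * (2 * \<epsilon>') ^ CARD('n) * (1 / real k) ^ CARD('n)"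
      by (simp only: power_mult_distrib)
    finally show ?thesis by (simp add: measure_cube m1)
  next
    case False
    have "?A = {}"
    proof (rule ccontr)
      assume "?A \<noteq> {}"
      then obtain \<Theta> :: "real ^ 'm ^ 'n" where \<Theta>: "\<Theta> \<in> prim_near_set q i \<epsilon>" "\<Theta> \<in> prim_near_set q' i \<epsilon>'" by blast
      from \<Theta>(1) obtain p :: "int ^ 'n" where p: "Gcd (insert (q $ i) (range (\<lambda>r. p $ r))) = 1"
        "\<And>r. \<bar>(\<Theta> *v real_vec q) $ r + p $ r\<bar> \<le> \<epsilon>"
        by (simp only: prim_near_set_def infnorm_le_iff_component mem_Collect_eq vector_add_component real_vec_nth) blast
      from \<Theta>(2) obtain p' :: "int ^ 'n" where p': "Gcd (insert (q' $ i) (range (\<lambda>r. p' $ r))) = 1"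
        "\<And>r. \<bar>(\<Theta> *v real_vec q') $ r + p' $ r\<bar> \<le> \<epsilon>'"
        by (simp only: prim_near_set_def infnorm_le_iff_component mem_Collect_eq vector_add_component real_vec_nth) blast
      have "p $ r * int t' = p' $ r * int t" for r
      proof -
        define h where "h = p $ r * int t' - p' $ r * int t"
        have "real_of_int h = t' * (k * t * \<Theta> $ r $ i + p $ r) - t * (k * t' * \<Theta> $ r $ i + p' $ r)"
          by (simp add: h_def algebra_simps)
        also have "\<bar>\<dots>\<bar> \<le> t' * \<bar>k * t * \<Theta> $ r $ i + p $ r\<bar> + t * \<bar>k * t' * \<Theta> $ r $ i + p' $ r\<bar>"
          by (rule order.trans[OF abs_triangle_ineq4]) (simp add: abs_mult)
        also have "\<dots> \<le> t' * \<epsilon> + t * \<epsilon>'"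
          using p(2)[of r] p'(2)[of r] by (intro add_mono mult_left_mono) (auto simp: comp q)
        also have "\<dots> < real (gcd t t')" using False by linarith
        finally have "\<bar>h\<bar> < int (gcd t t')" by linarith
        moreover have "int (gcd t t') dvd h" by (auto simp: h_def simp flip: gcd_int_int_eq)
        ultimately have "h = 0" using zdvd_not_zless[of "\<bar>h\<bar>" "int (gcd t t')"] by fastforce
        thus ?thesis by (simp add: h_def)
      qed
      hence "p $ r * (q' $ i) = p' $ r * (q $ i)" for r by (simp add: q mult.left_commute)
      hence "q $ i = q' $ i"
        using p(1) p'(1) pos by (intro gcd_eq_1_proportional_imp_eq[of "q $ i" "\<lambda>r. p $ r" UNIV "q' $ i" "\<lambda>r. p' $ r"])
          (auto simp: q)
      moreover have "j = i" for j using m by auto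
      ultimately have "q = q'" unfolding vec_eq_iff by metis
      thus False using q by simp
    qed
    thus ?thesis using \<epsilon> by simp
  qed
qed

section \<open>Convergence\<close>

lemma finite_vec_components:
  assumes "\<And>i. finite (S i)"
  shows "finite {v :: 'a ^ 'k. \<forall>i. v $ i \<in> S i}"
proof -
  have "{v :: 'a ^ 'k. \<forall>i. v $ i \<in> S i} = vec_nth -` (\<Pi>\<^sub>E i\<in>UNIV. S i)"
    by (auto simp: PiE_iff)
  moreover have "finite (\<Pi>\<^sub>E i\<in>(UNIV :: 'k set). S i)"
    using assms by (intro finite_PiE) auto
  moreover have "inj (vec_nth :: 'a ^ 'k \<Rightarrow> _)"
    by (rule injI) (simp add: vec_nth_inject)
  ultimately show ?thesis by (simp add: finite_vimageI)
qed

lemma int_supnorm_le_iff: "int_supnorm v \<le> x \<longleftrightarrow> (\<forall>i. \<bar>v $ i\<bar> \<le> int x)"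
  by (auto simp: int_supnorm_def nat_le_iff)

lemma finite_int_supnorm_le: "finite {v :: int ^ 'k. int_supnorm v \<le> x}"
proof -
  have "{v :: int ^ 'k. int_supnorm v \<le> x} = {v. \<forall>i. v $ i \<in> {-int x..int x}}"
    by (auto simp: int_supnorm_le_iff abs_le_iff minus_le_iff)
  thus ?thesis by (simp add: finite_vec_components del: atLeastAtMost_iff)
qed

text \<open>A sphere is covered by two faces per coordinate: one coordinate is x or -x, and each of
  the others takes 2x + 1 values.\<close>

lemma card_int_supnorm_eq_le:
  "card {v :: int ^ 'k. int_supnorm v = x} \<le> 2 * CARD('k) * (2 * x + 1) ^ (CARD('k) - 1)"
proof -
  define A where "A = (\<lambda>(i, s). {v :: int ^ 'k. v $ i = s \<and> (\<forall>j. \<bar>v $ j\<bar> \<le> int x)})"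
  have card_A: "finite (A (i, s)) \<and> card (A (i, s)) \<le> (2 * x + 1) ^ (CARD('k) - 1)" for i s
  proof -
    define S where "S = (\<lambda>j. if j = i then {s} else {-int x..int x})"
    have sub: "vec_nth ` A (i, s) \<subseteq> (\<Pi>\<^sub>E j\<in>UNIV. S j)"
      by (auto simp: A_def S_def PiE_iff abs_le_iff minus_le_iff)
    have inj: "inj_on vec_nth (A (i, s))"
      by (rule inj_onI) (simp add: vec_nth_inject)
    have fin: "finite (\<Pi>\<^sub>E j\<in>UNIV. S j)" by (intro finite_PiE) (auto simp: S_def)
    have "card (A (i, s)) \<le> card (\<Pi>\<^sub>E j\<in>UNIV. S j)"
      by (rule card_inj_on_le[OF inj sub fin])
    also have "\<dots> = (\<Prod>j\<in>UNIV. card (S j))" by (simp add: card_PiE)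
    also have "\<dots> = card (S i) * (\<Prod>j\<in>UNIV - {i}. card (S j))" by (simp add: prod.remove[of UNIV i])
    also have "(\<Prod>j\<in>UNIV - {i}. card (S j)) = (\<Prod>j\<in>UNIV - {i}. 2 * x + 1)"
      by (intro prod.cong) (auto simp: S_def)
    also have "card (S i) * \<dots> = (2 * x + 1) ^ (CARD('k) - 1)" by (simp add: S_def card_Diff_singleton)
    finally show ?thesis using inj_on_finite[OF inj sub fin] by simp
  qed
  have "{v :: int ^ 'k. int_supnorm v = x} \<subseteq> (\<Union>y\<in>UNIV \<times> {int x, - int x}. A y)"
  proof
    fix v :: "int ^ 'k" assume v: "v \<in> {v. int_supnorm v = x}"
    have "int_supnorm v \<in> range (\<lambda>i. nat \<bar>v $ i\<bar>)" unfolding int_supnorm_def by (rule Max_in) auto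
    then obtain i where "nat \<bar>v $ i\<bar> = x" using v by auto
    hence "v $ i = int x \<or> v $ i = - int x" by auto
    moreover have "\<forall>j. \<bar>v $ j\<bar> \<le> int x" using v int_supnorm_le_iff[of v x] by auto
    ultimately show "v \<in> (\<Union>y\<in>UNIV \<times> {int x, - int x}. A y)" by (force simp: A_def)
  qed
  hence "card {v :: int ^ 'k. int_supnorm v = x} \<le> card (\<Union>y\<in>UNIV \<times> {int x, - int x}. A y)"
    using card_A by (intro card_mono finite_UN_I) auto
  also have "\<dots> \<le> (\<Sum>y\<in>UNIV \<times> {int x, - int x}. card (A y))" by (rule card_UN_le) auto
  also have "\<dots> \<le> (\<Sum>y\<in>(UNIV :: 'k set) \<times> {int x, - int x}. (2 * x + 1) ^ (CARD('k) - 1))"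
    using card_A by (intro sum_mono) auto
  also have "\<dots> = card ((UNIV :: 'k set) \<times> {int x, - int x}) * (2 * x + 1) ^ (CARD('k) - 1)" by simp
  also have "\<dots> \<le> (CARD('k) * 2) * (2 * x + 1) ^ (CARD('k) - 1)"
    by (intro mult_right_mono) (auto simp: card_cartesian_product card_insert_if)
  finally show ?thesis by (simp add: mult_ac)
qed

lemma AE_finite_if_summable:
  fixes \<psi> :: "nat \<Rightarrow> real"
  assumes \<psi>: "\<And>x. x \<ge> 1 \<Longrightarrow> \<psi> x > 0"
    and summable: "summable (\<lambda>j. real (Suc j) ^ (CARD('m) - 1) * \<psi> (Suc j) ^ CARD('n))"
  shows "AE \<Theta> :: real ^ 'm ^ 'n in lborel.
     finite {(q :: int ^ 'm, p :: int ^ 'n). q \<noteq> 0 \<and> infnorm (\<Theta> *v real_vec q + real_vec p) \<le> \<psi> (int_supnorm q)}"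
proof (rule AE_lborel_if_AE_unit_cubes)
  fix a :: "real ^ 'm ^ 'n"
  let ?m = "CARD('m)" and ?n = "CARD('n)"
  \<comment> \<open>Grouping the vectors q by their norm x, of which there are at most a constant
    times x^(m-1), turns the sum of the measures into the given series.\<close>
  define E where "E = (\<lambda>x. (\<Union>q\<in>{q :: int ^ 'm. int_supnorm q = x}. near_set q 1 (\<psi> x) \<inter> cube a 1))"
  have fin: "finite {q :: int ^ 'm. int_supnorm q = x}" for x
    by (rule finite_subset[OF _ finite_int_supnorm_le[of x]]) auto
  have E_sets: "E x \<in> sets lborel" for x
    unfolding E_def using fin by (intro sets.finite_UN) auto
  have cube_fin: "emeasure lborel (cube a 1) < \<infinity>" by (simp add: emeasure_cube)
  have E_fin: "emeasure lborel (E x) < \<infinity>" for x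
  proof -
    have "emeasure lborel (E x) \<le> emeasure lborel (cube a 1)" by (intro emeasure_mono) (auto simp: E_def)
    thus ?thesis using cube_fin by (rule order.strict_trans1)
  qed
  define C where "C = 2 * real ?m * 3 ^ (?m - 1) * 2 ^ ?n"
  have bound: "measure lborel (E x) \<le> C * (real x ^ (?m - 1) * \<psi> x ^ ?n)" if x: "x \<ge> 1" "\<psi> x < 1 / 2" for x
  proof -
    have "measure lborel (E x) \<le> (\<Sum>q\<in>{q :: int ^ 'm. int_supnorm q = x}. measure lborel (near_set q 1 (\<psi> x) \<inter> cube a 1))"
      unfolding E_def using fin by (intro measure_UNION_le) auto
    also have "\<dots> = (\<Sum>q\<in>{q :: int ^ 'm. int_supnorm q = x}. (2 * \<psi> x) ^ ?n)"
    proof (intro sum.cong refl)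
      fix q :: "int ^ 'm" assume q: "q \<in> {q. int_supnorm q = x}"
      have "\<not> int_supnorm q \<le> 0" using q x by simp
      then obtain i where "q $ i \<noteq> 0" unfolding int_supnorm_le_iff by auto
      thus "measure lborel (near_set q 1 (\<psi> x) \<inter> cube a 1) = (2 * \<psi> x) ^ ?n"
        using measure_near_set_cube[of 1 1 "\<psi> x" q i "q $ i" a] \<psi>[OF x(1)] x(2) by (simp add: measure_cube)
    qed
    also have "\<dots> = real (card {q :: int ^ 'm. int_supnorm q = x}) * (2 * \<psi> x) ^ ?n" by simp
    also have "\<dots> \<le> (2 * real ?m * (3 * real x) ^ (?m - 1)) * (2 * \<psi> x) ^ ?n"
    proof (rule mult_right_mono)
      have "real (card {q :: int ^ 'm. int_supnorm q = x}) \<le> real (2 * ?m * (2 * x + 1) ^ (?m - 1))"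
        by (intro of_nat_mono card_int_supnorm_eq_le)
      also have "\<dots> = 2 * real ?m * (2 * real x + 1) ^ (?m - 1)" by (simp add: add.commute)
      also have "\<dots> \<le> 2 * real ?m * (3 * real x) ^ (?m - 1)"
        using x by (intro mult_left_mono power_mono) auto
      finally show "real (card {q :: int ^ 'm. int_supnorm q = x}) \<le> 2 * real ?m * (3 * real x) ^ (?m - 1)" .
    qed (use \<psi>[OF x(1)] in simp)
    also have "\<dots> = C * (real x ^ (?m - 1) * \<psi> x ^ ?n)" by (simp add: C_def power_mult_distrib)
    finally show ?thesis .
  qed
  \<comment> \<open>The exact measure formula needs \<psi> < 1/2. This holds eventually, as the
    terms of the series tend to 0 and the weights are at least 1.\<close>
  have "eventually (\<lambda>j. real (Suc j) ^ (?m - 1) * \<psi> (Suc j) ^ ?n < (1 / 2) ^ ?n) sequentially"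
    by (rule order_tendstoD(2)[OF summable_LIMSEQ_zero[OF summable]]) simp
  hence ev: "eventually (\<lambda>j. norm (measure lborel (E (Suc j))) \<le> C * (real (Suc j) ^ (?m - 1) * \<psi> (Suc j) ^ ?n)) sequentially"
  proof eventually_elim
    case (elim j)
    have "1 * \<psi> (Suc j) ^ ?n \<le> real (Suc j) ^ (?m - 1) * \<psi> (Suc j) ^ ?n"
      using \<psi>[of "Suc j"] by (intro mult_right_mono one_le_power) auto
    hence "\<psi> (Suc j) ^ ?n < (1 / 2) ^ ?n" using elim by simp
    hence "\<psi> (Suc j) < 1 / 2" by (rule power_less_imp_less_base) simp
    thus ?case using bound[of "Suc j"] by simp
  qed
  have "summable (\<lambda>j. measure lborel (E (Suc j)))"
    by (rule summable_comparison_test_ev[OF ev]) (intro summable_mult summable)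
  hence "AE \<Theta> in lborel. eventually (\<lambda>j. \<Theta> \<in> space lborel - E (Suc j)) sequentially"
    using E_sets E_fin by (intro borel_cantelli_AE1) auto
  thus "AE \<Theta> in lborel. \<Theta> \<in> cube a 1 \<longrightarrow> finite {(q :: int ^ 'm, p :: int ^ 'n). q \<noteq> 0 \<and>
      infnorm (\<Theta> *v real_vec q + real_vec p) \<le> \<psi> (int_supnorm q)}"
  proof eventually_elim
    case (elim \<Theta>)
    then obtain J where J: "\<And>j. j \<ge> J \<Longrightarrow> \<Theta> \<notin> E (Suc j)" by (auto simp: eventually_sequentially)
    show ?case
    proof
      assume \<Theta>: "\<Theta> \<in> cube a 1"
      \<comment> \<open>Borel-Cantelli bounds only the norm of q. For each q the inequality confines
        p to a bounded box, which makes the set of pairs finite.\<close>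
      define P where "P = (\<lambda>q :: int ^ 'm. {p :: int ^ 'n. \<forall>r. p $ r \<in>
        {\<lceil>- \<psi> (int_supnorm q) - (\<Theta> *v real_vec q) $ r\<rceil>..\<lfloor>\<psi> (int_supnorm q) - (\<Theta> *v real_vec q) $ r\<rfloor>}})"
      have "{(q :: int ^ 'm, p :: int ^ 'n). q \<noteq> 0 \<and> infnorm (\<Theta> *v real_vec q + real_vec p) \<le> \<psi> (int_supnorm q)}
         \<subseteq> (SIGMA q:{q. int_supnorm q \<le> J}. P q)"
      proof (rule subsetI, elim CollectE case_prodE conjE)
        fix z and q :: "int ^ 'm" and p :: "int ^ 'n"
        assume z: "z = (q, p)" and le: "infnorm (\<Theta> *v real_vec q + real_vec p) \<le> \<psi> (int_supnorm q)"
        have "p \<in> P q"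
          unfolding P_def mem_Collect_eq atLeastAtMost_iff ceiling_le_iff le_floor_iff
        proof
          fix r
          have "\<bar>(\<Theta> *v real_vec q) $ r + of_int (p $ r)\<bar> \<le> \<psi> (int_supnorm q)"
            using le by (simp add: infnorm_le_iff_component)
          thus "- \<psi> (int_supnorm q) - (\<Theta> *v real_vec q) $ r \<le> of_int (p $ r) \<and>
              of_int (p $ r) \<le> \<psi> (int_supnorm q) - (\<Theta> *v real_vec q) $ r"
            by linarith
        qed
        moreover have "int_supnorm q \<le> J"
        proof (rule ccontr)
          assume "\<not> int_supnorm q \<le> J"
          then obtain j where j: "int_supnorm q = Suc j" "j \<ge> J" by (cases "int_supnorm q") auto
          have "\<Theta> \<in> near_set q 1 (\<psi> (Suc j))" using le j unfolding mem_near_set_1_iff by auto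
          hence "\<Theta> \<in> E (Suc j)" using \<Theta> j by (auto simp: E_def)
          thus False using J[OF j(2)] by simp
        qed
        ultimately show "z \<in> (SIGMA q:{q. int_supnorm q \<le> J}. P q)" by (simp add: z)
      qed
      moreover have "finite (SIGMA q:{q. int_supnorm q \<le> J}. P q)"
        unfolding P_def by (intro finite_SigmaI finite_int_supnorm_le finite_vec_components) simp
      ultimately show "finite {(q :: int ^ 'm, p :: int ^ 'n). q \<noteq> 0 \<and>
          infnorm (\<Theta> *v real_vec q + real_vec p) \<le> \<psi> (int_supnorm q)}"
        by (rule finite_subset)
    qed
  qed
qed

section \<open>Divergence\<close>

text \<open>The divergence part works with q having positive coordinates; functions into the
  naturals make them countable block by block in \<open>PiE\<close> sets.\<close>

definition int_vec :: "('m \<Rightarrow> nat) \<Rightarrow> int ^ 'm" where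
  "int_vec f = (\<chi> i. int (f i))"

lemma int_vec_nth [simp]: "int_vec f $ i = int (f i)"
  by (simp add: int_vec_def)

lemma int_supnorm_int_vec: "int_supnorm (int_vec f) = Max (range f)"
  by (simp add: int_supnorm_def)

lemma Gcd_nat_mult: "Gcd ((*) c ` A) = c * Gcd A" for c :: nat
  by (simp add: Gcd_mult)

text \<open>For proportional functions, \<open>f j = f j * Gcd (f'\<close> C) = f' j * Gcd (f
  \<open>C) = f' j\<close>, for every \<open>j\<close> and not only for those in the block
  \<open>C\<close>.\<close>

lemma not_proportional_if_Gcd_eq_1:
  fixes f f' :: "'m \<Rightarrow> nat"
  assumes "Gcd (f ` C) = 1" "Gcd (f' ` C) = 1" "f \<noteq> f'"
  shows "\<exists>i j. f i * f' j \<noteq> f j * f' i"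
proof (rule ccontr)
  assume "\<nexists>i j. f i * f' j \<noteq> f j * f' i"
  hence eq: "f i * f' j = f j * f' i" for i j by blast
  have "f j = f' j" for j
  proof -
    have "f j * Gcd (f' ` C) = Gcd ((\<lambda>i. f j * f' i) ` C)"
      using Gcd_nat_mult[of "f j" "f' ` C"] by (simp add: image_image)
    also have "(\<lambda>i. f j * f' i) = (\<lambda>i. f' j * f i)" by (auto simp: eq[of _ j] mult.commute)
    also have "Gcd ((\<lambda>i. f' j * f i) ` C) = f' j * Gcd (f ` C)"
      using Gcd_nat_mult[of "f' j" "f ` C"] by (simp add: image_image)
    finally show ?thesis using assms by simp
  qed
  thus False using assms(3) by blast
qed

text \<open>The densities of the blocks multiply because the block sizes add up to the dimension;
  the sum of the thresholds serves as a common one.\<close>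

lemma card_block_vectors_ge:
  fixes \<P> :: "'m::finite set set" and P :: "'m set \<Rightarrow> ('m \<Rightarrow> nat) \<Rightarrow> bool"
  assumes \<P>: "partition_on UNIV \<P>"
    and local: "\<And>C f g. C \<in> \<P> \<Longrightarrow> (\<And>i. i \<in> C \<Longrightarrow> f i = g i) \<Longrightarrow> P C f \<Longrightarrow> P C g"
    and dense: "\<And>C. C \<in> \<P> \<Longrightarrow> \<exists>c>0. \<exists>N\<^sub>0. \<forall>N\<ge>N\<^sub>0. c * real N ^ card C \<le> real (card {f \<in> C \<rightarrow>\<^sub>E {1..N}. P C f})"
  shows "\<exists>c>0. \<exists>N\<^sub>0. \<forall>N\<ge>N\<^sub>0. c * real N ^ CARD('m) \<le> real (card {f. range f \<subseteq> {1..N} \<and> (\<forall>C\<in>\<P>. P C f)})"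
proof -
  have "\<forall>C\<in>\<P>. \<exists>c N\<^sub>0. c > 0 \<and> (\<forall>N\<ge>N\<^sub>0. c * real N ^ card C \<le> real (card {f \<in> C \<rightarrow>\<^sub>E {1..N}. P C f}))"
    using dense by blast
  then obtain c N\<^sub>0 where c: "\<And>C. C \<in> \<P> \<Longrightarrow> c C > 0"
    and N\<^sub>0: "\<And>C N. C \<in> \<P> \<Longrightarrow> N\<^sub>0 C \<le> N \<Longrightarrow> c C * real N ^ card C \<le> real (card {f \<in> C \<rightarrow>\<^sub>E {1..N}. P C f})"
    by metis
  have card: "(\<Sum>C\<in>\<P>. card C) = CARD('m)"
    using card_Union_disjoint[of \<P>] partition_onD1[OF \<P>] partition_onD2[OF \<P>]
    by (simp add: disjoint_def pairwise_def disjnt_def)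
  have "prod c \<P> * real N ^ CARD('m) \<le> real (card {f. range f \<subseteq> {1..N} \<and> (\<forall>C\<in>\<P>. P C f)})"
    if N: "N \<ge> sum N\<^sub>0 \<P>" for N
  proof -
    have N_le: "N\<^sub>0 C \<le> N" if "C \<in> \<P>" for C
      using member_le_sum[of C \<P> N\<^sub>0] that N by simp
    have "(\<Prod>C\<in>\<P>. c C * real N ^ card C) \<le> (\<Prod>C\<in>\<P>. real (card {f \<in> C \<rightarrow>\<^sub>E {1..N}. P C f}))"
    proof (rule prod_mono)
      fix C assume C: "C \<in> \<P>"
      have "0 \<le> c C * real N ^ card C" using c[OF C] by simp
      with N\<^sub>0[OF C N_le[OF C]]
      show "0 \<le> c C * real N ^ card C \<and> c C * real N ^ card C \<le> real (card {f \<in> C \<rightarrow>\<^sub>E {1..N}. P C f})"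
        by simp
    qed
    also have "\<dots> = real (\<Prod>C\<in>\<P>. card {f \<in> C \<rightarrow>\<^sub>E {1..N}. P C f})" by simp
    also have "\<dots> \<le> real (card {f. range f \<subseteq> {1..N} \<and> (\<forall>C\<in>\<P>. P C f)})"
    proof (rule of_nat_mono, rule card_PiE_blocks_le[OF \<P>])
      show "P C g" if "C \<in> \<P>" "\<And>i. i \<in> C \<Longrightarrow> f i = g i" "P C f" for C f g by (rule local[OF that])
    qed simp
    finally show ?thesis
      by (simp add: prod.distrib power_sum[symmetric] card)
  qed
  moreover have "prod c \<P> > 0" using c by (intro prod_pos) auto
  ultimately show ?thesis by blast
qed

text \<open>Truncating \<open>\<psi>\<close> below \<open>1 / 2\<close> makes the cubes around the integer points disjoint. The truncation may
  destroy the monotonicity of the weighted function, so it comes after the divergence over \<open>Q\<close>.\<close>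

lemma truncated_diverges_over_blocks:
  fixes \<P> :: "'m::finite set set" and P :: "'m set \<Rightarrow> ('m \<Rightarrow> nat) \<Rightarrow> bool" and \<psi> :: "nat \<Rightarrow> real"
  assumes \<P>: "partition_on UNIV \<P>"
    and local: "\<And>C f g. C \<in> \<P> \<Longrightarrow> (\<And>i. i \<in> C \<Longrightarrow> f i = g i) \<Longrightarrow> P C f \<Longrightarrow> P C g"
    and dense: "\<And>C. C \<in> \<P> \<Longrightarrow> \<exists>c>0. \<exists>N\<^sub>0. \<forall>N\<ge>N\<^sub>0. c * real N ^ card C \<le> real (card {f \<in> C \<rightarrow>\<^sub>E {1..N}. P C f})"
    and \<psi>: "\<And>x. x \<ge> 1 \<Longrightarrow> \<psi> x > 0"
    and anti: "antimono_on {1..} (\<lambda>x. real x ^ (CARD('m) - 1) * \<psi> x ^ n)"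
    and diverge: "\<not> summable (\<lambda>j. real (Suc j) ^ (CARD('m) - 1) * \<psi> (Suc j) ^ n)" and n: "n > 0"
  shows "\<exists>X. finite X \<and> X \<subseteq> {f \<in> {f. (\<forall>i. 1 \<le> f i) \<and> (\<forall>C\<in>\<P>. P C f)}. Max (range f) > k} \<and>
    R \<le> (\<Sum>f\<in>X. (2 * min (\<psi> (Max (range f))) (1 / 4)) ^ n)"
proof -
  let ?Q = "{f. (\<forall>i. 1 \<le> f i) \<and> (\<forall>C\<in>\<P>. P C f)}" and ?\<nu> = "\<lambda>f :: 'm \<Rightarrow> nat. Max (range f)"
  have Q_le: "{f \<in> ?Q. ?\<nu> f \<le> N} = {f. range f \<subseteq> {1..N} \<and> (\<forall>C\<in>\<P>. P C f)}" for N
    by (auto simp: image_subset_iff)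
  have sub: "{f \<in> ?Q. ?\<nu> f \<le> N} \<subseteq> UNIV \<rightarrow>\<^sub>E {1..N}" for N
    unfolding Q_le by auto
  have fin: "finite (UNIV \<rightarrow>\<^sub>E {1..N} :: ('m \<Rightarrow> nat) set)" for N by (intro finite_PiE) auto
  have "\<exists>c>0. \<exists>N\<^sub>0. \<forall>N\<ge>N\<^sub>0. c * real N ^ CARD('m) \<le> real (card {f. range f \<subseteq> {1..N} \<and> (\<forall>C\<in>\<P>. P C f)})"
  proof (rule card_block_vectors_ge[OF \<P>])
    show "P C g" if "C \<in> \<P>" "\<And>i. i \<in> C \<Longrightarrow> f i = g i" "P C f" for C f g by (rule local[OF that])
  qed (rule dense)
  then obtain c N\<^sub>0 where c: "c > 0"
    "\<And>N. N \<ge> N\<^sub>0 \<Longrightarrow> c * real N ^ CARD('m) \<le> real (card {f. range f \<subseteq> {1..N} \<and> (\<forall>C\<in>\<P>. P C f)})"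
    by blast
  \<comment> \<open>Monotonicity gives \<psi> <= M, and M >= 1/4. Hence \<psi> / (2 M) is at most
    1/2 and at most 2 \<psi>, that is, at most twice the truncation; \<gamma> carries this over to
    n-th powers.\<close>
  define M where "M = max (\<psi> 1) (1 / 4)"
  have M: "M > 0" by (simp add: M_def)
  define \<gamma> where "\<gamma> = (1 / (2 * M)) ^ n"
  have \<gamma>: "\<gamma> > 0" using M by (simp add: \<gamma>_def)
  have \<psi>_le: "\<psi> x \<le> M" if "x \<ge> 1" for x
  proof -
    have "1 * \<psi> x ^ n \<le> real x ^ (CARD('m) - 1) * \<psi> x ^ n"
      using that \<psi>[OF that] by (intro mult_right_mono one_le_power) auto
    also have "\<dots> \<le> real 1 ^ (CARD('m) - 1) * \<psi> 1 ^ n"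
      using anti that unfolding monotone_on_def by (metis atLeast_iff order_refl)
    finally have "\<psi> x ^ n \<le> \<psi> 1 ^ n" by simp
    hence "\<psi> x \<le> \<psi> 1" using power_mono_iff[of "\<psi> x" "\<psi> 1" n] \<psi>[OF that] \<psi>[of 1] n by simp
    thus ?thesis by (simp add: M_def)
  qed
  have "\<exists>X. finite X \<and> X \<subseteq> {f \<in> ?Q. ?\<nu> f > k} \<and> R / \<gamma> \<le> (\<Sum>f\<in>X. \<psi> (?\<nu> f) ^ n)"
  proof (rule diverges_over_positive_density[OF _ c(1) _ _ _ _ anti diverge])
    show "finite {f \<in> ?Q. ?\<nu> f \<le> N}" for N by (rule finite_subset[OF sub fin])
    show "card {f \<in> ?Q. ?\<nu> f \<le> N} \<le> N ^ CARD('m)" for N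
      using card_mono[OF fin sub, of N] by (simp add: card_PiE)
    show "c * real N ^ CARD('m) \<le> real (card {f \<in> ?Q. ?\<nu> f \<le> N})" if "N \<ge> N\<^sub>0" for N
      unfolding Q_le by (rule c(2)[OF that])
    show "0 \<le> \<psi> x ^ n" if "x \<ge> 1" for x using \<psi>[OF that] by simp
  qed (simp add: Suc_le_eq)
  then obtain X where X: "finite X" "X \<subseteq> {f \<in> ?Q. ?\<nu> f > k}" "R / \<gamma> \<le> (\<Sum>f\<in>X. \<psi> (?\<nu> f) ^ n)" by blast
  have "R \<le> \<gamma> * (\<Sum>f\<in>X. \<psi> (?\<nu> f) ^ n)" using X(3) \<gamma> by (simp add: pos_divide_le_eq mult.commute)
  also have "\<dots> \<le> (\<Sum>f\<in>X. (2 * min (\<psi> (?\<nu> f)) (1 / 4)) ^ n)"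
    unfolding sum_distrib_left
  proof (rule sum_mono)
    fix f assume f: "f \<in> X"
    hence "1 \<le> f undefined" using X(2) by auto
    also have "\<dots> \<le> ?\<nu> f" by (rule Max_ge) auto
    finally have \<nu>: "1 \<le> ?\<nu> f" .
    have "1 / (2 * M) * \<psi> (?\<nu> f) \<le> 2 * min (\<psi> (?\<nu> f)) (1 / 4)"
    proof -
      have "1 / (2 * M) * \<psi> (?\<nu> f) \<le> 1 / (2 * M) * M"
        using \<psi>_le[OF \<nu>] M by (intro mult_left_mono) auto
      moreover have "1 / (2 * M) * \<psi> (?\<nu> f) \<le> 2 * \<psi> (?\<nu> f)"
        using \<psi>[OF \<nu>] by (intro mult_right_mono) (auto simp: M_def max_def field_simps)
      ultimately show ?thesis using M by (simp add: min_def)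
    qed
    hence "(1 / (2 * M) * \<psi> (?\<nu> f)) ^ n \<le> (2 * min (\<psi> (?\<nu> f)) (1 / 4)) ^ n"
      using M \<psi>[OF \<nu>] by (intro power_mono) auto
    thus "\<gamma> * \<psi> (?\<nu> f) ^ n \<le> (2 * min (\<psi> (?\<nu> f)) (1 / 4)) ^ n"
      by (simp only: \<gamma>_def power_mult_distrib)
  qed
  finally show ?thesis using X by blast
qed

lemma infinite_solutions:
  fixes \<Theta> :: "real ^ 'm ^ 'n"
  assumes "\<And>k. \<exists>f. Max (range f) > k \<and> (\<exists>p. stack (int_vec f) p \<in> primitive_points \<pi> \<and>
      infnorm (\<Theta> *v real_vec (int_vec f) + real_vec p) \<le> \<psi> (Max (range f)))"
  shows "infinite {(q :: int ^ 'm, p :: int ^ 'n). stack q p \<in> primitive_points \<pi> \<and> q \<noteq> 0 \<and>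
      infnorm (\<Theta> *v real_vec q + real_vec p) \<le> \<psi> (int_supnorm q)}" (is "infinite ?S")
proof
  assume fin: "finite ?S"
  \<comment> \<open>Inserting 0 keeps the maximum meaningful when there is no solution at
    all.\<close>
  obtain f p where fp: "Max (range f) > Max (insert 0 ((\<lambda>(q, p). int_supnorm q) ` ?S))"
    "stack (int_vec f) p \<in> primitive_points \<pi>"
    "infnorm (\<Theta> *v real_vec (int_vec f) + real_vec p) \<le> \<psi> (Max (range f))"
    using assms by blast
  have "int_vec f \<noteq> 0"
  proof
    assume "int_vec f = 0"
    hence "int_supnorm (int_vec f) \<le> 0" by (simp only: int_supnorm_le_iff) simp
    thus False using fp(1) by (simp add: int_supnorm_int_vec)
  qed
  with fp have "(int_vec f, p) \<in> ?S" by (simp add: int_supnorm_int_vec)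
  hence "int_supnorm (int_vec f) \<in> insert 0 ((\<lambda>(q, p). int_supnorm q) ` ?S)" by (intro insertI2) (rule image_eqI, auto)
  hence "int_supnorm (int_vec f) \<le> Max (insert 0 ((\<lambda>(q, p). int_supnorm q) ` ?S))"
    using fin by (intro Max_ge) auto
  thus False using fp(1) by (simp only: int_supnorm_int_vec)
qed

text \<open>A common divisor of the block divides in particular its q-coordinates. Blocks of this
  kind therefore leave p free.\<close>

lemma Gcd_stack_eq_1:
  fixes f :: "'m::finite \<Rightarrow> nat" and p :: "int ^ 'n" and B :: "('m + 'n) set"
  assumes "Gcd (f ` (Inl -` B)) = 1"
  shows "Gcd ((\<lambda>i. stack (int_vec f) p $ i) ` B) = 1"
proof -
  define g where "g = Gcd ((\<lambda>i. stack (int_vec f) p $ i) ` B)"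
  have "nat g dvd Gcd (f ` (Inl -` B))"
  proof (rule Gcd_greatest, elim imageE)
    fix x i assume x: "x = f i" "i \<in> Inl -` B"
    have "g dvd stack (int_vec f) p $ Inl i" unfolding g_def using x by (intro Gcd_dvd) auto
    hence "g dvd int (f i)" by (simp add: stack_def)
    moreover have "0 \<le> g" by (simp add: g_def)
    ultimately show "nat g dvd x" using x by (simp add: nat_dvd_iff)
  qed
  hence "nat g = 1" using assms by simp
  thus ?thesis unfolding g_def[symmetric] by linarith
qed

lemma int_vec_noncollinear:
  assumes "Gcd (f ` C) = 1" "Gcd (f' ` C) = 1" "f \<noteq> f'"
  shows "\<exists>i j. int_vec f $ i * int_vec f' $ j \<noteq> int_vec f $ j * int_vec f' $ i"
  using not_proportional_if_Gcd_eq_1[OF assms] by (simp flip: of_nat_mult)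

lemma int_vec_nonzero:
  assumes "\<And>i. 1 \<le> f i"
  shows "int_vec f \<noteq> 0"
proof
  assume "int_vec f = 0"
  hence "int (f undefined) = 0" by (metis int_vec_nth zero_index)
  thus False using assms[of undefined] by simp
qed

lemma partition_on_Inl:
  assumes "partition_on UNIV \<pi>" "\<And>B. B \<in> \<pi> \<Longrightarrow> Inl -` B \<noteq> {}"
  shows "partition_on UNIV ((-`) Inl ` \<pi>)"
  using partition_on_vimage[OF assms(1), of Inl] assms(2)
  by (metis Diff_empty Diff_insert0 imageE vimage_UNIV)

text \<open>All of primitivity is imposed on q, so every p is admissible, plain
  \<open>near_set\<close> suffices, and the moments are those of pairwise independent events. The
  constants c = C = 1 then give the whole unit cube.\<close>

lemma AE_infinite_if_blocks_ge_2:
  fixes \<pi> :: "('m::finite + 'n::finite) set set" and \<psi> :: "nat \<Rightarrow> real"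
  assumes \<pi>: "partition_on UNIV \<pi>" and card: "\<And>B. B \<in> \<pi> \<Longrightarrow> card (Inl -` B) \<ge> 2"
    and \<psi>: "\<And>x. x \<ge> 1 \<Longrightarrow> \<psi> x > 0"
    and anti: "antimono_on {1..} (\<lambda>x. real x ^ (CARD('m) - 1) * \<psi> x ^ CARD('n))"
    and diverge: "\<not> summable (\<lambda>j. real (Suc j) ^ (CARD('m) - 1) * \<psi> (Suc j) ^ CARD('n))"
  shows "AE \<Theta> :: real ^ 'm ^ 'n in lborel. infinite {(q :: int ^ 'm, p :: int ^ 'n).
      stack q p \<in> primitive_points \<pi> \<and> q \<noteq> 0 \<and> infnorm (\<Theta> *v real_vec q + real_vec p) \<le> \<psi> (int_supnorm q)}"
proof -
  define \<P> :: "'m set set" where "\<P> = (-`) Inl ` \<pi>"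
  have \<P>: "partition_on UNIV \<P>" unfolding \<P>_def
    by (rule partition_on_Inl[OF \<pi>]) (use card in fastforce)
  define Q where "Q = {f :: 'm \<Rightarrow> nat. (\<forall>i. 1 \<le> f i) \<and> (\<forall>C\<in>\<P>. Gcd (f ` C) = 1)}"
  define \<epsilon> where "\<epsilon> = (\<lambda>f :: 'm \<Rightarrow> nat. min (\<psi> (Max (range f))) (1 / 4))"
  have tails: "\<exists>X. finite X \<and> X \<subseteq> {f \<in> Q. Max (range f) > k} \<and> R \<le> (\<Sum>f\<in>X. (2 * \<epsilon> f) ^ CARD('n))" for k R
    unfolding Q_def \<epsilon>_def
  proof (rule truncated_diverges_over_blocks[OF \<P> _ _ \<psi> anti diverge])
    fix C and f g :: "'m \<Rightarrow> nat"
    assume "\<And>i. i \<in> C \<Longrightarrow> f i = g i" "Gcd (f ` C) = 1"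
    thus "Gcd (g ` C) = 1" by (metis image_cong)
  next
    fix C assume "C \<in> \<P>"
    hence "card C \<ge> 2" using card by (auto simp: \<P>_def)
    thus "\<exists>c>0. \<exists>N\<^sub>0. \<forall>N\<ge>N\<^sub>0. c * real N ^ card C \<le> real (card {f \<in> C \<rightarrow>\<^sub>E {1..N}. Gcd (f ` C) = 1})"
      by (intro exI[of _ "1 / 4"]) (use card_coprime_ge[of C] in auto)
  qed simp_all
  have "\<P> \<noteq> {}" using partition_onD1[OF \<P>] by auto
  \<comment> \<open>Primitivity on one block already makes distinct vectors
    non-proportional.\<close>
  then obtain C where C: "C \<in> \<P>" by blast
  have Q: "1 \<le> f i" "Gcd (f ` C) = 1" if "f \<in> Q" for f i using that C by (auto simp: Q_def)
  have \<epsilon>: "0 \<le> \<epsilon> f \<and> \<epsilon> f \<le> 1 / 4" if "f \<in> Q" for f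
  proof -
    have "1 \<le> f undefined" using Q(1)[OF that] .
    also have "\<dots> \<le> Max (range f)" by (rule Max_ge) auto
    finally show ?thesis using \<psi> by (simp add: \<epsilon>_def less_imp_le)
  qed
  have indep: "\<exists>i j. int_vec f $ i * int_vec g $ j \<noteq> int_vec f $ j * int_vec g $ i"
    if "f \<in> Q" "g \<in> Q" "f \<noteq> g" for f g
    using Q(2)[OF that(1)] Q(2)[OF that(2)] that(3) by (rule int_vec_noncollinear)
  show ?thesis
  proof (rule AE_lborel_if_AE_unit_cubes)
    fix a :: "real ^ 'm ^ 'n"
    define A where "A = (\<lambda>f. near_set (int_vec f) 1 (\<epsilon> f) :: (real ^ 'm ^ 'n) set)"
    define W where "W = {\<Theta> \<in> cube a 1. \<forall>k. \<exists>f\<in>Q. Max (range f) > k \<and> \<Theta> \<in> A f}"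
    have [measurable]: "A f \<in> sets borel" for f by (simp add: A_def)
    have W_sets: "W \<in> sets borel"
    proof -
      have "W = cube a 1 \<inter> (\<Inter>k. \<Union>f\<in>{f\<in>Q. Max (range f) > k}. A f)" by (auto simp: W_def)
      also have "\<dots> \<in> sets borel"
        by (intro sets.Int sets.countable_INT' sets.countable_UN') (auto intro: countable_subset[OF subset_UNIV])
      finally show ?thesis .
    qed
    have "1\<^sup>2 / 1 * measure lborel (cube a 1) \<le> measure lborel W"
      unfolding W_def
    proof (rule measure_limsup_ge[where s = "\<lambda>f. (2 * \<epsilon> f) ^ CARD('n)" and C' = 1])
      show "countable Q" by (rule countable_subset[OF subset_UNIV]) simp
      show "1 * (2 * \<epsilon> f) ^ CARD('n) * measure lborel (cube a 1) \<le> measure lborel (A f \<inter> cube a 1)" if "f \<in> Q" for f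
        using sum_measure_inter_cube_le(2)[of "{f}" \<epsilon> int_vec f a] \<epsilon>[OF that] int_vec_nonzero[of f] Q(1)[OF that]
        by (simp add: A_def measure_cube)
      show "(\<Sum>f\<in>X. \<Sum>g\<in>X. measure lborel (A f \<inter> A g \<inter> cube a 1)) \<le>
          1 * measure lborel (cube a 1) * (\<Sum>f\<in>X. (2 * \<epsilon> f) ^ CARD('n))\<^sup>2 + 1 * (\<Sum>f\<in>X. (2 * \<epsilon> f) ^ CARD('n))"
        if X: "finite X" "X \<subseteq> Q" for X
      proof -
        have "(\<Sum>f\<in>X. \<Sum>g\<in>X. measure lborel (A f \<inter> A g \<inter> cube a 1)) \<le>
          (\<Sum>f\<in>X. (2 * \<epsilon> f) ^ CARD('n))\<^sup>2 + (\<Sum>f\<in>X. (2 * \<epsilon> f) ^ CARD('n))"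
          unfolding A_def
        proof (rule sum_measure_inter_cube_le(1)[OF X(1)])
          show "0 \<le> \<epsilon> f \<and> \<epsilon> f \<le> 1 / 4" if "f \<in> X" for f using \<epsilon> that X by blast
          show "int_vec f \<noteq> 0" if "f \<in> X" for f using int_vec_nonzero Q(1) that X by blast
          show "\<exists>i j. int_vec f $ i * int_vec g $ j \<noteq> int_vec f $ j * int_vec g $ i"
            if "f \<in> X" "g \<in> X" "f \<noteq> g" for f g using indep that X by blast
        qed
        thus ?thesis by (simp add: measure_cube)
      qed
    qed (use \<epsilon> tails in \<open>auto simp: emeasure_cube\<close>)
    hence le: "measure lborel (cube a 1) \<le> measure lborel W" by simp
    have "emeasure lborel (cube a 1 - W) = 0"
    proof -
      have fm: "cube a 1 - W \<in> fmeasurable lborel"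
        using W_sets by (intro fmeasurableI2[OF fmeasurable_cube[of 1 a]]) auto
      have "measure lborel (cube a 1 - W) = measure lborel (cube a 1) - measure lborel W"
        using W_sets by (intro measure_Diff) (auto simp: emeasure_cube W_def)
      hence "measure lborel (cube a 1 - W) = 0"
        using le measure_nonneg[of lborel "cube a 1 - W"] by linarith
      thus ?thesis using emeasure_eq_measure2[OF fm] by simp
    qed
    hence "AE \<Theta> in lborel. \<Theta> \<notin> cube a 1 - W"
      using W_sets by (intro AE_not_in) (auto simp: null_sets_def)
    thus "AE \<Theta> in lborel. \<Theta> \<in> cube a 1 \<longrightarrow> infinite {(q :: int ^ 'm, p :: int ^ 'n).
      stack q p \<in> primitive_points \<pi> \<and> q \<noteq> 0 \<and> infnorm (\<Theta> *v real_vec q + real_vec p) \<le> \<psi> (int_supnorm q)}"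
    proof eventually_elim
      case (elim \<Theta>)
      show ?case
      proof
        assume "\<Theta> \<in> cube a 1"
        hence \<Theta>: "\<Theta> \<in> W" using elim by blast
        show "infinite {(q :: int ^ 'm, p :: int ^ 'n).
          stack q p \<in> primitive_points \<pi> \<and> q \<noteq> 0 \<and> infnorm (\<Theta> *v real_vec q + real_vec p) \<le> \<psi> (int_supnorm q)}"
        proof (rule infinite_solutions)
          fix k
          obtain f where f: "f \<in> Q" "Max (range f) > k" "\<Theta> \<in> A f" using \<Theta> by (auto simp: W_def)
          then obtain p :: "int ^ 'n" where p: "infnorm (\<Theta> *v real_vec (int_vec f) + real_vec p) \<le> \<epsilon> f"
            unfolding A_def mem_near_set_1_iff by blast
          have "stack (int_vec f) p \<in> primitive_points \<pi>"
            using f(1) by (auto simp: primitive_points_def Q_def \<P>_def intro!: Gcd_stack_eq_1)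
          thus "\<exists>f. Max (range f) > k \<and> (\<exists>p. stack (int_vec f) p \<in> primitive_points \<pi> \<and>
            infnorm (\<Theta> *v real_vec (int_vec f) + real_vec p) \<le> \<psi> (Max (range f)))"
            using f p by (auto simp: \<epsilon>_def)
        qed
      qed
    qed
  qed
qed

lemma card_few_divisors_functions_ge:
  assumes "N \<ge> 2 ^ j"
  shows "real N / (400 * 2 ^ j) \<le>
    real (card {f \<in> {i} \<rightarrow>\<^sub>E {1..N}. \<exists>r. f i = 2 ^ j * r \<and> few_divisors r})"
proof -
  let ?\<Phi> = "\<lambda>x. \<lambda>i'\<in>{i}. x :: nat"
  have "card {x\<in>{1..N}. \<exists>r. x = 2 ^ j * r \<and> few_divisors r} \<le>
      card {f \<in> {i} \<rightarrow>\<^sub>E {1..N}. \<exists>r. f i = 2 ^ j * r \<and> few_divisors r}"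
  proof (rule card_inj_on_le[of ?\<Phi>])
    show "inj_on ?\<Phi> {x\<in>{1..N}. \<exists>r. x = 2 ^ j * r \<and> few_divisors r}"
    proof (rule inj_onI)
      fix x y assume "?\<Phi> x = ?\<Phi> y"
      thus "x = y" by (metis insertI1 restrict_apply)
    qed
    show "?\<Phi> ` {x\<in>{1..N}. \<exists>r. x = 2 ^ j * r \<and> few_divisors r} \<subseteq>
        {f \<in> {i} \<rightarrow>\<^sub>E {1..N}. \<exists>r. f i = 2 ^ j * r \<and> few_divisors r}"
      by (auto split: if_splits)
    have "finite ({i} \<rightarrow>\<^sub>E {1..N})" by (intro finite_PiE) auto
    thus "finite {f \<in> {i} \<rightarrow>\<^sub>E {1..N}. \<exists>r. f i = 2 ^ j * r \<and> few_divisors r}" by simp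
  qed
  thus ?thesis using card_few_divisors_multiples_ge[OF assms] by linarith
qed

text \<open>One set \<open>W\<close>, built from the family \<open>G\<close> that does not involve
  j, has to be bounded below in all dyadic cubes. Cubes of side 2^-j use the subfamily
  \<open>Q j\<close>; j affects how far one must go to collect a large sum, but not the proportion
  \<open>(1 / 50)\<^sup>2 / 6 ^ CARD('n)\<close>.\<close>

lemma AE_infinite_if_mixed_block:
  fixes \<pi> :: "('m::finite + 'n::finite) set set" and \<psi> :: "nat \<Rightarrow> real"
  assumes \<pi>: "partition_on UNIV \<pi>" and B\<^sub>0: "B\<^sub>0 \<in> \<pi>" "B\<^sub>0 = insert (Inl i\<^sub>0) (range Inr)"
    and card: "\<And>B. B \<in> \<pi> \<Longrightarrow> B \<noteq> B\<^sub>0 \<Longrightarrow> card (Inl -` B) \<ge> 2"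
    and \<psi>: "\<And>x. x \<ge> 1 \<Longrightarrow> \<psi> x > 0"
    and anti: "antimono_on {1..} (\<lambda>x. real x ^ (CARD('m) - 1) * \<psi> x ^ CARD('n))"
    and diverge: "\<not> summable (\<lambda>j. real (Suc j) ^ (CARD('m) - 1) * \<psi> (Suc j) ^ CARD('n))"
  shows "AE \<Theta> :: real ^ 'm ^ 'n in lborel. infinite {(q :: int ^ 'm, p :: int ^ 'n).
      stack q p \<in> primitive_points \<pi> \<and> q \<noteq> 0 \<and> infnorm (\<Theta> *v real_vec q + real_vec p) \<le> \<psi> (int_supnorm q)}"
proof -
  define \<P> :: "'m set set" where "\<P> = (-`) Inl ` \<pi>"
  have Inl_B\<^sub>0: "Inl -` B\<^sub>0 = {i\<^sub>0}" by (auto simp: B\<^sub>0)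
  have \<P>: "partition_on UNIV \<P>" unfolding \<P>_def
    by (rule partition_on_Inl[OF \<pi>]) (use card Inl_B\<^sub>0 in fastforce)
  have card_\<P>: "card C \<ge> 2" if "C \<in> \<P>" "C \<noteq> {i\<^sub>0}" for C
    using that card Inl_B\<^sub>0 by (auto simp: \<P>_def)
  define G where "G = {f :: 'm \<Rightarrow> nat. (\<forall>i. 1 \<le> f i) \<and> (\<forall>C\<in>\<P> - {{i\<^sub>0}}. Gcd (f ` C) = 1)}"
  \<comment> \<open>On the single coordinate a gcd condition would leave only the value 1. It is
    replaced by a shape that leaves enough numerators p coprime to it.\<close>
  define P where "P = (\<lambda>j C f. if C = {i\<^sub>0} then \<exists>r. f i\<^sub>0 = 2 ^ Suc j * r \<and> few_divisors r else Gcd (f ` C) = 1)"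
  define Q where "Q = (\<lambda>j. {f :: 'm \<Rightarrow> nat. (\<forall>i. 1 \<le> f i) \<and> (\<forall>C\<in>\<P>. P j C f)})"
  have i\<^sub>0: "{i\<^sub>0} \<in> \<P>" using B\<^sub>0(1) Inl_B\<^sub>0 by (auto simp: \<P>_def)
  have Q: "f \<in> G" "\<exists>r. f i\<^sub>0 = 2 ^ Suc j * r \<and> few_divisors r" if "f \<in> Q j" for f j
  proof -
    show "f \<in> G" using that by (auto simp: Q_def G_def P_def)
    show "\<exists>r. f i\<^sub>0 = 2 ^ Suc j * r \<and> few_divisors r" using that i\<^sub>0 unfolding Q_def P_def by force
  qed
  define \<epsilon> where "\<epsilon> = (\<lambda>f :: 'm \<Rightarrow> nat. min (\<psi> (Max (range f))) (1 / 4))"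
  have tails: "\<exists>X. finite X \<and> X \<subseteq> {f \<in> Q j. Max (range f) > k} \<and> R \<le> (\<Sum>f\<in>X. (2 * \<epsilon> f) ^ CARD('n))" for j k R
    unfolding Q_def \<epsilon>_def
  proof (rule truncated_diverges_over_blocks[OF \<P> _ _ \<psi> anti diverge])
    fix C and f g :: "'m \<Rightarrow> nat"
    assume "\<And>i. i \<in> C \<Longrightarrow> f i = g i" "P j C f"
    moreover from this have "f ` C = g ` C" by simp
    ultimately show "P j C g" by (cases "C = {i\<^sub>0}") (simp_all add: P_def)
  next
    fix C assume C: "C \<in> \<P>"
    show "\<exists>c>0. \<exists>N\<^sub>0. \<forall>N\<ge>N\<^sub>0. c * real N ^ card C \<le> real (card {f \<in> C \<rightarrow>\<^sub>E {1..N}. P j C f})"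
    proof (cases "C = {i\<^sub>0}")
      case True
      show ?thesis unfolding True P_def
        by (intro exI[of _ "1 / (400 * 2 ^ Suc j)"] exI[of _ "2 ^ Suc j"] conjI allI impI)
          (use card_few_divisors_functions_ge[of "Suc j" _ i\<^sub>0] in auto)
    next
      case False
      thus ?thesis using card_\<P>[OF C] card_coprime_ge[of C]
        by (intro exI[of _ "1 / 4"]) (auto simp: P_def)
    qed
  qed simp_all
  have G: "1 \<le> f i" if "f \<in> G" for f i using that by (auto simp: G_def)
  have \<epsilon>: "0 \<le> \<epsilon> f" "\<epsilon> f \<le> 1 / 4" if "f \<in> G" for f
  proof -
    have "1 \<le> f undefined" using G[OF that] .
    also have "\<dots> \<le> Max (range f)" by (rule Max_ge) auto
    finally show "0 \<le> \<epsilon> f" "\<epsilon> f \<le> 1 / 4" using \<psi> by (simp_all add: \<epsilon>_def less_imp_le)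
  qed
  define A where "A = (\<lambda>f. prim_near_set (int_vec f) i\<^sub>0 (\<epsilon> f) :: (real ^ 'm ^ 'n) set)"
  have [measurable]: "A f \<in> sets borel" for f by (simp add: A_def)
  define W where "W = {\<Theta>. \<forall>k. \<exists>f\<in>G. Max (range f) > k \<and> \<Theta> \<in> A f}"
  have W_sets: "W \<in> sets borel"
  proof -
    have "W = (\<Inter>k. \<Union>f\<in>{f\<in>G. Max (range f) > k}. A f)" by (auto simp: W_def)
    also have "\<dots> \<in> sets borel"
      by (intro sets.countable_INT' sets.countable_UN') (auto intro: countable_subset[OF subset_UNIV])
    finally show ?thesis .
  qed
  define s where "s = (\<lambda>f. (2 * \<epsilon> f) ^ CARD('n))"
  have s: "0 \<le> s f" if "f \<in> G" for f using \<epsilon>[OF that] by (simp add: s_def)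
  \<comment> \<open>Brings the bound for m >= 2, whose leading constant is 2, under the constant of
    the case m = 1.\<close>
  have six: "(2::real) \<le> 6 ^ CARD('n)"
    using self_le_power[of "6::real" "CARD('n)"] by (simp add: Suc_le_eq)
  have upper: "(\<Sum>f\<in>X. \<Sum>g\<in>X. measure lborel (A f \<inter> A g \<inter> cube a (1 / 2 ^ j))) \<le>
      6 ^ CARD('n) * measure lborel (cube a (1 / 2 ^ j)) * (sum s X)\<^sup>2 + 2 * sum s X"
    if X: "finite X" "X \<subseteq> Q j" for X j and a :: "real ^ 'm ^ 'n"
  proof (cases "UNIV = {i\<^sub>0}")
    case True
    define b where "b = measure lborel (cube a (1 / 2 ^ j))"
    have b: "0 \<le> b" "b \<le> 1" unfolding b_def by (simp_all add: measure_cube power_le_one)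
    have "measure lborel (A f \<inter> A g \<inter> cube a (1 / 2 ^ j)) \<le> 6 ^ CARD('n) * b * (s f * s g) + (if f = g then s f else 0)"
      if f: "f \<in> X" and g: "g \<in> X" for f g
    proof -
      have fG: "f \<in> G" and gG: "g \<in> G" using f g X Q by blast+
      obtain r where r: "f i\<^sub>0 = 2 ^ Suc j * r" using Q(2)[of f j] f X by blast
      obtain r' where r': "g i\<^sub>0 = 2 ^ Suc j * r'" using Q(2)[of g j] g X by blast
      show ?thesis
      proof (cases "f = g")
        case True
        have "measure lborel (A f \<inter> A g \<inter> cube a (1 / 2 ^ j)) \<le> measure lborel (near_set (int_vec f) 1 (\<epsilon> f) \<inter> cube a (1 / 2 ^ j))"
          using prim_near_set_subset[of "int_vec f" i\<^sub>0 "\<epsilon> f"] True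
          by (intro measure_mono_fmeasurable fmeasurableI2[OF fmeasurable_cube[of "1 / 2 ^ j" a]]) (auto simp: A_def)
        also have "\<dots> = s f * b"
          using measure_near_set_cube[of "1 / 2 ^ j" 1 "\<epsilon> f" "int_vec f" i\<^sub>0 "2 * int r" a] \<epsilon>[OF fG] G[OF fG, of i\<^sub>0] r
          by (simp add: s_def b_def)
        also have "\<dots> \<le> s f * 1" using b s[OF fG] by (intro mult_left_mono) auto
        finally show ?thesis using True b s[OF fG] by (simp add: add_increasing)
      next
        case False
        have "int_vec f \<noteq> int_vec g"
        proof
          assume "int_vec f = int_vec g"
          hence "f i = g i" for i by (metis int_vec_nth of_nat_eq_iff)
          thus False using False by blast
        qed
        moreover have "r > 0" "r' > 0" using G[OF fG, of i\<^sub>0] G[OF gG, of i\<^sub>0] r r' by (auto intro: gr0I)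
        ultimately have "measure lborel (A f \<inter> A g \<inter> cube a (1 / real (2 ^ j))) \<le> 6 ^ CARD('n) * (2 * \<epsilon> f) ^ CARD('n) *
            (2 * \<epsilon> g) ^ CARD('n) * measure lborel (cube a (1 / real (2 ^ j)))"
          unfolding A_def using \<epsilon>[OF fG] \<epsilon>[OF gG] r r' True
          by (intro measure_prim_near_set_inter_le[where t = "2 * r" and t' = "2 * r'"]) (auto simp: mult_ac)
        thus ?thesis using False by (simp add: s_def b_def mult_ac)
      qed
    qed
    hence "(\<Sum>f\<in>X. \<Sum>g\<in>X. measure lborel (A f \<inter> A g \<inter> cube a (1 / 2 ^ j))) \<le>
        (\<Sum>f\<in>X. \<Sum>g\<in>X. 6 ^ CARD('n) * b * (s f * s g) + (if f = g then s f else 0))"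
      by (intro sum_mono) auto
    also have "\<dots> = 6 ^ CARD('n) * b * (\<Sum>f\<in>X. \<Sum>g\<in>X. s f * s g) + (\<Sum>f\<in>X. \<Sum>g\<in>X. if f = g then s f else 0)"
      by (simp only: sum.distrib sum_distrib_left)
    also have "\<dots> = 6 ^ CARD('n) * b * (sum s X)\<^sup>2 + sum s X"
      using X by (simp add: power2_eq_square sum_product)
    also have "\<dots> \<le> 6 ^ CARD('n) * b * (sum s X)\<^sup>2 + 2 * sum s X"
    proof -
      have "0 \<le> sum s X" using X Q(1) s by (intro sum_nonneg) blast
      thus ?thesis by simp
    qed
    finally show ?thesis by (simp add: b_def)
  next
    case False
    \<comment> \<open>A second coordinate of q lies in a block other than
      \<open>{i\<^sub>0}\<close>. Members of \<open>G\<close> are primitive on it, which makes them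
      pairwise non-collinear.\<close>
    then obtain i\<^sub>1 where "i\<^sub>1 \<noteq> i\<^sub>0" by auto
    moreover obtain C where C: "C \<in> \<P>" "i\<^sub>1 \<in> C" using partition_onD1[OF \<P>] by blast
    ultimately have C': "C \<in> \<P> - {{i\<^sub>0}}" by auto
    have XG: "f \<in> G" if "f \<in> X" for f using X Q that by blast
    have cube_sub: "cube a (1 / 2 ^ j) \<subseteq> cube a 1"
    proof -
      have "(1::real) / 2 ^ j \<le> 1" by simp
      thus ?thesis unfolding cube_def by (force intro: less_le_trans)
    qed
    have "(\<Sum>f\<in>X. \<Sum>g\<in>X. measure lborel (A f \<inter> A g \<inter> cube a (1 / 2 ^ j))) \<le>
      2 * measure lborel (cube a (1 / 2 ^ j)) * (sum s X)\<^sup>2 + 2 * sum s X"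
      unfolding s_def
    proof (rule sum_measure_inter_subset_cube_le[OF X(1), where q = int_vec])
      show "0 \<le> \<epsilon> f \<and> \<epsilon> f \<le> 1 / 4" if "f \<in> X" for f using \<epsilon>[OF XG[OF that]] by simp
      show "int_vec f \<noteq> 0" if "f \<in> X" for f using int_vec_nonzero[of f] G[OF XG[OF that]] by simp
      show "\<exists>i j. int_vec f $ i * int_vec g $ j \<noteq> int_vec f $ j * int_vec g $ i"
        if "f \<in> X" "g \<in> X" "f \<noteq> g" for f g
        using XG[OF that(1)] XG[OF that(2)] C' that(3) by (intro int_vec_noncollinear[of f C g]) (auto simp: G_def)
      show "A f \<subseteq> near_set (int_vec f) 1 (\<epsilon> f)" for f unfolding A_def by (rule prim_near_set_subset)
    qed (use cube_sub in auto)
    also have "\<dots> \<le> 6 ^ CARD('n) * measure lborel (cube a (1 / 2 ^ j)) * (sum s X)\<^sup>2 + 2 * sum s X"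
      using six by (intro add_right_mono mult_right_mono) auto
    finally show ?thesis .
  qed
  have cubes: "(1 / 50)\<^sup>2 / 6 ^ CARD('n) * measure lborel (cube a (1 / 2 ^ j)) \<le> measure lborel (W \<inter> cube a (1 / 2 ^ j))" for a j
  proof -
    have "(1 / 50)\<^sup>2 / 6 ^ CARD('n) * measure lborel (cube a (1 / 2 ^ j)) \<le>
       measure lborel {\<Theta> \<in> cube a (1 / 2 ^ j). \<forall>k. \<exists>f\<in>Q j. Max (range f) > k \<and> \<Theta> \<in> A f}"
    proof (rule measure_limsup_ge[where s = s and C' = 2])
      show "countable (Q j)" by (rule countable_subset[OF subset_UNIV]) simp
      show "1 / 50 * s f * measure lborel (cube a (1 / 2 ^ j)) \<le> measure lborel (A f \<inter> cube a (1 / 2 ^ j))"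
        if f: "f \<in> Q j" for f
      proof -
        obtain r where "f i\<^sub>0 = 2 ^ Suc j * r" "few_divisors r" using Q(2)[OF f] by blast
        thus ?thesis unfolding s_def A_def using \<epsilon>[OF Q(1)[OF f]]
          by (intro measure_prim_near_set_ge[where r = r]) auto
      qed
      show "\<exists>X. finite X \<and> X \<subseteq> {f \<in> Q j. k < Max (range f)} \<and> R \<le> sum s X" for k R
        unfolding s_def by (rule tails)
    qed (use upper s Q in \<open>auto simp: emeasure_cube\<close>)
    also have "\<dots> \<le> measure lborel (W \<inter> cube a (1 / 2 ^ j))"
    proof (rule measure_mono_fmeasurable)
      show "{\<Theta> \<in> cube a (1 / 2 ^ j). \<forall>k. \<exists>f\<in>Q j. Max (range f) > k \<and> \<Theta> \<in> A f} \<subseteq> W \<inter> cube a (1 / 2 ^ j)"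
        using Q(1) by (fastforce simp: W_def)
      have "{\<Theta> \<in> cube a (1 / 2 ^ j). \<forall>k. \<exists>f\<in>Q j. Max (range f) > k \<and> \<Theta> \<in> A f} =
          cube a (1 / 2 ^ j) \<inter> (\<Inter>k. \<Union>f\<in>{f\<in>Q j. Max (range f) > k}. A f)" by auto
      also have "\<dots> \<in> sets lborel"
        by (intro sets.Int sets.countable_INT' sets.countable_UN') (auto intro: countable_subset[OF subset_UNIV])
      finally show "{\<Theta> \<in> cube a (1 / 2 ^ j). \<forall>k. \<exists>f\<in>Q j. Max (range f) > k \<and> \<Theta> \<in> A f} \<in> sets lborel" .
      show "W \<inter> cube a (1 / 2 ^ j) \<in> fmeasurable lborel"
        using W_sets by (intro fmeasurableI2[OF fmeasurable_cube[of "1 / 2 ^ j" a]]) auto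
    qed
    finally show ?thesis .
  qed
  have "AE \<Theta> in lborel. \<Theta> \<in> W"
    by (rule AE_lborel_if_cubes[OF W_sets _ cubes]) simp
  thus ?thesis
  proof eventually_elim
    case (elim \<Theta>)
    show ?case
    proof (rule infinite_solutions)
      fix k
      obtain f where f: "f \<in> G" "Max (range f) > k" "\<Theta> \<in> A f" using elim by (auto simp: W_def)
      then obtain p :: "int ^ 'n" where p: "Gcd (insert (int_vec f $ i\<^sub>0) (range (\<lambda>r. p $ r))) = 1"
        "infnorm (\<Theta> *v real_vec (int_vec f) + real_vec p) \<le> \<epsilon> f"
        unfolding A_def prim_near_set_def by blast
      have "Gcd ((\<lambda>i. stack (int_vec f) p $ i) ` B) = 1" if B: "B \<in> \<pi>" for B
      proof (cases "B = B\<^sub>0")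
        case True
        have "(\<lambda>i. stack (int_vec f) p $ i) ` B = insert (int_vec f $ i\<^sub>0) (range (\<lambda>r. p $ r))"
          by (simp add: True B\<^sub>0(2) stack_def image_image)
        thus ?thesis using p(1) by simp
      next
        case False
        hence "Inl -` B \<in> \<P> - {{i\<^sub>0}}" using card[OF B] B by (auto simp: \<P>_def)
        thus ?thesis using f(1) by (intro Gcd_stack_eq_1) (auto simp: G_def)
      qed
      hence "stack (int_vec f) p \<in> primitive_points \<pi>" by (simp add: primitive_points_def)
      thus "\<exists>f. Max (range f) > k \<and> (\<exists>p. stack (int_vec f) p \<in> primitive_points \<pi> \<and>
        infnorm (\<Theta> *v real_vec (int_vec f) + real_vec p) \<le> \<psi> (Max (range f)))"
        using f p by (auto simp: \<epsilon>_def)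
    qed
  qed
qed

theorem theorem1p2:
  fixes \<pi> :: "('m::finite + 'n::finite) set set"
    and \<psi> :: "nat \<Rightarrow> real"
  assumes "partition_on UNIV \<pi>"
    and "\<forall>B\<in>\<pi>. card B \<ge> CARD('n) + 1"
    and "\<forall>x\<ge>1. \<psi> x > 0"
    and "antimono_on {1..} (\<lambda>x. real x ^ (CARD('m) - 1) * \<psi> x ^ CARD('n))"
  shows "(\<not> summable (\<lambda>j. real (Suc j) ^ (CARD('m) - 1) * \<psi> (Suc j) ^ CARD('n)) \<longrightarrow>
          (AE \<Theta> :: real ^ 'm ^ 'n in lebesgue.
             infinite {(q :: int ^ 'm, p :: int ^ 'n).
               stack q p \<in> primitive_points \<pi> \<and> q \<noteq> 0 \<and>
               infnorm (\<Theta> *v real_vec q + real_vec p) \<le> \<psi> (int_supnorm q)}))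
       \<and> (summable (\<lambda>j. real (Suc j) ^ (CARD('m) - 1) * \<psi> (Suc j) ^ CARD('n)) \<longrightarrow>
          (AE \<Theta> :: real ^ 'm ^ 'n in lebesgue.
             finite {(q :: int ^ 'm, p :: int ^ 'n).
               q \<noteq> 0 \<and> infnorm (\<Theta> *v real_vec q + real_vec p) \<le> \<psi> (int_supnorm q)}))"
proof (intro conjI impI)
  assume "summable (\<lambda>j. real (Suc j) ^ (CARD('m) - 1) * \<psi> (Suc j) ^ CARD('n))"
  thus "AE \<Theta> :: real ^ 'm ^ 'n in lebesgue. finite {(q :: int ^ 'm, p :: int ^ 'n).
      q \<noteq> 0 \<and> infnorm (\<Theta> *v real_vec q + real_vec p) \<le> \<psi> (int_supnorm q)}"
    using assms(3) by (intro AE_completion AE_finite_if_summable) auto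
next
  assume diverge: "\<not> summable (\<lambda>j. real (Suc j) ^ (CARD('m) - 1) * \<psi> (Suc j) ^ CARD('n))"
  have card_split: "card B = card (Inl -` B) + card (Inr -` B)" for B :: "('m + 'n) set"
  proof -
    have "B = Inl ` (Inl -` B) \<union> Inr ` (Inr -` B)"
      by (auto simp: image_iff) (metis sum.exhaust)
    hence "card B = card (Inl ` (Inl -` B) \<union> Inr ` (Inr -` B))" by simp
    also have "\<dots> = card (Inl ` (Inl -` B) :: ('m + 'n) set) + card (Inr ` (Inr -` B) :: ('m + 'n) set)"
      by (intro card_Un_disjoint) auto
    also have "\<dots> = card (Inl -` B) + card (Inr -` B)"
      by (intro arg_cong2[where f = "(+)"] card_image) (auto simp: inj_on_def)
    finally show ?thesis .
  qed
  have card_Inr: "card (Inr -` B) \<le> CARD('n)" for B :: "('m + 'n) set"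
    by (intro card_mono) auto
  show "AE \<Theta> :: real ^ 'm ^ 'n in lebesgue. infinite {(q :: int ^ 'm, p :: int ^ 'n).
      stack q p \<in> primitive_points \<pi> \<and> q \<noteq> 0 \<and> infnorm (\<Theta> *v real_vec q + real_vec p) \<le> \<psi> (int_supnorm q)}"
  proof (rule AE_completion, cases "\<forall>B\<in>\<pi>. card (Inl -` B) \<ge> 2")
    case True
    thus "AE \<Theta> :: real ^ 'm ^ 'n in lborel. infinite {(q :: int ^ 'm, p :: int ^ 'n).
      stack q p \<in> primitive_points \<pi> \<and> q \<noteq> 0 \<and> infnorm (\<Theta> *v real_vec q + real_vec p) \<le> \<psi> (int_supnorm q)}"
      using assms diverge by (intro AE_infinite_if_blocks_ge_2) auto
  next
    case False
    then obtain B\<^sub>0 where B\<^sub>0: "B\<^sub>0 \<in> \<pi>" "card (Inl -` B\<^sub>0) < 2" by (auto simp: not_le)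
    have "card B\<^sub>0 \<ge> CARD('n) + 1" using assms(2) B\<^sub>0(1) by blast
    \<comment> \<open>At most n of the at least n + 1 elements belong to p, so exactly one belongs
      to q and all of p is used up.\<close>
    hence "card (Inl -` B\<^sub>0) = 1" "card (Inr -` B\<^sub>0) = CARD('n)"
      using card_split[of B\<^sub>0] card_Inr[of B\<^sub>0] B\<^sub>0(2) by linarith+
    then obtain i\<^sub>0 where i\<^sub>0: "Inl -` B\<^sub>0 = {i\<^sub>0}" and Inr: "Inr -` B\<^sub>0 = UNIV"
      by (metis card_1_singletonE card_subset_eq finite subset_UNIV)
    have B\<^sub>0_eq: "B\<^sub>0 = insert (Inl i\<^sub>0) (range Inr)"
    proof (rule set_eqI)
      fix x show "x \<in> B\<^sub>0 \<longleftrightarrow> x \<in> insert (Inl i\<^sub>0) (range Inr)"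
        using i\<^sub>0 Inr by (cases x) (auto simp: set_eq_iff)
    qed
    \<comment> \<open>The exceptional block contains all of p, so any other block consists of at
      least n + 1 >= 2 coordinates of q.\<close>
    have "card (Inl -` B) \<ge> 2" if "B \<in> \<pi>" "B \<noteq> B\<^sub>0" for B
    proof -
      have "B \<inter> B\<^sub>0 = {}" using disjointD[OF partition_onD2[OF assms(1)] that(1) B\<^sub>0(1) that(2)] .
      hence "Inr -` B = {}" using B\<^sub>0_eq by auto
      hence "card B = card (Inl -` B)" using card_split[of B] by simp
      moreover have "card B \<ge> CARD('n) + 1" using assms(2) that(1) by blast
      moreover have "CARD('n) \<ge> 1" by (simp add: Suc_le_eq)
      ultimately show ?thesis by linarith
    qed
    thus "AE \<Theta> :: real ^ 'm ^ 'n in lborel. infinite {(q :: int ^ 'm, p :: int ^ 'n).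
      stack q p \<in> primitive_points \<pi> \<and> q \<noteq> 0 \<and> infnorm (\<Theta> *v real_vec q + real_vec p) \<le> \<psi> (int_supnorm q)}"
      using assms diverge B\<^sub>0(1) B\<^sub>0_eq by (intro AE_infinite_if_mixed_block[of \<pi> B\<^sub>0 i\<^sub>0 \<psi>]) auto
  qed
qed

end
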